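(* Each $\mathcal{Q}'_\alpha$ lies in $\mathbb{Q}[q]\otimes\mathrm{NSym}$, and for every $n$ the set $\{\mathcal{Q}'_\alpha:\alpha\models n\}$ is a basis of $\mathbb{Q}(q)\otimes\mathrm{NSym}_n$ over $\mathbb{Q}(q)$. When $\alpha=\lambda$ is a partition, $\chi(\mathcal{Q}'_\lambda)=Q'_\lambda$. Moreover, for every composition $\alpha$, specializing $q=1$ gives $\mathcal{Q}'_\alpha=H_\alpha$ and specializing $q=0$ gives $\mathcal{Q}'_\alpha=\mathfrak{S}_\alpha$.
   Context: $\mathrm{NSym}$ is the free associative graded algebra over $\mathbb{Q}$ on $H_1,H_2,\dots$ ($H_\alpha=H_{\alpha_1}\cdots H_{\alpha_k}$, $H_0=1$, $H_{-r}=0$ for $r>0$), graded dual to $\mathrm{QSym}$ via $\langle H_\alpha,M_\beta\rangle=\delta_{\alpha\beta}$ ($M_\beta$ monomial quasisymmetric functions), coproduct $\Delta(H_j)=\sum_iH_i\otimes H_{j-i}$. For $F\in\mathrm{QSym}$, $F^\perp$ satisfies $\langle F^\perp(H),G\rangle=\langle H,FG\rangle$ (extended $q$-linearly). $F_i=\sum_{\gamma\models i}M_\gamma$ ($F_0=1$), $F_{1^i}=M_{1^i}$. Let $\mathbb{B}_m=\sum_{i\ge0}(-1)^iH_{m+i}F_{1^i}^\perp$, $\mathfrak{S}_\alpha=\mathbb{B}_{\alpha_1}\cdots\mathbb{B}_{\alpha_m}(1)$, $\widetilde{\mathbb{B}}_m(f)=\sum_{i\ge0}q^i\mathbb{B}_{m+i}(F_i^\perp(f))$,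 and $\mathcal{Q}'_\alpha=\widetilde{\mathbb{B}}_{\alpha_1}\cdots\widetilde{\mathbb{B}}_{\alpha_m}(1)$. $\chi:\mathrm{NSym}\to\mathrm{Sym}$ is the (q-linearly extended) map $H_{\alpha_1}\cdots H_{\alpha_k}\mapsto h_{\alpha_1}\cdots h_{\alpha_k}$. $Q'_\lambda$ is the (modified) Hall–Littlewood symmetric function, i.e. the basis of $\mathbb{Q}(q)\otimes\mathrm{Sym}$ dual under the Hall inner product to the Hall–Littlewood $P_\lambda$; equivalently $Q'_\lambda=\sum_\mu K_{\mu\lambda}(q)s_\mu$ with $K_{\mu\lambda}(q)$ the Kostka–Foulkes polynomials. *)

theory Defs
  imports
    "HOL-Library.Poly_Mapping"
    "HOL-Computational_Algebra.Computational_Algebra"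
    "HOL-Combinatorics.Permutations"
begin

section \<open>Compositions\<close>

text \<open>Compositions form a monoid under concatenation, written additively because
  \<^theory>\<open>HOL-Library.Poly_Mapping\<close> builds monoid algebras over additive monoids.\<close>

typedef composition = "{xs :: nat list. \<forall>x\<in>set xs. 0 < x}"
  morphisms parts Abs_composition
  by (rule exI[of _ "[]"]) simp

setup_lifting type_definition_composition

instantiation composition :: monoid_add
begin

lift_definition zero_composition :: composition is "[]" by simp

lift_definition plus_composition :: "composition \<Rightarrow> composition \<Rightarrow> composition"
  is "(@)" by auto

instance
  by standard (transfer; simp)+

end

lift_definition single_part :: "nat \<Rightarrow> composition" is "\<lambda>r. if r = 0 then [] else [r]"
  by (auto split: if_splits)

lift_definition ones :: "nat \<Rightarrow> composition" is "\<lambda>i. replicate i 1"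
  by simp

definition comp_size :: "composition \<Rightarrow> nat"
  where "comp_size \<alpha> = sum_list (parts \<alpha>)"

definition comp_length :: "composition \<Rightarrow> nat"
  where "comp_length \<alpha> = length (parts \<alpha>)"

definition is_partition :: "composition \<Rightarrow> bool"
  where "is_partition \<nu> \<longleftrightarrow> sorted_wrt (\<ge>) (parts \<nu>)"


section \<open>Formal power series in the variables \<open>x\<^sub>0, x\<^sub>1, x\<^sub>2, \<dots>\<close>\<close>

type_synonym monomial = "nat \<Rightarrow>\<^sub>0 nat"

definition mdeg :: "monomial \<Rightarrow> nat"
  where "mdeg m = (\<Sum>i\<in>Poly_Mapping.keys m. Poly_Mapping.lookup m i)"

text \<open>The leading monomial \<open>x\<^sub>0\<^bsup>\<alpha>\<^sub>1\<^esup> x\<^sub>1\<^bsup>\<alpha>\<^sub>2\<^esup> \<dots>\<close> of a composition.\<close>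

definition comp_monomial :: "composition \<Rightarrow> monomial"
  where "comp_monomial \<alpha> = Poly_Mapping.nth (parts \<alpha>)"

text \<open>The nonzero exponents of a monomial, in increasing order of the variables.\<close>

definition exponents :: "monomial \<Rightarrow> nat list"
  where "exponents m =
    map (Poly_Mapping.lookup m) (sorted_list_of_set (Poly_Mapping.keys m))"

typedef 'a mps = "UNIV :: (monomial \<Rightarrow> 'a) set"
  morphisms mps_coeff Abs_mps ..

setup_lifting type_definition_mps

lemma mps_eqI: "(\<And>m. mps_coeff f m = mps_coeff g m) \<Longrightarrow> f = g"
  by transfer auto

definition splits :: "monomial \<Rightarrow> (monomial \<times> monomial) set"
  where "splits m = {(a, b). a + b = m}"

lemma finite_monomial_le: "finite {a :: monomial. \<exists>b. a + b = m}"
proof -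
  define A where "A = {a :: monomial. \<exists>b. a + b = m}"
  let ?K = "Poly_Mapping.keys m"
  define N where "N = (\<Sum>i\<in>?K. Poly_Mapping.lookup m i)"
  have le: "Poly_Mapping.lookup a i \<le> Poly_Mapping.lookup m i" if "a \<in> A" for a i
    using that by (auto simp: A_def lookup_add)
  have "Poly_Mapping.lookup ` A \<subseteq> {f. \<forall>i. (i \<in> ?K \<longrightarrow> f i \<in> {..N}) \<and> (i \<notin> ?K \<longrightarrow> f i = 0)}"
  proof safe
    fix a i assume a: "a \<in> A" and i: "i \<in> ?K"
    have "Poly_Mapping.lookup m i \<le> N"
      unfolding N_def using i by (intro member_le_sum) auto
    then show "Poly_Mapping.lookup a i \<le> N" using le[OF a, of i] by simp
  next
    fix a i assume a: "a \<in> A" and i: "i \<notin> ?K"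
    then show "Poly_Mapping.lookup a i = 0"
      using le[OF a, of i] by (simp add: in_keys_iff)
  qed
  moreover have "finite {f :: nat \<Rightarrow> nat. \<forall>i. (i \<in> ?K \<longrightarrow> f i \<in> {..N}) \<and> (i \<notin> ?K \<longrightarrow> f i = 0)}"
    by (rule finite_set_of_finite_funs) auto
  ultimately have "finite (Poly_Mapping.lookup ` A)"
    by (rule finite_subset)
  then have "finite A"
    by (rule finite_imageD) (auto intro!: inj_onI poly_mapping_eqI)
  then show ?thesis by (simp add: A_def)
qed

lemma finite_splits [simp]: "finite (splits m)"
proof (rule finite_subset)
  show "splits m \<subseteq> {a. \<exists>b. a + b = m} \<times> {a. \<exists>b. a + b = m}"
    by (auto simp: splits_def intro: add.commute)
  show "finite ({a. \<exists>b. a + b = m} \<times> {a :: monomial. \<exists>b. a + b = m})"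
    by (intro finite_cartesian_product finite_monomial_le)
qed

instantiation mps :: (comm_ring_1) comm_ring_1
begin

lift_definition zero_mps :: "'a mps" is "\<lambda>_. 0" .

lift_definition one_mps :: "'a mps" is "\<lambda>m. if m = 0 then 1 else 0" .

lift_definition plus_mps :: "'a mps \<Rightarrow> 'a mps \<Rightarrow> 'a mps" is "\<lambda>f g m. f m + g m" .

lift_definition minus_mps :: "'a mps \<Rightarrow> 'a mps \<Rightarrow> 'a mps" is "\<lambda>f g m. f m - g m" .

lift_definition uminus_mps :: "'a mps \<Rightarrow> 'a mps" is "\<lambda>f m. - f m" .

lift_definition times_mps :: "'a mps \<Rightarrow> 'a mps \<Rightarrow> 'a mps"
  is "\<lambda>f g m. \<Sum>(a, b)\<in>splits m. f a * g b" .

instance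
proof
  fix f g h :: "'a mps"
  show "f + g + h = f + (g + h)" "f + g = g + f" "0 + f = f" "- f + f = 0" "f - g = f + - g"
    by (transfer; simp add: fun_eq_iff algebra_simps)+
  show "(0 :: 'a mps) \<noteq> 1"
    by transfer (auto simp: fun_eq_iff)
  show "f * g * h = f * (g * h)"
  proof (rule mps_eqI)
    fix m
    have "mps_coeff (f * g * h) m =
        (\<Sum>(u, c)\<in>splits m. \<Sum>(a, b)\<in>splits u. mps_coeff f a * mps_coeff g b * mps_coeff h c)"
      by (simp add: times_mps.rep_eq sum_distrib_right case_prod_unfold)
    also have "\<dots> = (\<Sum>((u, c), (a, b))\<in>(SIGMA p:splits m. splits (fst p)).
        mps_coeff f a * mps_coeff g b * mps_coeff h c)"
      by (subst sum.Sigma[symmetric]) (auto simp: case_prod_unfold)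
    also have "\<dots> = (\<Sum>((a, v), (b, c))\<in>(SIGMA p:splits m. splits (snd p)).
        mps_coeff f a * mps_coeff g b * mps_coeff h c)"
      by (rule sum.reindex_bij_witness
          [where i = "\<lambda>((a, v), (b, c)). ((a + b, c), (a, b))"
             and j = "\<lambda>((u, c), (a, b)). ((a, b + c), (b, c))"])
         (auto simp: splits_def ac_simps)
    also have "\<dots> = (\<Sum>(a, v)\<in>splits m. \<Sum>(b, c)\<in>splits v. mps_coeff f a * mps_coeff g b * mps_coeff h c)"
      by (subst sum.Sigma[symmetric]) (auto simp: case_prod_unfold)
    also have "\<dots> = mps_coeff (f * (g * h)) m"
      by (simp add: times_mps.rep_eq sum_distrib_left case_prod_unfold mult.assoc)
    finally show "mps_coeff (f * g * h) m = mps_coeff (f * (g * h)) m" .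
  qed
  show "f * g = g * f"
  proof (rule mps_eqI)
    fix m
    show "mps_coeff (f * g) m = mps_coeff (g * f) m"
      unfolding times_mps.rep_eq
      by (rule sum.reindex_bij_witness[where i = "\<lambda>(a, b). (b, a)" and j = "\<lambda>(a, b). (b, a)"])
         (auto simp: splits_def ac_simps)
  qed
  show "(f + g) * h = f * h + g * h"
    by transfer (simp add: fun_eq_iff distrib_right sum.distrib case_prod_unfold)
  show "1 * f = f"
  proof (rule mps_eqI)
    fix m
    have "mps_coeff (1 * f) m = (\<Sum>(a, b)\<in>splits m. if a = 0 then mps_coeff f b else 0)"
      unfolding times_mps.rep_eq one_mps.rep_eq by (intro sum.cong) auto
    also have "\<dots> = (\<Sum>(a, b)\<in>{(0 :: monomial, m)}. if a = 0 then mps_coeff f b else 0)"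
    proof (rule sum.mono_neutral_right)
      show "{(0, m)} \<subseteq> splits m" by (simp add: splits_def)
      show "\<forall>p\<in>splits m - {(0, m)}. (case p of (a, b) \<Rightarrow> if a = 0 then mps_coeff f b else 0) = 0"
        by (auto simp: splits_def split: if_splits)
    qed simp
    finally show "mps_coeff (1 * f) m = mps_coeff f m" by simp
  qed
qed

end

lift_definition mps_scale :: "'a :: comm_ring_1 \<Rightarrow> 'a mps \<Rightarrow> 'a mps"
  is "\<lambda>c f m. c * f m" .

interpretation MPS: vector_space "mps_scale :: 'a :: field \<Rightarrow> 'a mps \<Rightarrow> 'a mps"
  by standard (transfer; simp add: algebra_simps)+

definition bounded_degree :: "'a :: comm_ring_1 mps \<Rightarrow> bool"
  where "bounded_degree f \<longleftrightarrow> (\<exists>d. \<forall>m. mps_coeff f m \<noteq> 0 \<longrightarrow> mdeg m \<le> d)"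


section \<open>Quasisymmetric functions\<close>

definition QM :: "composition \<Rightarrow> 'a :: comm_ring_1 mps"
  where "QM \<beta> = Abs_mps (\<lambda>m. if exponents m = parts \<beta> then 1 else 0)"

definition QSym :: "'a :: field mps set"
  where "QSym = MPS.span (range QM)"

definition QF :: "nat \<Rightarrow> 'a :: comm_ring_1 mps"
  where "QF i = (\<Sum>\<gamma> | comp_size \<gamma> = i. QM \<gamma>)"

definition QF_ones :: "nat \<Rightarrow> 'a :: comm_ring_1 mps"
  where "QF_ones i = QM (ones i)"


section \<open>Noncommutative symmetric functions\<close>

text \<open>The free associative algebra on \<open>H\<^sub>1, H\<^sub>2, \<dots>\<close> is the monoid algebra of the free monoid
  of compositions.\<close>

type_synonym 'a nsym = "composition \<Rightarrow>\<^sub>0 'a"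

definition nsym_scale :: "'a :: comm_ring_1 \<Rightarrow> 'a nsym \<Rightarrow> 'a nsym"
  where "nsym_scale c = Poly_Mapping.map ((*) c)"

lemma lookup_nsym_scale [simp]:
  "Poly_Mapping.lookup (nsym_scale c f) \<alpha> = c * Poly_Mapping.lookup f \<alpha>"
  by (simp add: nsym_scale_def Poly_Mapping.map.rep_eq when_def)

interpretation NSym: vector_space "nsym_scale :: 'a :: field \<Rightarrow> 'a nsym \<Rightarrow> 'a nsym"
  by standard (auto intro!: poly_mapping_eqI simp: lookup_add algebra_simps)

definition H_comp :: "composition \<Rightarrow> 'a :: comm_ring_1 nsym"
  where "H_comp \<alpha> = Poly_Mapping.single \<alpha> 1"

definition H_gen :: "int \<Rightarrow> 'a :: comm_ring_1 nsym"
  where "H_gen r = (if r < 0 then 0 else H_comp (single_part (nat r)))"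

definition NSym_deg :: "nat \<Rightarrow> 'a :: field nsym set"
  where "NSym_deg n = NSym.span (H_comp ` {\<alpha>. comp_size \<alpha> = n})"

text \<open>The bilinear pairing with QSym given by \<open>\<langle>H\<^sub>\<alpha>, M\<^sub>\<beta>\<rangle> = \<delta>\<^sub>\<alpha>\<^sub>\<beta>\<close>.  For \<open>G\<close> in QSym the coefficient
  of \<open>M\<^sub>\<alpha>\<close> in \<open>G\<close> is its coefficient at the leading monomial of \<open>\<alpha>\<close>.\<close>

definition pairing :: "'a :: comm_ring_1 nsym \<Rightarrow> 'a mps \<Rightarrow> 'a"
  where "pairing f G = (\<Sum>\<alpha>\<in>Poly_Mapping.keys f.
    Poly_Mapping.lookup f \<alpha> * mps_coeff G (comp_monomial \<alpha>))"

lemma exponents_comp_monomial: "exponents (comp_monomial \<alpha>) = parts \<alpha>"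
proof -
  have pos: "\<forall>x\<in>set (parts \<alpha>). 0 < x" using parts[of \<alpha>] by simp
  then have "Poly_Mapping.keys (comp_monomial \<alpha>) = {0..<length (parts \<alpha>)}"
    by (auto simp: comp_monomial_def in_keys_iff Poly_Mapping.nth.rep_eq nth_default_def
        simp del: keys_nth split: if_splits)
  then have "exponents (comp_monomial \<alpha>)
      = map (Poly_Mapping.lookup (comp_monomial \<alpha>)) [0..<length (parts \<alpha>)]"
    by (simp add: exponents_def)
  also have "\<dots> = map ((!) (parts \<alpha>)) [0..<length (parts \<alpha>)]"
    by (auto simp: comp_monomial_def Poly_Mapping.nth.rep_eq nth_default_def)
  finally show ?thesis by (simp add: map_nth)
qed

lemma pairing_H_comp_QM:
  "pairing (H_comp \<alpha>) (QM \<beta>) = (if \<alpha> = \<beta> then 1 else (0 :: 'a :: comm_ring_1))"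
  by (simp add: pairing_def H_comp_def QM_def Abs_mps_inverse exponents_comp_monomial parts_inject)

definition perp :: "'a :: field mps \<Rightarrow> 'a nsym \<Rightarrow> 'a nsym"
  where "perp F f = (THE f'. \<forall>G\<in>QSym. pairing f' G = pairing f (F * G))"

text \<open>The sums below are locally finite: \<^const>\<open>Sum_any\<close> sums over the indices with nonzero
  terms, and \<open>F\<^sub>i\<^sup>\<bottom>\<close> and \<open>F\<^bsub>1^i\<^esub>\<^sup>\<bottom>\<close> vanish on elements of degree less than \<open>i\<close>.\<close>

definition B_op :: "int \<Rightarrow> 'a :: field nsym \<Rightarrow> 'a nsym"
  where "B_op m f = Sum_any (\<lambda>i::nat. (-1) ^ i * H_gen (m + int i) * perp (QF_ones i) f)"

definition immaculate :: "composition \<Rightarrow> rat nsym"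
  where "immaculate \<alpha> = foldr (\<lambda>a. B_op (int a)) (parts \<alpha>) 1"

type_synonym ratfun = "rat poly fract"

definition qvar :: ratfun
  where "qvar = to_fract (monom 1 1)"

definition Bt_op :: "int \<Rightarrow> ratfun nsym \<Rightarrow> ratfun nsym"
  where "Bt_op m f = Sum_any (\<lambda>i::nat. nsym_scale (qvar ^ i) (B_op (m + int i) (perp (QF i) f)))"

definition HL_nsym :: "composition \<Rightarrow> ratfun nsym"
  where "HL_nsym \<alpha> = foldr (\<lambda>a. Bt_op (int a)) (parts \<alpha>) 1"

text \<open>The inclusion of \<open>\<rat>[q] \<otimes> NSym\<close> into \<open>\<rat>(q) \<otimes> NSym\<close>.  Specialization of \<open>q\<close> is
  defined on its image.\<close>

definition nsym_of_poly :: "rat poly nsym \<Rightarrow> ratfun nsym"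
  where "nsym_of_poly = Poly_Mapping.map to_fract"

definition specialize :: "rat \<Rightarrow> ratfun nsym \<Rightarrow> rat nsym"
  where "specialize c f = Poly_Mapping.map (\<lambda>p. poly p c) (inv nsym_of_poly f)"


section \<open>Symmetric functions\<close>

definition Sym :: "'a :: field mps set"
  where "Sym = {f. bounded_degree f \<and>
    (\<forall>\<pi> m. bij \<pi> \<longrightarrow> mps_coeff f (Poly_Mapping.map_key \<pi> m) = mps_coeff f m)}"

definition h_gen :: "nat \<Rightarrow> 'a :: comm_ring_1 mps"
  where "h_gen r = Abs_mps (\<lambda>m. if mdeg m = r then 1 else 0)"

definition h_comp :: "composition \<Rightarrow> 'a :: comm_ring_1 mps"
  where "h_comp \<alpha> = prod_list (map h_gen (parts \<alpha>))"

definition chi :: "'a :: comm_ring_1 nsym \<Rightarrow> 'a mps"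
  where "chi f = (\<Sum>\<alpha>\<in>Poly_Mapping.keys f. mps_scale (Poly_Mapping.lookup f \<alpha>) (h_comp \<alpha>))"

text \<open>The Hall inner product, given by \<open>\<langle>h\<^sub>\<nu>, m\<^sub>\<mu>\<rangle> = \<delta>\<^sub>\<nu>\<^sub>\<mu>\<close>: the left argument is expanded in
  the basis \<open>h\<^sub>\<nu>\<close>, and the coefficient of \<open>m\<^sub>\<nu>\<close> in a symmetric function is its coefficient at
  \<open>x\<^sup>\<nu>\<close>.\<close>

definition hall :: "'a :: field mps \<Rightarrow> 'a mps \<Rightarrow> 'a"
  where "hall f g = Sum_any (\<lambda>\<nu>. if is_partition \<nu>
    then MPS.representation (h_comp ` Collect is_partition) f (h_comp \<nu>) * mps_coeff g (comp_monomial \<nu>)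
    else 0)"


subsection \<open>Hall--Littlewood functions\<close>

type_synonym poly_ratfun = "((nat \<Rightarrow>\<^sub>0 nat) \<Rightarrow>\<^sub>0 ratfun) fract"

definition xvar :: "nat \<Rightarrow> poly_ratfun"
  where "xvar i = to_fract (Poly_Mapping.single (Poly_Mapping.single i 1) 1)"

definition const_poly :: "ratfun \<Rightarrow> poly_ratfun"
  where "const_poly c = to_fract (Poly_Mapping.single 0 c)"

text \<open>\<open>f(x\<^sub>0, \<dots>, x\<^bsub>n-1\<^esub>, 0, 0, \<dots>)\<close>, for \<open>f\<close> of bounded degree.\<close>

definition restrict_vars :: "nat \<Rightarrow> ratfun mps \<Rightarrow> (nat \<Rightarrow>\<^sub>0 nat) \<Rightarrow>\<^sub>0 ratfun"
  where "restrict_vars n f = Abs_poly_mapping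
    (\<lambda>m. if Poly_Mapping.keys m \<subseteq> {..<n} then mps_coeff f m else 0)"

text \<open>The \<open>i\<close>-th part of \<open>\<nu>\<close>, counted from 0 and padded with zeros.\<close>

definition part :: "composition \<Rightarrow> nat \<Rightarrow> nat"
  where "part \<nu> i = nth_default 0 (parts \<nu>) i"

text \<open>\<open>v\<^sub>\<nu>(q) = \<Prod>\<^bsub>i\<ge>0\<^esub> \<Prod>\<^bsub>1\<le>j\<le>m\<^sub>i\<^esub> (1 - q\<^sup>j) / (1 - q)\<close>, where \<open>m\<^sub>i\<close> is the multiplicity of
  \<open>i\<close> in \<open>\<nu>\<close> padded with zeros to length \<open>n\<close>.\<close>

definition HL_v :: "nat \<Rightarrow> composition \<Rightarrow> ratfun"
  where "HL_v n \<nu> = (\<Prod>i\<le>comp_size \<nu>. \<Prod>j = 1..card {k. k < n \<and> part \<nu> k = i}.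
    (1 - qvar ^ j) / (1 - qvar))"

text \<open>The Hall--Littlewood polynomial \<open>P\<^sub>\<nu>(x\<^sub>0, \<dots>, x\<^bsub>n-1\<^esub>; q)\<close> as a sum over the symmetric
  group.\<close>

definition HL_P_vars :: "nat \<Rightarrow> composition \<Rightarrow> poly_ratfun"
  where "HL_P_vars n \<nu> = (\<Sum>w | w permutes {..<n}.
      (\<Prod>i<n. xvar (w i) ^ part \<nu> i) *
      (\<Prod>i<n. \<Prod>j\<in>{i<..<n}. (xvar (w i) - const_poly qvar * xvar (w j)) / (xvar (w i) - xvar (w j))))
    / const_poly (HL_v n \<nu>)"

definition HL_P :: "composition \<Rightarrow> ratfun mps"
  where "HL_P \<nu> = (THE f. f \<in> Sym \<and>
    (\<forall>n\<ge>comp_length \<nu>. to_fract (restrict_vars n f) = HL_P_vars n \<nu>))"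

definition HL_Q' :: "composition \<Rightarrow> ratfun mps"
  where "HL_Q' \<nu> = (THE f. f \<in> Sym \<and>
    (\<forall>\<mu>. is_partition \<mu> \<longrightarrow> hall f (HL_P \<mu>) = (if \<mu> = \<nu> then 1 else 0)))"

end

theory Submission
  imports Defs
begin

text \<open>The coefficient of \<open>H\<^sub>\<beta>\<close> in an element of NSym is its pairing with \<open>M\<^sub>\<beta>\<close>, so the
  claims about NSym follow from a formula for the pairing of \<open>Q'\<^sub>\<alpha>\<close> with a quasisymmetric \<open>G\<close>.  The adjoint of
  \<open>B\<^sub>m\<close> (with parameter \<open>q\<close>) takes the coefficient of \<open>x\<^sub>0\<^sup>m\<close> in
  \<open>G(x\<^sub>0, x\<^sub>1, \<dots>) \<Prod>\<^sub>i (1 - x\<^sub>i / x\<^sub>0) / (1 - q x\<^sub>i / x\<^sub>0)\<close>; iterating, the pairing is the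
  coefficient of \<open>x\<^sup>\<alpha>\<close> in \<open>G \<Prod>\<^bsub>a<b\<^esub> (1 - x\<^sub>b / x\<^sub>a) / (1 - q x\<^sub>b / x\<^sub>a)\<close>.  This is polynomial in
  \<open>q\<close>, equals the coefficient of \<open>x\<^sup>\<alpha>\<close> in \<open>G\<close> at \<open>q = 1\<close>, and is unitriangular because each ratio
  \<open>x\<^sub>b / x\<^sub>a\<close> raises the height \<open>\<Sum>\<^sub>i (i + 1) \<alpha>\<^sub>i\<close>.

  By triangularity there are symmetric \<open>G\<^sub>\<mu>\<close> dual to the \<open>Q'\<^sub>\<lambda>\<close>, and the claim about partitions
  amounts to \<open>G\<^sub>\<mu> = P\<^sub>\<mu>\<close>.  Multiplied by the Vandermonde product both sides become antisymmetric
  polynomials, which are determined by the coefficients of \<open>x\<^bsup>\<lambda>+\<delta>\<^esup>\<close> after division by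
  \<open>\<Prod>\<^bsub>a<b\<^esub> (x\<^sub>a - q x\<^sub>b)\<close>.  For \<open>P\<^sub>\<mu>\<close> these come from \<open>x\<^bsup>w\<mu>\<^esup> \<Prod> (q - y) / (1 - q y)\<close>, the product
  running over the ratios \<open>y = x\<^sub>b / x\<^sub>a\<close> inverted by \<open>w\<close>.  Comparing heights before and after
  applying the inverse of \<open>w\<close> forces \<open>\<lambda> = w\<mu> = \<mu>\<close>, and what remains is the Poincare polynomial of
  the stabilizer of \<open>\<mu>\<close>.\<close>

text \<open>\<open>HL_P\<close> is a definite description: one symmetric series whose restriction to
  \<open>n\<close> variables is a given rational function for every large \<open>n\<close>.
  Polynomiality of the symmetrization and its stability in \<open>n\<close> therefore have to be
  proved, but never by manipulating fractions: \<open>G_\<mu>\<close> is obtained by linear algebra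
  without mention of \<open>n\<close>, and the numerator identity then shows, for each
  \<open>n\<close>, that the symmetrization is its truncation. Partitions enter through an
  adjunction. The map \<open>chi\<close> is adjoint to the inclusion of Sym in QSym, so pairing
  \<open>Q'_\<lambda>\<close> with a symmetric \<open>G\<close> is the Hall product of
  \<open>chi (Q'_\<lambda>)\<close> with \<open>G\<close>. Since \<open>hall\<close> expands its
  left argument in the \<open>h_\<nu>\<close>, these first have to be shown to be a basis of Sym.
  Polynomiality in \<open>q\<close> and both specializations come from naturality: the formula for
  the pairing uses only ring operations on \<open>q\<close>, so it can be evaluated over the
  polynomial ring and carried along ring homomorphisms.\<close>

abbreviation lkp :: "monomial \<Rightarrow> nat \<Rightarrow> nat"
  where "lkp \<equiv> Poly_Mapping.lookup"

abbreviation kys :: "monomial \<Rightarrow> nat set"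
  where "kys \<equiv> Poly_Mapping.keys"

declare zero_mps.rep_eq [simp] one_mps.rep_eq [simp] plus_mps.rep_eq [simp]
  minus_mps.rep_eq [simp] uminus_mps.rep_eq [simp] mps_scale.rep_eq [simp]

lemma mps_coeff_Abs [simp]: "mps_coeff (Abs_mps f) = f"
  by (simp add: Abs_mps_inverse)

lemma mps_coeff_sum [simp]: "mps_coeff (sum f A) m = (\<Sum>x\<in>A. mps_coeff (f x) m)"
  by (induction A rule: infinite_finite_induct) auto

lemma mps_coeff_times: "mps_coeff (f * g) m = (\<Sum>(a, b)\<in>splits m. mps_coeff f a * mps_coeff g b)"
  by (rule times_mps.rep_eq[THEN fun_cong])

lemma in_splits [simp]: "(a, b) \<in> splits m \<longleftrightarrow> a + b = m"
  by (simp add: splits_def)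

lemma monomial_add_eq_0_iff [simp]: "a + b = (0 :: monomial) \<longleftrightarrow> a = 0 \<and> b = 0"
proof
  assume ab: "a + b = 0"
  have "lkp a i = 0" "lkp b i = 0" for i
    using arg_cong[OF ab, of "\<lambda>m. lkp m i"] by (simp_all add: lookup_add)
  then show "a = 0 \<and> b = 0" by (intro conjI poly_mapping_eqI) simp_all
qed simp

lemma splits_zero [simp]: "splits 0 = {(0, 0)}"
  by (auto simp: splits_def)

lemma mps_coeff_times_0 [simp]: "mps_coeff (f * g) 0 = mps_coeff f 0 * mps_coeff g 0"
  by (simp add: mps_coeff_times)

lemma mdeg_sum: "finite A \<Longrightarrow> kys m \<subseteq> A \<Longrightarrow> mdeg m = (\<Sum>i\<in>A. lkp m i)"
  unfolding mdeg_def by (rule sum.mono_neutral_left) (auto simp: in_keys_iff)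

lemma mdeg_add [simp]: "mdeg (a + b) = mdeg a + mdeg b"
proof -
  let ?A = "kys a \<union> kys b"
  have "kys (a + b) \<subseteq> ?A" by (rule keys_add)
  then show ?thesis
    by (simp add: mdeg_sum[of ?A] lookup_add sum.distrib)
qed

lemma mdeg_0 [simp]: "mdeg 0 = 0"
  by (simp add: mdeg_def)

lemma mdeg_eq_0_iff [simp]: "mdeg m = 0 \<longleftrightarrow> m = 0"
  by (auto simp: mdeg_def in_keys_iff intro!: poly_mapping_eqI)

lemma mdeg_single [simp]: "mdeg (Poly_Mapping.single i k) = k"
  by (simp add: mdeg_def)

section \<open>Supports and coefficients of products\<close>

definition supp :: "'a :: comm_ring_1 mps \<Rightarrow> monomial set"
  where "supp f = {m. mps_coeff f m \<noteq> 0}"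

lemma in_supp: "m \<in> supp f \<longleftrightarrow> mps_coeff f m \<noteq> 0"
  by (simp add: supp_def)

lemma times_coeff_nonzeroE:
  assumes "mps_coeff (f * g) m \<noteq> 0"
  obtains a b where "a + b = m" "mps_coeff f a \<noteq> 0" "mps_coeff g b \<noteq> 0"
proof -
  have "\<exists>p\<in>splits m. (case p of (a, b) \<Rightarrow> mps_coeff f a * mps_coeff g b) \<noteq> 0"
    using assms unfolding mps_coeff_times by (meson sum.neutral)
  then show ?thesis using that by (auto dest: mult_not_zero)
qed

definition submonoid :: "monomial set \<Rightarrow> bool"
  where "submonoid S \<longleftrightarrow> 0 \<in> S \<and> (\<forall>a\<in>S. \<forall>b\<in>S. a + b \<in> S)"

lemma supp_times: "submonoid S \<Longrightarrow> supp f \<subseteq> S \<Longrightarrow> supp g \<subseteq> S \<Longrightarrow> supp (f * g) \<subseteq> S"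
  by (auto simp: in_supp submonoid_def subset_iff elim!: times_coeff_nonzeroE)

lemma supp_1: "submonoid S \<Longrightarrow> supp 1 \<subseteq> S"
  by (auto simp: in_supp submonoid_def split: if_splits)

lemma supp_prod:
  assumes "submonoid S" "\<And>x. x \<in> A \<Longrightarrow> supp (f x) \<subseteq> S"
  shows "supp (prod f A) \<subseteq> S"
  using assms(2)
  by (induction A rule: infinite_finite_induct)
    (simp_all add: supp_1 supp_times assms(1))

lemma supp_power: "submonoid S \<Longrightarrow> supp f \<subseteq> S \<Longrightarrow> supp (f ^ k) \<subseteq> S"
  by (induction k) (simp_all add: supp_1 supp_times)

lemma supp_diff: "supp f \<subseteq> S \<Longrightarrow> supp g \<subseteq> S \<Longrightarrow> supp (f - g) \<subseteq> S"
  and supp_scale: "supp f \<subseteq> S \<Longrightarrow> supp (mps_scale c f) \<subseteq> S"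
  unfolding subset_iff in_supp minus_mps.rep_eq mps_scale.rep_eq
  by (metis diff_0_right, metis mult_zero_right)

lemma mps_coeff_times_unique:
  assumes "a + b = m"
    "\<And>a' b'. a' + b' = m \<Longrightarrow> mps_coeff f a' \<noteq> 0 \<Longrightarrow> mps_coeff g b' \<noteq> 0 \<Longrightarrow> a' = a \<and> b' = b"
  shows "mps_coeff (f * g) m = mps_coeff f a * mps_coeff g b"
proof -
  have "mps_coeff (f * g) m = (\<Sum>(a, b)\<in>{(a, b)}. mps_coeff f a * mps_coeff g b)"
    unfolding mps_coeff_times
    by (rule sum.mono_neutral_right) (use assms in \<open>auto dest!: mult_not_zero\<close>)
  then show ?thesis by simp
qed

text \<open>Only coefficients at divisors of \<open>m\<close> matter, so an infinite series may be
  replaced by a finite approximation that depends on \<open>m\<close>.\<close>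

lemma mps_coeff_times_cong:
  assumes "\<And>a b. a + b = m \<Longrightarrow> mps_coeff f a = mps_coeff f' a"
    "\<And>a b. a + b = m \<Longrightarrow> mps_coeff g b = mps_coeff g' b"
  shows "mps_coeff (f * g) m = mps_coeff (f' * g') m"
  unfolding mps_coeff_times using assms by (intro sum.cong) auto

section \<open>Monomials as series, scalars and geometric series\<close>

definition xpow :: "monomial \<Rightarrow> 'a :: comm_ring_1 mps"
  where "xpow p = Abs_mps (\<lambda>m. if m = p then 1 else 0)"

lemma mps_coeff_xpow [simp]: "mps_coeff (xpow p) m = (if m = p then 1 else 0)"
  by (simp add: xpow_def)

lemma mps_coeff_xpow_times [simp]: "mps_coeff (xpow p * f) (p + m) = mps_coeff f m"
  by (subst mps_coeff_times_unique[of p m]) (auto split: if_splits)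

lemma mps_coeff_xpow_times_eq_0: "(\<And>k. m \<noteq> p + k) \<Longrightarrow> mps_coeff (xpow p * f) m = 0"
  by (metis times_coeff_nonzeroE mps_coeff_xpow)

lemma xpow_0 [simp]: "xpow 0 = 1"
  by (rule mps_eqI) simp

lemma xpow_add: "xpow (p + q) = xpow p * xpow q"
proof (rule mps_eqI)
  fix m
  show "mps_coeff (xpow (p + q) :: 'a mps) m = mps_coeff (xpow p * xpow q) m"
  proof (cases "\<exists>k. m = p + k")
    case True
    then show ?thesis by auto
  next
    case False
    then show ?thesis by (subst mps_coeff_xpow_times_eq_0) auto
  qed
qed

lemma xpow_sum: "xpow (sum p A) = (\<Prod>i\<in>A. xpow (p i))"
  by (induction A rule: infinite_finite_induct) (auto simp: xpow_add)

lemma supp_xpow: "supp (xpow p) \<subseteq> {p}"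
  by (auto simp: in_supp split: if_splits)

abbreviation mps_const :: "'a :: comm_ring_1 \<Rightarrow> 'a mps"
  where "mps_const c \<equiv> mps_scale c 1"

lemma mps_coeff_scale_times: "mps_coeff (mps_scale c f * g) m = c * mps_coeff (f * g) m"
  by (simp add: mps_coeff_times sum_distrib_left mult.assoc case_prod_unfold)

lemma mps_scale_times: "mps_scale c f * g = mps_scale c (f * g)"
  by (rule mps_eqI) (simp add: mps_coeff_scale_times)

lemma times_mps_scale: "g * mps_scale c f = mps_scale c (g * f)"
  by (simp only: mps_scale_times mult.commute[of g])

lemma mps_const_times: "mps_const c * f = mps_scale c f"
  by (simp add: mps_scale_times)

text \<open>If \<open>f\<close> has no constant term, its powers with exponent above \<^term>\<open>mdeg m\<close> do not contribute to
  the coefficient at \<open>m\<close>.\<close>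

definition mps_geom :: "'a :: comm_ring_1 mps \<Rightarrow> 'a mps"
  where "mps_geom f = Abs_mps (\<lambda>m. \<Sum>k\<le>mdeg m. mps_coeff (f ^ k) m)"

lemma mps_power_order:
  assumes "mps_coeff f 0 = 0" "mps_coeff (f ^ k) m \<noteq> 0"
  shows "k \<le> mdeg m"
  using assms(2)
proof (induction k arbitrary: m)
  case (Suc k)
  then obtain a b where ab: "a + b = m" "mps_coeff f a \<noteq> 0" "mps_coeff (f ^ k) b \<noteq> 0"
    by (auto elim!: times_coeff_nonzeroE)
  then have "a \<noteq> 0" using assms(1) by auto
  then have "mdeg a > 0" by (metis mdeg_eq_0_iff not_gr0)
  moreover have "k \<le> mdeg b" using ab(3) by (rule Suc.IH)
  ultimately show ?case using ab(1) by auto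
qed simp

lemma mps_geom_coeff:
  assumes "mps_coeff f 0 = 0" "mdeg m \<le> M"
  shows "mps_coeff (mps_geom f) m = mps_coeff (\<Sum>k\<le>M. f ^ k) m"
proof -
  have "(\<Sum>k\<le>mdeg m. mps_coeff (f ^ k) m) = (\<Sum>k\<le>M. mps_coeff (f ^ k) m)"
    by (rule sum.mono_neutral_left) (use assms mps_power_order in auto)
  then show ?thesis by (simp add: mps_geom_def)
qed

lemma mps_geom:
  assumes "mps_coeff f 0 = 0"
  shows "(1 - f) * mps_geom f = 1"
proof (rule mps_eqI)
  fix m
  \<comment> \<open>The cut-off depends on \<open>m\<close>: the error term \<open>f ^ Suc M\<close>
    of the finite geometric sum has order above \<open>mdeg m\<close>.\<close>
  define M where "M = mdeg m"
  have "mps_coeff ((1 - f) * mps_geom f) m = mps_coeff ((1 - f) * (\<Sum>k\<le>M. f ^ k)) m"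
    by (rule mps_coeff_times_cong) (auto intro!: mps_geom_coeff[OF assms] simp: M_def simp del: mps_coeff_sum)
  also have "(1 - f) * (\<Sum>k\<le>M. f ^ k) = 1 - f ^ Suc M"
    by (rule sum_gp_basic)
  also have "mps_coeff \<dots> m = mps_coeff 1 m"
    using mps_power_order[OF assms, of "Suc M" m] by (auto simp: M_def simp del: power_Suc)
  finally show "mps_coeff ((1 - f) * mps_geom f) m = mps_coeff 1 m" .
qed

lemma mps_geom_unique: "mps_coeff f 0 = 0 \<Longrightarrow> (1 - f) * g = 1 \<Longrightarrow> g = mps_geom f"
proof -
  assume f: "mps_coeff f 0 = 0" and g: "(1 - f) * g = 1"
  have "g = (1 - f) * mps_geom f * g" using mps_geom[OF f] by simp
  also have "\<dots> = mps_geom f * ((1 - f) * g)" by (simp only: ac_simps)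
  finally show ?thesis using g by simp
qed

lemma supp_geom: "submonoid S \<Longrightarrow> supp f \<subseteq> S \<Longrightarrow> supp (mps_geom f) \<subseteq> S"
proof
  fix m assume S: "submonoid S" "supp f \<subseteq> S" and "m \<in> supp (mps_geom f)"
  then obtain k where "mps_coeff (f ^ k) m \<noteq> 0"
    by (auto simp: in_supp mps_geom_def) (meson sum.neutral)
  then show "m \<in> S" using supp_power[OF S, of k] by (auto simp: in_supp)
qed

lemma mps_geom_coeff_0 [simp]: "mps_coeff (mps_geom f) 0 = 1"
  by (simp add: mps_geom_def)

section \<open>Pushforward along monomial maps\<close>

definition monomial_hom :: "(monomial \<Rightarrow> monomial) \<Rightarrow> bool"
  where "monomial_hom \<theta> \<longleftrightarrow> inj \<theta> \<and> (\<forall>a b. \<theta> (a + b) = \<theta> a + \<theta> b)"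

text \<open>For injective additive \<open>\<theta>\<close> this is the substitution of
  \<open>x^(\<theta> m)\<close> for \<open>x^m\<close>. Fibres have at most one element, so no sum
  over a fibre occurs and no convergence is at stake.\<close>

definition push :: "(monomial \<Rightarrow> monomial) \<Rightarrow> 'a :: comm_ring_1 mps \<Rightarrow> 'a mps"
  where "push \<theta> f = Abs_mps (\<lambda>m. if m \<in> range \<theta> then mps_coeff f (inv \<theta> m) else 0)"

lemma push_coeff_notin: "m \<notin> range \<theta> \<Longrightarrow> mps_coeff (push \<theta> f) m = 0"
  by (simp add: push_def)

lemma push_coeff: "monomial_hom \<theta> \<Longrightarrow> mps_coeff (push \<theta> f) (\<theta> m) = mps_coeff f m"
  by (simp add: push_def monomial_hom_def inv_f_f)

lemma push_coeff_nonzeroE: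
  assumes "monomial_hom \<theta>" "mps_coeff (push \<theta> f) m \<noteq> 0"
  obtains k where "m = \<theta> k" "mps_coeff f k \<noteq> 0"
proof -
  have "m \<in> range \<theta>" using assms(2) push_coeff_notin by blast
  then obtain k where "m = \<theta> k" by blast
  then show ?thesis using that assms push_coeff by metis
qed

lemma push_eqI:
  assumes "monomial_hom \<theta>" "\<And>m. mps_coeff g (\<theta> m) = mps_coeff f m"
    "\<And>m. m \<notin> range \<theta> \<Longrightarrow> mps_coeff g m = 0"
  shows "push \<theta> f = g"
proof (rule mps_eqI)
  fix m show "mps_coeff (push \<theta> f) m = mps_coeff g m"
    using assms by (cases "m \<in> range \<theta>") (auto simp: push_coeff push_coeff_notin)
qed

lemma monomial_hom_0: "monomial_hom \<theta> \<Longrightarrow> \<theta> 0 = 0"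
  unfolding monomial_hom_def by (metis add_cancel_right_right add.right_neutral)

lemma push_xpow: "monomial_hom \<theta> \<Longrightarrow> push \<theta> (xpow p) = xpow (\<theta> p)"
  by (rule push_eqI) (auto simp: monomial_hom_def inj_def)

lemma push_1: "monomial_hom \<theta> \<Longrightarrow> push \<theta> 1 = 1"
  using push_xpow[of \<theta> 0] by (simp add: monomial_hom_0)

lemma push_add: "push \<theta> (f + g) = push \<theta> f + push \<theta> g"
  and push_diff: "push \<theta> (f - g) = push \<theta> f - push \<theta> g"
  and push_0: "push \<theta> 0 = 0"
  and push_scale: "push \<theta> (mps_scale c f) = mps_scale c (push \<theta> f)"
  by (auto intro!: mps_eqI simp: push_def)

lemma push_sum: "push \<theta> (sum f A) = (\<Sum>x\<in>A. push \<theta> (f x))"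
  by (induction A rule: infinite_finite_induct) (auto simp: push_add push_0)

lemma push_times:
  assumes \<theta>: "monomial_hom \<theta>"
  shows "push \<theta> (f * g) = push \<theta> f * push \<theta> g"
proof (rule push_eqI[OF \<theta>])
  fix m
  have inj: "inj \<theta>" and add: "\<And>a b. \<theta> (a + b) = \<theta> a + \<theta> b"
    using \<theta> by (auto simp: monomial_hom_def)
  have "mps_coeff (push \<theta> f * push \<theta> g) (\<theta> m)
      = (\<Sum>(a, b)\<in>(\<lambda>(a, b). (\<theta> a, \<theta> b)) ` splits m. mps_coeff (push \<theta> f) a * mps_coeff (push \<theta> g) b)"
    unfolding mps_coeff_times
  proof (rule sum.mono_neutral_right)
    show "\<forall>i\<in>splits (\<theta> m) - (\<lambda>(a, b). (\<theta> a, \<theta> b)) ` splits m.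
       (case i of (a, b) \<Rightarrow> mps_coeff (push \<theta> f) a * mps_coeff (push \<theta> g) b) = 0"
    proof safe
      fix a b assume ab: "(a, b) \<in> splits (\<theta> m)" "(a, b) \<notin> (\<lambda>(a, b). (\<theta> a, \<theta> b)) ` splits m"
      show "mps_coeff (push \<theta> f) a * mps_coeff (push \<theta> g) b = 0"
      proof (rule ccontr)
        assume "mps_coeff (push \<theta> f) a * mps_coeff (push \<theta> g) b \<noteq> 0"
        then have "mps_coeff (push \<theta> f) a \<noteq> 0" "mps_coeff (push \<theta> g) b \<noteq> 0" by auto
        then obtain k l where kl: "a = \<theta> k" "b = \<theta> l" by (metis push_coeff_nonzeroE[OF \<theta>])
        then have "k + l = m" using ab(1) add inj by (metis in_splits injD)
        then show False using ab(2) kl by force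
      qed
    qed
  qed (auto simp: add[symmetric])
  also have "\<dots> = (\<Sum>(a, b)\<in>splits m. mps_coeff f a * mps_coeff g b)"
    using inj by (subst sum.reindex) (auto simp: inj_on_def inj_def push_coeff[OF \<theta>] intro!: sum.cong)
  finally show "mps_coeff (push \<theta> f * push \<theta> g) (\<theta> m) = mps_coeff (f * g) m"
    by (simp add: mps_coeff_times)
next
  fix m assume m: "m \<notin> range \<theta>"
  show "mps_coeff (push \<theta> f * push \<theta> g) m = 0"
  proof (rule ccontr)
    assume "mps_coeff (push \<theta> f * push \<theta> g) m \<noteq> 0"
    then obtain a b where "a + b = m" "mps_coeff (push \<theta> f) a \<noteq> 0" "mps_coeff (push \<theta> g) b \<noteq> 0"
      by (rule times_coeff_nonzeroE)
    then obtain k l where "m = \<theta> k + \<theta> l"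
      by (metis push_coeff_nonzeroE[OF \<theta>])
    then have "m = \<theta> (k + l)" using \<theta> by (simp add: monomial_hom_def)
    then show False using m by simp
  qed
qed

lemma push_prod: "monomial_hom \<theta> \<Longrightarrow> push \<theta> (prod f A) = (\<Prod>x\<in>A. push \<theta> (f x))"
  by (induction A rule: infinite_finite_induct) (simp_all add: push_1 push_times)

lemma push_geom:
  assumes "monomial_hom \<theta>" "mps_coeff f 0 = 0"
  shows "push \<theta> (mps_geom f) = mps_geom (push \<theta> f)"
proof (rule mps_geom_unique)
  show "mps_coeff (push \<theta> f) 0 = 0"
    using push_coeff[OF assms(1), of f 0] assms by (simp add: monomial_hom_0)
  show "(1 - push \<theta> f) * push \<theta> (mps_geom f) = 1"
    using arg_cong[OF mps_geom[OF assms(2)], of "push \<theta>"]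
    by (simp add: push_1 push_diff push_times assms(1))
qed

section \<open>Maps of monomials\<close>

text \<open>For injective \<open>\<pi>\<close>, replaces the variable \<open>x_i\<close> by
  \<open>x_(\<pi> i)\<close>. It moves exponents forward along \<open>\<pi>\<close>, whereas
  \<open>map_key\<close> pulls them back.\<close>

definition relabel :: "(nat \<Rightarrow> nat) \<Rightarrow> monomial \<Rightarrow> monomial"
  where "relabel \<pi> m = Abs_poly_mapping (\<lambda>j. if j \<in> range \<pi> then lkp m (inv \<pi> j) else 0)"

lemma lookup_relabel:
  assumes "inj \<pi>"
  shows "lkp (relabel \<pi> m) j = (if j \<in> range \<pi> then lkp m (inv \<pi> j) else 0)"
proof -
  have "finite {j. (if j \<in> range \<pi> then lkp m (inv \<pi> j) else 0) \<noteq> 0}"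
    by (rule finite_subset[of _ "\<pi> ` kys m"]) (use assms in \<open>auto simp: in_keys_iff split: if_splits\<close>)
  then show ?thesis by (simp add: relabel_def)
qed

lemma lookup_relabel_image [simp]: "inj \<pi> \<Longrightarrow> lkp (relabel \<pi> m) (\<pi> i) = lkp m i"
  by (simp add: lookup_relabel)

lemma lookup_relabel_notin: "inj \<pi> \<Longrightarrow> j \<notin> range \<pi> \<Longrightarrow> lkp (relabel \<pi> m) j = 0"
  by (simp add: lookup_relabel)

lemma relabel_add: "inj \<pi> \<Longrightarrow> relabel \<pi> (a + b) = relabel \<pi> a + relabel \<pi> b"
  by (rule poly_mapping_eqI) (simp add: lookup_relabel lookup_add)

lemma inj_relabel: "inj \<pi> \<Longrightarrow> inj (relabel \<pi>)"
  by (rule injI, rule poly_mapping_eqI) (metis lookup_relabel_image)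

lemma monomial_hom_relabel: "inj \<pi> \<Longrightarrow> monomial_hom (relabel \<pi>)"
  by (simp add: monomial_hom_def relabel_add inj_relabel)

lemma keys_relabel: "inj \<pi> \<Longrightarrow> kys (relabel \<pi> m) = \<pi> ` kys m"
  by (force simp: in_keys_iff lookup_relabel split: if_splits)

lemma mdeg_relabel [simp]: "inj \<pi> \<Longrightarrow> mdeg (relabel \<pi> m) = mdeg m"
  unfolding mdeg_def keys_relabel by (subst sum.reindex) (auto intro: inj_on_subset)

lemma relabel_surj:
  assumes "inj \<pi>" "kys m \<subseteq> range \<pi>"
  obtains k where "m = relabel \<pi> k"
proof
  show "m = relabel \<pi> (Poly_Mapping.map_key \<pi> m)"
    by (rule poly_mapping_eqI)
      (use assms in \<open>auto simp: lookup_relabel map_key.rep_eq in_keys_iff f_inv_into_f\<close>)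
qed

lemma splits_relabel:
  assumes "inj \<pi>"
  shows "splits (relabel \<pi> m) = (\<lambda>(a, b). (relabel \<pi> a, relabel \<pi> b)) ` splits m"
proof (intro equalityI subsetI)
  fix p assume "p \<in> splits (relabel \<pi> m)"
  then obtain a b where p: "p = (a, b)" "a + b = relabel \<pi> m" by (auto simp: splits_def)
  have "kys a \<subseteq> kys (a + b)" "kys b \<subseteq> kys (a + b)"
    by (auto simp: in_keys_iff lookup_add)
  then have "kys a \<subseteq> range \<pi>" "kys b \<subseteq> range \<pi>"
    using p(2) keys_relabel[OF assms, of m] by auto
  then obtain a' b' where ab: "a = relabel \<pi> a'" "b = relabel \<pi> b'"
    using relabel_surj[OF assms] by metis
  then have "relabel \<pi> (a' + b') = relabel \<pi> m" using p(2) assms by (simp add: relabel_add)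
  then have "a' + b' = m" using inj_relabel[OF assms] by (simp add: inj_eq)
  then show "p \<in> (\<lambda>(a, b). (relabel \<pi> a, relabel \<pi> b)) ` splits m"
    using p(1) ab by force
qed (use assms in \<open>auto simp: relabel_add[symmetric]\<close>)

lemma sum_splits_relabel:
  assumes "inj \<pi>"
  shows "(\<Sum>(a, b)\<in>splits (relabel \<pi> m). F a b)
    = (\<Sum>(a, b)\<in>splits m. F (relabel \<pi> a) (relabel \<pi> b))"
proof -
  have "inj_on (\<lambda>(a, b). (relabel \<pi> a, relabel \<pi> b)) (splits m)"
    using inj_relabel[OF assms] by (auto simp: inj_on_def)
  then show ?thesis
    by (simp add: splits_relabel[OF assms] sum.reindex case_prod_unfold)
qed

text \<open>The monomial counterpart of list Cons: a new variable in front carries the exponent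
  \<open>r\<close>.\<close>

definition mcons :: "nat \<Rightarrow> monomial \<Rightarrow> monomial"
  where "mcons r m = Poly_Mapping.single 0 r + relabel Suc m"

lemma lookup_mcons_0 [simp]: "lkp (mcons r m) 0 = r"
  by (simp add: mcons_def lookup_add lookup_relabel_notin)

lemma lookup_mcons_Suc [simp]: "lkp (mcons r m) (Suc i) = lkp m i"
  by (simp add: mcons_def lookup_add lookup_single)

lemma monomial_eqI_0_Suc:
  "lkp a 0 = lkp b 0 \<Longrightarrow> (\<And>i. lkp a (Suc i) = lkp b (Suc i)) \<Longrightarrow> a = b"
  by (rule poly_mapping_eqI) (metis not0_implies_Suc)

lemma mcons_eq_iff [simp]: "mcons r a = mcons s b \<longleftrightarrow> r = s \<and> a = b"
  by (metis lookup_mcons_0 lookup_mcons_Suc poly_mapping_eqI)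

lemma mcons_add: "mcons (r + s) (a + b) = mcons r a + mcons s b"
  by (rule monomial_eqI_0_Suc) (simp_all add: lookup_add)

lemma mdeg_mcons [simp]: "mdeg (mcons r m) = r + mdeg m"
  by (simp add: mcons_def)

lemma relabel_Suc: "relabel Suc m = mcons 0 m"
  by (simp add: mcons_def)

lemma mcons_cases: obtains r k where "m = mcons r k"
proof
  show "m = mcons (lkp m 0) (Poly_Mapping.map_key Suc m)"
    by (rule monomial_eqI_0_Suc) (simp_all add: map_key.rep_eq)
qed

text \<open>Substituting \<open>x\<^sub>i = z\<^sub>0 z\<^sub>1 \<dots> z\<^sub>i\<close> turns \<open>x\<^sup>m\<close> into \<open>z\<^bsup>tail m\<^esup>\<close>, and the ratio
  \<open>x\<^sub>b / x\<^sub>a\<close> with \<open>a < b\<close> into the monomial \<open>z\<^bsub>a+1\<^esub> \<dots> z\<^sub>b\<close>.  Laurent series in these ratios are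
  power series in the \<open>z\<^sub>i\<close>.\<close>

definition tail :: "monomial \<Rightarrow> monomial"
  where "tail m = Abs_poly_mapping (\<lambda>i. \<Sum>j\<in>kys m. if i \<le> j then lkp m j else 0)"

lemma lookup_tail: "lkp (tail m) i = (\<Sum>j\<in>kys m. if i \<le> j then lkp m j else 0)"
proof -
  have "finite {i. (\<Sum>j\<in>kys m. if i \<le> j then lkp m j else 0) \<noteq> 0}"
  proof (rule finite_subset)
    show "{i. (\<Sum>j\<in>kys m. if i \<le> j then lkp m j else 0) \<noteq> 0} \<subseteq> (\<Union>j\<in>kys m. {..j})"
      by (auto split: if_splits)
  qed simp
  then show ?thesis by (simp add: tail_def)
qed

lemma lookup_tail': "finite A \<Longrightarrow> kys m \<subseteq> A \<Longrightarrow> lkp (tail m) i = (\<Sum>j\<in>A. if i \<le> j then lkp m j else 0)"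
  unfolding lookup_tail by (rule sum.mono_neutral_left) (auto simp: in_keys_iff)

lemma tail_add: "tail (a + b) = tail a + tail b"
proof (rule poly_mapping_eqI)
  fix i
  let ?A = "kys a \<union> kys b"
  have "kys (a + b) \<subseteq> ?A" by (rule keys_add)
  then show "lkp (tail (a + b)) i = lkp (tail a + tail b) i"
    by (auto simp: lookup_tail'[of ?A] lookup_add sum.distrib[symmetric] intro!: sum.cong)
qed

lemma lookup_tail_0: "lkp (tail m) 0 = mdeg m"
  by (simp add: lookup_tail mdeg_def)

lemma lookup_tail_step: "lkp (tail m) i = lkp m i + lkp (tail m) (Suc i)"
proof -
  let ?A = "insert i (kys m)"
  have "lkp (tail m) i = (\<Sum>j\<in>?A. if i \<le> j then lkp m j else 0)"
    by (rule lookup_tail') auto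
  also have "\<dots> = (\<Sum>j\<in>?A. (if i = j then lkp m j else 0) + (if Suc i \<le> j then lkp m j else 0))"
    by (rule sum.cong) auto
  also have "\<dots> = lkp m i + (\<Sum>j\<in>?A. if Suc i \<le> j then lkp m j else 0)"
    by (simp add: sum.distrib)
  also have "(\<Sum>j\<in>?A. if Suc i \<le> j then lkp m j else 0) = lkp (tail m) (Suc i)"
    by (rule lookup_tail'[symmetric]) auto
  finally show ?thesis .
qed

text \<open>Injectivity holds because exponents are differences of consecutive tail sums.\<close>

lemma monomial_hom_tail: "monomial_hom tail"
proof -
  have "a = b" if "tail a = tail b" for a b
  proof (rule poly_mapping_eqI)
    fix i show "lkp a i = lkp b i"
      using lookup_tail_step[of a i] lookup_tail_step[of b i] that by simp
  qed
  then show ?thesis by (auto simp: monomial_hom_def tail_add inj_def)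
qed

lemma tail_eq_iff [simp]: "tail a = tail b \<longleftrightarrow> a = b"
  using monomial_hom_tail by (simp add: monomial_hom_def inj_eq)

lemma tail_0 [simp]: "tail 0 = 0"
  by (rule monomial_hom_0[OF monomial_hom_tail])

lemma tail_relabel_Suc: "tail (mcons 0 m) = mcons (mdeg m) (tail m)"
proof -
  have "lkp (tail (relabel Suc m)) (Suc i) = lkp (tail m) i" for i
    unfolding lookup_tail keys_relabel[OF inj_Suc]
    by (subst sum.reindex) (simp_all add: relabel_Suc cong: if_cong)
  then show ?thesis
    by (intro monomial_eqI_0_Suc) (simp_all add: lookup_tail_0 flip: relabel_Suc)
qed

lemma lookup_tail_single: "lkp (tail (Poly_Mapping.single i r)) j = (if j \<le> i then r else 0)"
  by (simp add: lookup_tail)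

lemma tail_mcons: "tail (mcons r m) = mcons (r + mdeg m) (tail m)"
proof -
  have "tail (mcons r m) = tail (Poly_Mapping.single 0 r) + tail (mcons 0 m)"
    by (simp add: mcons_def tail_add)
  also have "tail (Poly_Mapping.single 0 r) = mcons r 0"
    by (rule monomial_eqI_0_Suc) (simp_all add: lookup_tail_single)
  finally show ?thesis by (simp add: tail_relabel_Suc flip: mcons_add)
qed

lemma keys_tail_subset:
  assumes "kys m \<subseteq> {..<n}"
  shows "kys (tail m) \<subseteq> {..<n}"
proof
  fix i assume "i \<in> kys (tail m)"
  then obtain j where "j \<in> kys m" "i \<le> j"
    by (auto simp: in_keys_iff[of i] lookup_tail split: if_splits)
  then show "i \<in> {..<n}" using assms by auto
qed

text \<open>The height is the degree in the variables \<open>z_i\<close>, hence additive;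
  \<open>ht_sum\<close> gives the weighted form with weights \<open>i + 1\<close>.\<close>

abbreviation ht :: "monomial \<Rightarrow> nat"
  where "ht m \<equiv> mdeg (tail m)"

section \<open>Quasisymmetric functions as relabelling invariants\<close>

text \<open>For series of bounded degree this characterizes QSym (\<open>QSym_iff\<close>), and
  unlike the span it is visibly closed under products.\<close>

definition qinv :: "'a :: comm_ring_1 mps \<Rightarrow> bool"
  where "qinv f \<longleftrightarrow> (\<forall>\<pi> m. strict_mono \<pi> \<longrightarrow> mps_coeff f (relabel \<pi> m) = mps_coeff f m)"

lemma qinvD: "qinv f \<Longrightarrow> strict_mono \<pi> \<Longrightarrow> mps_coeff f (relabel \<pi> m) = mps_coeff f m"
  by (simp add: qinv_def)

lemma strict_mono_inj: "strict_mono (\<pi> :: nat \<Rightarrow> nat) \<Longrightarrow> inj \<pi>"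
  by (rule strict_mono_imp_inj_on)

lemma qinv_times: "qinv f \<Longrightarrow> qinv g \<Longrightarrow> qinv (f * g)"
  by (auto simp: qinv_def mps_coeff_times sum_splits_relabel strict_mono_inj)

lemma qinv_mcons_0: "qinv f \<Longrightarrow> mps_coeff f (mcons 0 m) = mps_coeff f m"
  using qinvD[of f Suc m] by (simp add: relabel_Suc strict_mono_Suc_iff)

text \<open>Relabellings of the remaining variables extend by fixing \<open>x_0\<close>, so a
  coefficient of \<open>x_0^r\<close> extracted from a quasisymmetric series is again
  quasisymmetric.\<close>

lemma relabel_mcons:
  assumes "strict_mono \<pi>"
  defines "\<pi>' \<equiv> (\<lambda>i. case i of 0 \<Rightarrow> 0 | Suc j \<Rightarrow> Suc (\<pi> j))"
  shows "strict_mono \<pi>'" "relabel \<pi>' (mcons r m) = mcons r (relabel \<pi> m)"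
proof -
  show sm: "strict_mono \<pi>'"
    unfolding strict_mono_def
  proof (intro allI impI)
    fix i j :: nat assume "i < j"
    then show "\<pi>' i < \<pi>' j" using assms(1)
      by (cases i; cases j) (auto simp: \<pi>'_def strict_mono_def)
  qed
  have inj: "inj \<pi>" "inj \<pi>'" using assms(1) sm by (auto intro: strict_mono_inj)
  show "relabel \<pi>' (mcons r m) = mcons r (relabel \<pi> m)"
  proof (rule monomial_eqI_0_Suc)
    have "lkp (relabel \<pi>' (mcons r m)) (\<pi>' 0) = r"
      using inj by (subst lookup_relabel_image) auto
    then show "lkp (relabel \<pi>' (mcons r m)) 0 = lkp (mcons r (relabel \<pi> m)) 0"
      by (simp add: \<pi>'_def)
  next
    fix i
    show "lkp (relabel \<pi>' (mcons r m)) (Suc i) = lkp (mcons r (relabel \<pi> m)) (Suc i)"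
    proof (cases "i \<in> range \<pi>")
      case True
      then obtain j where j: "i = \<pi> j" by auto
      have "lkp (relabel \<pi>' (mcons r m)) (\<pi>' (Suc j)) = lkp m j"
        using inj by (subst lookup_relabel_image) auto
      then show ?thesis using inj by (simp add: j \<pi>'_def)
    next
      case False
      then have "Suc i \<notin> range \<pi>'" by (auto simp: \<pi>'_def split: nat.splits)
      then show ?thesis using False inj by (simp add: lookup_relabel_notin)
    qed
  qed
qed

lemma comp_pos: "0 \<notin> set (parts \<alpha>)"
  using parts[of \<alpha>] by auto

definition comp_of :: "monomial \<Rightarrow> composition"
  where "comp_of m = Abs_composition (exponents m)"

lemma parts_comp_of [simp]: "parts (comp_of m) = exponents m"
  unfolding comp_of_def
  by (rule Abs_composition_inverse) (auto simp: exponents_def in_keys_iff)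

lemma comp_of_eq_iff: "comp_of m = \<beta> \<longleftrightarrow> exponents m = parts \<beta>"
  by (metis parts_comp_of parts_inject)

lemma comp_of_comp_monomial [simp]: "comp_of (comp_monomial \<alpha>) = \<alpha>"
  by (simp add: comp_of_eq_iff exponents_comp_monomial)

lemma exponents_relabel:
  assumes "strict_mono \<pi>"
  shows "exponents (relabel \<pi> m) = exponents m"
proof -
  have inj: "inj \<pi>" using assms by (rule strict_mono_inj)
  have "sorted_list_of_set (\<pi> ` kys m) = map \<pi> (sorted_list_of_set (kys m))"
  proof (rule sorted_distinct_set_unique)
    show "sorted (map \<pi> (sorted_list_of_set (kys m)))"
      using assms by (simp add: sorted_map strict_mono_less_eq)
    show "distinct (map \<pi> (sorted_list_of_set (kys m)))"
      using inj by (simp add: distinct_map inj_on_subset[OF inj])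
  qed auto
  then show ?thesis
    using inj by (simp add: exponents_def keys_relabel)
qed

lemma lookup_comp_monomial: "lkp (comp_monomial \<alpha>) i = part \<alpha> i"
  by (simp add: comp_monomial_def part_def nth.rep_eq)

lemma relabel_comp_of: obtains \<pi> where "strict_mono \<pi>" "m = relabel \<pi> (comp_monomial (comp_of m))"
proof -
  define xs where "xs = sorted_list_of_set (kys m)"
  define l where "l = length xs"
  obtain B where B: "\<And>x. x \<in> kys m \<Longrightarrow> x < B"
    using finite_nat_set_iff_bounded[of "kys m"] by auto
  have set_xs: "set xs = kys m" by (simp add: xs_def)
  have sorted: "sorted_wrt (<) xs" by (simp add: xs_def)
  \<comment> \<open>The leading variables go to the variables of \<open>m\<close>; beyond them any
    increasing continuation works, and \<open>B\<close> lies above all variables of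
    \<open>m\<close>.\<close>
  define \<pi> where "\<pi> i = (if i < l then xs ! i else B + i)" for i
  have sm: "strict_mono \<pi>"
    unfolding strict_mono_def
  proof (intro allI impI)
    fix i j :: nat assume ij: "i < j"
    have "xs ! i < B" if "i < l" using that B set_xs nth_mem[of i xs] by (simp add: l_def)
    then show "\<pi> i < \<pi> j"
      using ij sorted by (auto simp: \<pi>_def l_def sorted_wrt_iff_nth_less)
  qed
  have inj: "inj \<pi>" by (rule strict_mono_inj[OF sm])
  have "m = relabel \<pi> (comp_monomial (comp_of m))"
  proof (rule poly_mapping_eqI)
    fix j
    have part: "part (comp_of m) i = (if i < l then lkp m (xs ! i) else 0)" for i
      by (simp add: part_def exponents_def nth_default_def l_def flip: xs_def)
    show "lkp m j = lkp (relabel \<pi> (comp_monomial (comp_of m))) j"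
    proof (cases "j \<in> range \<pi>")
      case True
      then obtain i where i: "j = \<pi> i" by auto
      have "lkp m (B + i) = 0" using B[of "B + i"] by (auto simp: in_keys_iff)
      then show ?thesis using inj by (simp add: i lookup_comp_monomial part) (simp add: \<pi>_def)
    next
      case False
      then have "j \<notin> set xs" by (auto simp: \<pi>_def in_set_conv_nth l_def image_iff)
      then show ?thesis using False inj
        by (simp add: set_xs lookup_relabel_notin in_keys_iff)
    qed
  qed
  then show ?thesis using that sm by blast
qed

lemma qinv_coeff: "qinv f \<Longrightarrow> mps_coeff f m = mps_coeff f (comp_monomial (comp_of m))"
  using relabel_comp_of[of m] qinvD by metis

lemma mdeg_comp_monomial [simp]: "mdeg (comp_monomial \<alpha>) = comp_size \<alpha>"
proof -
  have "mdeg (comp_monomial \<alpha>) = (\<Sum>i<length (parts \<alpha>). lkp (comp_monomial \<alpha>) i)"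
    by (rule mdeg_sum) (auto simp: in_keys_iff lookup_comp_monomial part_def nth_default_def split: if_splits)
  also have "\<dots> = (\<Sum>i<length (parts \<alpha>). parts \<alpha> ! i)"
    by (rule sum.cong) (auto simp: lookup_comp_monomial part_def nth_default_def)
  also have "\<dots> = comp_size \<alpha>"
    by (simp add: comp_size_def sum_list_sum_nth atLeast0LessThan)
  finally show ?thesis .
qed

lemma comp_size_comp_of [simp]: "comp_size (comp_of m) = mdeg m"
  by (metis mdeg_comp_monomial mdeg_relabel relabel_comp_of strict_mono_inj)

lemma mps_coeff_QM: "mps_coeff (QM \<beta>) m = (if comp_of m = \<beta> then 1 else 0)"
  by (simp add: QM_def comp_of_eq_iff)

lemma comp_of_relabel [simp]: "strict_mono \<pi> \<Longrightarrow> comp_of (relabel \<pi> m) = comp_of m"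
  by (simp add: comp_of_eq_iff exponents_relabel)

lemma finite_comp_size_le [simp]: "finite {\<alpha>. comp_size \<alpha> \<le> d}"
proof -
  have "parts ` {\<alpha>. comp_size \<alpha> \<le> d} \<subseteq> {xs. set xs \<subseteq> {..d} \<and> length xs \<le> d}"
  proof clarsimp
    fix \<alpha> assume d: "comp_size \<alpha> \<le> d"
    have "x \<le> comp_size \<alpha>" if "x \<in> set (parts \<alpha>)" for x
      using that by (simp add: comp_size_def member_le_sum_list)
    moreover have "length xs \<le> sum_list xs" if "0 \<notin> set xs" for xs :: "nat list"
      using that by (induction xs) auto
    ultimately show "set (parts \<alpha>) \<subseteq> {..d} \<and> length (parts \<alpha>) \<le> d"
      using d comp_pos[of \<alpha>] by (fastforce simp: comp_size_def)
  qed
  then have "finite (parts ` {\<alpha>. comp_size \<alpha> \<le> d})"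
    by (rule finite_subset) (rule finite_lists_length_le, simp)
  then show ?thesis
    by (rule finite_imageD) (auto intro!: inj_onI simp: parts_inject)
qed

lemma finite_comp_size_eq [simp]: "finite {\<alpha>. comp_size \<alpha> = d}"
  by (rule finite_subset[OF _ finite_comp_size_le[of d]]) auto

lemma mps_coeff_QF: "mps_coeff (QF i) m = (if mdeg m = i then 1 else 0)"
  by (simp add: QF_def mps_coeff_QM)

definition squarefree_mon :: "monomial \<Rightarrow> bool"
  where "squarefree_mon m \<longleftrightarrow> (\<forall>i. lkp m i \<le> 1)"

lemma squarefree_mon_relabel: "inj \<pi> \<Longrightarrow> squarefree_mon (relabel \<pi> m) \<longleftrightarrow> squarefree_mon m"
  unfolding squarefree_mon_def
  by (metis le0 lookup_relabel_image lookup_relabel_notin rangeE)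

text \<open>This identifies \<open>QF_ones i\<close> with the elementary symmetric function, as
  \<open>mps_coeff_QF\<close> identifies \<open>QF i\<close> with the complete one.\<close>

lemma mps_coeff_QF_ones:
  "mps_coeff (QF_ones i) m = (if squarefree_mon m \<and> mdeg m = i then 1 else 0)"
proof -
  have "exponents m = replicate i 1 \<longleftrightarrow> squarefree_mon m \<and> mdeg m = i"
  proof safe
    assume e: "exponents m = replicate i 1"
    show sq: "squarefree_mon m"
      unfolding squarefree_mon_def
    proof
      fix j
      show "lkp m j \<le> 1"
      proof (cases "j \<in> kys m")
        case True
        then have "lkp m j \<in> set (exponents m)" by (simp add: exponents_def)
        then show ?thesis by (simp add: e)
      qed (simp add: in_keys_iff)
    qed
    have "comp_size (comp_of m) = i" by (simp add: comp_size_def e sum_list_replicate)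
    then show "mdeg m = i" by simp
  next
    assume sq: "squarefree_mon m"
    have "lkp m j = 1" if "j \<in> kys m" for j
      using that sq unfolding in_keys_iff squarefree_mon_def by (metis le_neq_implies_less less_one)
    then have "exponents m = map (\<lambda>_. 1) (sorted_list_of_set (kys m))" "mdeg m = card (kys m)"
      by (auto simp: exponents_def mdeg_def)
    then show "exponents m = replicate (mdeg m) 1" by (simp add: map_replicate_const)
  qed
  then show ?thesis by (simp add: QF_ones_def QM_def ones.rep_eq)
qed

lemma qinv_QM: "qinv (QM \<beta>)"
  by (simp add: qinv_def mps_coeff_QM)

lemma qinv_QF: "qinv (QF i)"
  by (simp add: qinv_def mps_coeff_QF strict_mono_inj)

lemma bounded_degreeI: "(\<And>m. mps_coeff f m \<noteq> 0 \<Longrightarrow> mdeg m \<le> d) \<Longrightarrow> bounded_degree f"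
  by (auto simp: bounded_degree_def)

lemma bounded_degree_times:
  assumes "bounded_degree f" "bounded_degree g"
  shows "bounded_degree (f * g)"
proof -
  obtain d e where "\<And>m. mps_coeff f m \<noteq> 0 \<Longrightarrow> mdeg m \<le> d" "\<And>m. mps_coeff g m \<noteq> 0 \<Longrightarrow> mdeg m \<le> e"
    using assms by (auto simp: bounded_degree_def)
  then show ?thesis
    by (intro bounded_degreeI[of _ "d + e"]) (fastforce elim!: times_coeff_nonzeroE intro: add_mono)
qed

lemma bounded_degree_add:
  assumes "bounded_degree f" "bounded_degree g"
  shows "bounded_degree (f + g)"
proof -
  obtain d e where "\<And>m. mps_coeff f m \<noteq> 0 \<Longrightarrow> mdeg m \<le> d" "\<And>m. mps_coeff g m \<noteq> 0 \<Longrightarrow> mdeg m \<le> e"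
    using assms by (auto simp: bounded_degree_def)
  then show ?thesis
    by (intro bounded_degreeI[of _ "max d e"]) (metis add.right_neutral max.coboundedI1 max.coboundedI2 plus_mps.rep_eq)
qed

lemma bounded_degree_scale: "bounded_degree f \<Longrightarrow> bounded_degree (mps_scale c f)"
  unfolding bounded_degree_def by (metis mps_scale.rep_eq mult_zero_right)

lemma bounded_degree_0 [simp]: "bounded_degree 0"
  by (simp add: bounded_degree_def)

lemma bounded_degree_QM: "bounded_degree (QM \<beta>)"
  by (rule bounded_degreeI[of _ "comp_size \<beta>"]) (auto simp: mps_coeff_QM split: if_splits)

lemma QSym_iff: "f \<in> QSym \<longleftrightarrow> bounded_degree f \<and> qinv f"
proof
  have "MPS.subspace {f :: 'a mps. bounded_degree f \<and> qinv f}"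
    by (auto simp: MPS.subspace_def bounded_degree_add bounded_degree_scale qinv_def)
  moreover have "range QM \<subseteq> {f :: 'a mps. bounded_degree f \<and> qinv f}"
    by (auto simp: qinv_QM bounded_degree_QM)
  ultimately show "f \<in> QSym \<Longrightarrow> bounded_degree f \<and> qinv f"
    unfolding QSym_def using MPS.span_minimal by blast
next
  assume "bounded_degree f \<and> qinv f"
  then obtain d where d: "\<And>m. mps_coeff f m \<noteq> 0 \<Longrightarrow> mdeg m \<le> d" and q: "qinv f"
    by (auto simp: bounded_degree_def)
  have "f = (\<Sum>\<beta> | comp_size \<beta> \<le> d. mps_scale (mps_coeff f (comp_monomial \<beta>)) (QM \<beta>))"
  proof (rule mps_eqI)
    fix m
    show "mps_coeff f m = mps_coeff (\<Sum>\<beta> | comp_size \<beta> \<le> d. mps_scale (mps_coeff f (comp_monomial \<beta>)) (QM \<beta>)) m"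
      using d[of m] qinv_coeff[OF q, of m] by (auto simp: mps_coeff_QM if_distrib cong: if_cong)
  qed
  then show "f \<in> QSym"
    unfolding QSym_def by (metis (no_types, lifting) MPS.span_base MPS.span_scale MPS.span_sum rangeI)
qed

lemma QSym_times: "f \<in> QSym \<Longrightarrow> g \<in> QSym \<Longrightarrow> f * g \<in> QSym"
  by (simp add: QSym_iff bounded_degree_times qinv_times)

lemma QM_in_QSym [simp]: "QM \<beta> \<in> QSym"
  by (simp add: QSym_def MPS.span_base)

lemma QF_in_QSym [simp]: "QF i \<in> QSym"
  by (auto simp: QSym_iff qinv_QF mps_coeff_QF intro!: bounded_degreeI[of _ i] split: if_splits)

lemma QF_ones_in_QSym [simp]: "QF_ones i \<in> QSym"
  by (simp add: QF_ones_def)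

section \<open>The pairing and the adjoint operators\<close>

lemma pairing_superset:
  assumes "finite A" "Poly_Mapping.keys f \<subseteq> A"
  shows "pairing f G = (\<Sum>\<alpha>\<in>A. Poly_Mapping.lookup f \<alpha> * mps_coeff G (comp_monomial \<alpha>))"
  unfolding pairing_def
  by (rule sum.mono_neutral_left) (use assms in \<open>auto simp: in_keys_iff\<close>)

lemma pairing_add_left: "pairing (f + g) G = pairing f G + pairing g G"
proof -
  let ?A = "Poly_Mapping.keys f \<union> Poly_Mapping.keys g"
  have "Poly_Mapping.keys (f + g) \<subseteq> ?A" by (rule keys_add)
  then show ?thesis
    by (simp add: pairing_superset[of ?A] lookup_add algebra_simps sum.distrib)
qed

lemma pairing_0_left [simp]: "pairing 0 G = 0"
  by (simp add: pairing_def)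

lemma pairing_sum_left: "pairing (sum f A) G = (\<Sum>x\<in>A. pairing (f x) G)"
  by (induction A rule: infinite_finite_induct) (auto simp: pairing_add_left)

lemma pairing_scale_left: "pairing (nsym_scale c f) G = c * pairing f G"
proof -
  have "Poly_Mapping.keys (nsym_scale c f) \<subseteq> Poly_Mapping.keys f"
    by (auto simp: in_keys_iff)
  then show ?thesis
    by (simp add: pairing_superset[of "Poly_Mapping.keys f"] sum_distrib_left mult.assoc)
qed

lemma pairing_add_right: "pairing f (G + G') = pairing f G + pairing f G'"
  by (simp add: pairing_def algebra_simps sum.distrib)

lemma pairing_diff_right: "pairing f (G - G') = pairing f G - pairing f G'"
  by (simp add: pairing_def algebra_simps sum_subtractf)

lemma pairing_scale_right: "pairing f (mps_scale c G) = c * pairing f G"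
  by (simp add: pairing_def sum_distrib_left mult.left_commute)

lemma pairing_0_right [simp]: "pairing f 0 = 0"
  by (simp add: pairing_def)

lemma pairing_sum_right: "pairing f (sum G A) = (\<Sum>x\<in>A. pairing f (G x))"
  by (induction A rule: infinite_finite_induct) (auto simp: pairing_add_right)

lemma pairing_single: "pairing (Poly_Mapping.single \<alpha> c) G = c * mps_coeff G (comp_monomial \<alpha>)"
  by (simp add: pairing_def)

lemma pairing_H_comp: "pairing (H_comp \<alpha>) G = mps_coeff G (comp_monomial \<alpha>)"
  by (simp add: H_comp_def pairing_single)

lemma pairing_QM: "pairing f (QM \<beta>) = Poly_Mapping.lookup f \<beta>"
proof -
  have "pairing f (QM \<beta>) = (\<Sum>\<alpha>\<in>insert \<beta> (Poly_Mapping.keys f).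
      Poly_Mapping.lookup f \<alpha> * mps_coeff (QM \<beta>) (comp_monomial \<alpha>))"
    by (rule pairing_superset) auto
  also have "\<dots> = Poly_Mapping.lookup f \<beta>"
    by (simp add: mps_coeff_QM if_distrib cong: if_cong)
  finally show ?thesis .
qed

lemma nsym_expand: "f = (\<Sum>\<alpha>\<in>Poly_Mapping.keys f. nsym_scale (Poly_Mapping.lookup f \<alpha>) (H_comp \<alpha>))"
proof (rule poly_mapping_eqI)
  fix \<beta>
  have "Poly_Mapping.lookup (\<Sum>\<alpha>\<in>Poly_Mapping.keys f. nsym_scale (Poly_Mapping.lookup f \<alpha>) (H_comp \<alpha>)) \<beta>
     = (\<Sum>\<alpha>\<in>Poly_Mapping.keys f. if \<alpha> = \<beta> then Poly_Mapping.lookup f \<alpha> else 0)"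
    unfolding lookup_sum
    by (rule sum.cong) (auto simp: H_comp_def lookup_single when_def)
  then show "Poly_Mapping.lookup f \<beta>
      = Poly_Mapping.lookup (\<Sum>\<alpha>\<in>Poly_Mapping.keys f. nsym_scale (Poly_Mapping.lookup f \<alpha>) (H_comp \<alpha>)) \<beta>"
    by (simp add: in_keys_iff)
qed

definition degree_le :: "nat \<Rightarrow> 'a :: zero nsym \<Rightarrow> bool"
  where "degree_le N f \<longleftrightarrow> (\<forall>\<alpha>\<in>Poly_Mapping.keys f. comp_size \<alpha> \<le> N)"

lemma ex_degree_le: "\<exists>N. degree_le N f"
  unfolding degree_le_def
  by (rule exI[of _ "Max (comp_size ` Poly_Mapping.keys f)"]) simp

lemma pairing_cong:
  assumes "degree_le N f" "\<And>m. mdeg m \<le> N \<Longrightarrow> mps_coeff G m = mps_coeff G' m"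
  shows "pairing f G = pairing f G'"
  unfolding pairing_def by (rule sum.cong) (use assms in \<open>auto simp: degree_le_def\<close>)

lemma pairing_times_eq_0:
  assumes "degree_le N f" "\<And>m. mps_coeff G m \<noteq> 0 \<Longrightarrow> N < mdeg m"
  shows "pairing f (F * G) = 0"
proof -
  have "mps_coeff (F * G) m = 0" if "mdeg m \<le> N" for m
  proof (rule ccontr)
    assume "mps_coeff (F * G) m \<noteq> 0"
    then obtain a b where "a + b = m" "mps_coeff G b \<noteq> 0" by (rule times_coeff_nonzeroE)
    then show False using assms(2)[of b] that by auto
  qed
  then have "pairing f (F * G) = pairing f 0" by (intro pairing_cong[OF assms(1)]) simp
  then show ?thesis by simp
qed

lemma nsym_eqI:
  assumes "\<And>G. G \<in> QSym \<Longrightarrow> pairing f G = pairing g G"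
  shows "f = g"
  by (rule poly_mapping_eqI) (metis assms pairing_QM QM_in_QSym)

text \<open>The coefficient at \<open>\<beta>\<close> is forced to be the pairing of
  \<open>f\<close> with \<open>F * QM \<beta>\<close>. It vanishes once \<open>\<beta>\<close> is
  larger than the degree of \<open>f\<close>, so the candidate has finite support.\<close>

lemma ex_perp: "\<exists>f'. \<forall>G\<in>QSym. pairing f' G = pairing f (F * G)"
proof -
  obtain N where N: "degree_le N f" using ex_degree_le by blast
  have fin: "finite {\<beta>. pairing f (F * QM \<beta>) \<noteq> 0}"
  proof (rule finite_subset[OF _ finite_comp_size_le[of N]], safe)
    fix \<beta> assume nz: "pairing f (F * QM \<beta>) \<noteq> 0"
    show "comp_size \<beta> \<le> N"
    proof (rule ccontr)
      assume "\<not> comp_size \<beta> \<le> N"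
      then have "pairing f (F * QM \<beta>) = 0"
        by (intro pairing_times_eq_0[OF N]) (auto simp: mps_coeff_QM split: if_splits)
      then show False using nz by simp
    qed
  qed
  define f' where "f' = Abs_poly_mapping (\<lambda>\<beta>. pairing f (F * QM \<beta>))"
  have lookup: "pairing f' (QM \<beta>) = pairing f (F * QM \<beta>)" for \<beta>
    using fin by (simp add: pairing_QM f'_def)
  have "pairing f' G = pairing f (F * G)" if "G \<in> QSym" for G
    using that unfolding QSym_def
  proof (induction rule: MPS.span_induct_alt)
    case (step c x y)
    then show ?case
      by (auto simp: lookup pairing_add_right pairing_scale_right distrib_left times_mps_scale)
  qed simp
  then show ?thesis by blast
qed

lemma pairing_perp: "G \<in> QSym \<Longrightarrow> pairing (perp F f) G = pairing f (F * G)"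
proof -
  assume G: "G \<in> QSym"
  have "\<exists>!f'. \<forall>G\<in>QSym. pairing f' G = pairing f (F * G)"
    using ex_perp[of f F] nsym_eqI by (metis (no_types, lifting))
  then have "\<forall>G\<in>QSym. pairing (perp F f) G = pairing f (F * G)"
    unfolding perp_def by (rule theI')
  then show ?thesis using G by blast
qed

lemma perp_1: "perp 1 f = f"
  by (rule nsym_eqI) (simp add: pairing_perp)

lemma perp_eq_0:
  assumes "degree_le N f" "\<And>m. mps_coeff F m \<noteq> 0 \<Longrightarrow> N < mdeg m"
  shows "perp F f = 0"
proof (rule nsym_eqI)
  fix G :: "'a mps" assume "G \<in> QSym"
  then show "pairing (perp F f) G = pairing 0 G"
    using pairing_times_eq_0[where F = G and G = F, OF assms]
    by (simp add: pairing_perp mult.commute)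
qed

lemma perp_0 [simp]: "perp F 0 = 0"
  by (rule nsym_eqI) (simp add: pairing_perp)

lemma degree_le_perp:
  assumes "degree_le N f"
  shows "degree_le N (perp F f)"
  unfolding degree_le_def
proof (intro ballI, rule ccontr)
  fix \<beta> assume \<beta>: "\<beta> \<in> Poly_Mapping.keys (perp F f)" "\<not> comp_size \<beta> \<le> N"
  have "Poly_Mapping.lookup (perp F f) \<beta> = pairing f (F * QM \<beta>)"
    by (metis pairing_QM pairing_perp QM_in_QSym)
  also have "\<dots> = 0"
    using \<beta>(2) by (intro pairing_times_eq_0[OF assms]) (auto simp: mps_coeff_QM split: if_splits)
  finally show False using \<beta>(1) by (simp add: in_keys_iff)
qed

text \<open>The coefficient of \<open>x_0^r\<close>, with the other variables shifted down. It is
  the adjoint of left multiplication by \<open>H_r\<close>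
  (\<open>pairing_H_gen_times\<close>).\<close>

definition coeff_x0 :: "nat \<Rightarrow> 'a :: comm_ring_1 mps \<Rightarrow> 'a mps"
  where "coeff_x0 r G = Abs_mps (\<lambda>c. mps_coeff G (mcons r c))"

lemma mps_coeff_coeff_x0 [simp]: "mps_coeff (coeff_x0 r G) c = mps_coeff G (mcons r c)"
  by (simp add: coeff_x0_def)

lemma coeff_x0_in_QSym:
  assumes "G \<in> QSym"
  shows "coeff_x0 r G \<in> QSym"
proof -
  obtain d where d: "\<And>m. mps_coeff G m \<noteq> 0 \<Longrightarrow> mdeg m \<le> d" and q: "qinv G"
    using assms by (auto simp: QSym_iff bounded_degree_def)
  have "mdeg c \<le> d" if "mps_coeff G (mcons r c) \<noteq> 0" for c
    using d[OF that] by simp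
  moreover have "mps_coeff G (mcons r (relabel \<pi> c)) = mps_coeff G (mcons r c)" if "strict_mono \<pi>" for \<pi> c
    using qinvD[OF q relabel_mcons(1)[OF that], of "mcons r c"] relabel_mcons(2)[OF that, of r c]
    by simp
  ultimately show ?thesis
    by (auto simp: QSym_iff qinv_def bounded_degree_def)
qed

lemma comp_monomial_single_part_add:
  "0 < r \<Longrightarrow> comp_monomial (single_part r + \<alpha>) = mcons r (comp_monomial \<alpha>)"
  by (rule monomial_eqI_0_Suc)
    (simp_all add: lookup_comp_monomial part_def plus_composition.rep_eq single_part.rep_eq)

lemma single_part_0: "single_part 0 = 0"
  by (rule parts_inject[THEN iffD1]) (simp add: single_part.rep_eq zero_composition.rep_eq)

lemma H_comp_mult: "H_comp \<alpha> * H_comp \<beta> = H_comp (\<alpha> + \<beta>)"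
  by (simp add: H_comp_def mult_single)

lemma nsym_scale_conv: "nsym_scale c f = Poly_Mapping.single 0 c * f"
  by (simp add: nsym_scale_def mult_map_scale_conv_mult)

lemma update_eq_add_single:
  "a \<notin> Poly_Mapping.keys f \<Longrightarrow> Poly_Mapping.update a b f = f + Poly_Mapping.single a b"
  by (intro poly_mapping_eqI) (auto simp: lookup_update lookup_add lookup_single in_keys_iff)

lemma times_nsym_scale: "g * nsym_scale c (f :: 'a :: comm_ring_1 nsym) = nsym_scale c (g * f)"
proof (rule poly_mapping_eqI)
  fix \<alpha>
  have "g * Poly_Mapping.single 0 c = Poly_Mapping.single 0 c * g"
  proof (induction g rule: update_induct)
    case (update f a b)
    then show ?case
      by (simp add: update_eq_add_single distrib_left distrib_right mult_single mult.commute)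
  qed simp
  then show "Poly_Mapping.lookup (g * nsym_scale c f) \<alpha> = Poly_Mapping.lookup (nsym_scale c (g * f)) \<alpha>"
    unfolding nsym_scale_conv mult.assoc[symmetric] by simp
qed

text \<open>Quasisymmetry is used at \<open>r = 0\<close>: there \<open>H_0 = 1\<close> leaves the
  leading monomial in place, while \<open>mcons 0\<close> shifts it by one variable.\<close>

lemma pairing_H_gen_times:
  assumes "qinv G"
  shows "pairing (H_gen (int r) * f) G = pairing f (coeff_x0 r G)"
proof -
  have H: "pairing (H_gen (int r) * H_comp \<alpha>) G = mps_coeff G (mcons r (comp_monomial \<alpha>))" for \<alpha>
    using qinv_mcons_0[OF assms]
    by (cases "r = 0")
      (simp_all add: H_gen_def H_comp_mult single_part_0 pairing_H_comp comp_monomial_single_part_add)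
  have "pairing (H_gen (int r) * f) G = pairing (H_gen (int r) *
      (\<Sum>\<alpha>\<in>Poly_Mapping.keys f. nsym_scale (Poly_Mapping.lookup f \<alpha>) (H_comp \<alpha>))) G"
    using nsym_expand[of f] by simp
  also have "\<dots> = pairing f (coeff_x0 r G)"
    by (simp add: sum_distrib_left times_nsym_scale pairing_sum_left pairing_scale_left H)
      (simp add: pairing_def)
  finally show ?thesis .
qed

text \<open>The alternating sum of all elementary symmetric functions, that is, the product of all
  \<open>1 - x_i\<close>. Likewise \<open>H_plus q\<close> is the product of all
  \<open>1 / (1 - q x_i)\<close>.\<close>

definition E_minus :: "'a :: comm_ring_1 mps"
  where "E_minus = Abs_mps (\<lambda>m. if squarefree_mon m then (-1) ^ mdeg m else 0)"

definition H_plus :: "'a :: comm_ring_1 \<Rightarrow> 'a mps"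
  where "H_plus q = Abs_mps (\<lambda>m. q ^ mdeg m)"

text \<open>The kernel \<open>\<Prod>\<^sub>i (1 - x\<^sub>i) / (1 - q x\<^sub>i)\<close>.\<close>

definition HL_kernel :: "'a :: comm_ring_1 \<Rightarrow> 'a mps"
  where "HL_kernel q = H_plus q * E_minus"

text \<open>The adjoint of the creation operator with parameter \<open>q\<close>: the coefficient of \<open>x\<^sub>0\<^sup>r\<close> in
  \<open>G(x\<^sub>0, x\<^sub>1, \<dots>) \<Prod>\<^sub>i (1 - x\<^sub>i / x\<^sub>0) / (1 - q x\<^sub>i / x\<^sub>0)\<close>.\<close>

definition Bt_adj :: "'a :: comm_ring_1 \<Rightarrow> nat \<Rightarrow> 'a mps \<Rightarrow> 'a mps"
  where "Bt_adj q r G = Abs_mps (\<lambda>c. \<Sum>(a, b)\<in>splits c.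
    mps_coeff (HL_kernel q) a * mps_coeff G (mcons (r + mdeg a) b))"

lemma qinv_HL_kernel: "qinv (HL_kernel q)"
proof -
  have "qinv (E_minus :: 'a mps)" "qinv (H_plus q)"
    by (auto simp: qinv_def E_minus_def H_plus_def strict_mono_inj squarefree_mon_relabel)
  then show ?thesis unfolding HL_kernel_def by (intro qinv_times)
qed

lemma Bt_adj_in_QSym:
  assumes "G \<in> QSym"
  shows "Bt_adj q r G \<in> QSym"
proof -
  obtain d where d: "\<And>m. mps_coeff G m \<noteq> 0 \<Longrightarrow> mdeg m \<le> d" and q: "qinv G"
    using assms by (auto simp: QSym_iff bounded_degree_def)
  have "mdeg c \<le> d" if nz: "mps_coeff (Bt_adj q r G) c \<noteq> 0" for c
  proof -
    have "\<exists>p\<in>splits c. (case p of (a, b) \<Rightarrow> mps_coeff (HL_kernel q) a * mps_coeff G (mcons (r + mdeg a) b)) \<noteq> 0"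
      using nz unfolding Bt_adj_def mps_coeff_Abs by (meson sum.neutral)
    then obtain a b where "a + b = c" "mps_coeff G (mcons (r + mdeg a) b) \<noteq> 0"
      by (auto dest: mult_not_zero)
    then show ?thesis using d by fastforce
  qed
  moreover have "mps_coeff G (mcons s (relabel \<pi> c)) = mps_coeff G (mcons s c)" if "strict_mono \<pi>" for \<pi> c s
    using qinvD[OF q relabel_mcons(1)[OF that], of "mcons s c"] relabel_mcons(2)[OF that, of s c]
    by simp
  ultimately show ?thesis using qinv_HL_kernel[of q]
    by (auto simp: QSym_iff qinv_def bounded_degree_def Bt_adj_def sum_splits_relabel strict_mono_inj)
qed

lemma sum_splits_assoc:
  "(\<Sum>(v, w)\<in>splits c. \<Sum>(u, b)\<in>splits w. F v u b) = (\<Sum>(a, b)\<in>splits c. \<Sum>(v, u)\<in>splits a. F v u b)"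
proof -
  have "(\<Sum>(v, w)\<in>splits c. \<Sum>(u, b)\<in>splits w. F v u b)
      = (\<Sum>((v, w), (u, b))\<in>(SIGMA p:splits c. splits (snd p)). F v u b)"
    by (subst sum.Sigma[symmetric]) (auto simp: case_prod_unfold)
  also have "\<dots> = (\<Sum>((a, b), (v, u))\<in>(SIGMA p:splits c. splits (fst p)). F v u b)"
    by (rule sum.reindex_bij_witness
        [where j = "\<lambda>((v, w), (u, b)). ((v + u, b), (v, u))"
           and i = "\<lambda>((a, b), (v, u)). ((v, u + b), (u, b))"])
       (auto simp: splits_def ac_simps)
  also have "\<dots> = (\<Sum>(a, b)\<in>splits c. \<Sum>(v, u)\<in>splits a. F v u b)"
    by (subst sum.Sigma[symmetric]) (auto simp: case_prod_unfold)
  finally show ?thesis .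
qed

text \<open>The parameter \<^const>\<open>qvar\<close> gives \<^const>\<open>Bt_op\<close>, and \<open>q = 0\<close> gives \<^const>\<open>B_op\<close>, since
  \<open>0 ^ i\<close> vanishes for \<open>i > 0\<close>.\<close>

definition Bt_gen :: "'a :: field \<Rightarrow> int \<Rightarrow> 'a nsym \<Rightarrow> 'a nsym"
  where "Bt_gen q m f = Sum_any (\<lambda>i::nat. nsym_scale (q ^ i) (B_op (m + int i) (perp (QF i) f)))"

definition HL_gen :: "'a :: field \<Rightarrow> composition \<Rightarrow> 'a nsym"
  where "HL_gen q \<alpha> = foldr (\<lambda>a. Bt_gen q (int a)) (parts \<alpha>) 1"

lemma HL_nsym_eq: "HL_nsym \<alpha> = HL_gen qvar \<alpha>"
  unfolding HL_nsym_def HL_gen_def Bt_op_def Bt_gen_def by simp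

lemma B_op_sum:
  assumes "degree_le N f"
  shows "B_op m f = (\<Sum>i\<le>N. (-1) ^ i * H_gen (m + int i) * perp (QF_ones i) f)"
  unfolding B_op_def
proof (rule Sum_any.expand_superset)
  show "{i. (-1) ^ i * H_gen (m + int i) * perp (QF_ones i) f \<noteq> 0} \<subseteq> {..N}"
  proof safe
    fix i assume nz: "(-1) ^ i * H_gen (m + int i) * perp (QF_ones i) f \<noteq> 0"
    then have "perp (QF_ones i) f \<noteq> 0" by auto
    then show "i \<le> N"
      using perp_eq_0[OF assms, of "QF_ones i"] by (force simp: mps_coeff_QF_ones split: if_splits)
  qed
qed simp

lemma B_op_0 [simp]: "B_op m 0 = 0"
  by (subst B_op_sum[of 0]) (auto simp: degree_le_def)

lemma Bt_gen_sum:
  assumes "degree_le N f"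
  shows "Bt_gen q m f = (\<Sum>i\<le>N. nsym_scale (q ^ i) (B_op (m + int i) (perp (QF i) f)))"
  unfolding Bt_gen_def
proof (rule Sum_any.expand_superset)
  show "{i. nsym_scale (q ^ i) (B_op (m + int i) (perp (QF i) f)) \<noteq> 0} \<subseteq> {..N}"
  proof safe
    fix i assume nz: "nsym_scale (q ^ i) (B_op (m + int i) (perp (QF i) f)) \<noteq> 0"
    then have "perp (QF i) f \<noteq> 0" by auto
    then show "i \<le> N"
      using perp_eq_0[OF assms, of "QF i"] by (force simp: mps_coeff_QF split: if_splits)
  qed
qed simp

lemma QF_0: "QF 0 = 1"
  by (rule mps_eqI) (simp add: mps_coeff_QF)

lemma Bt_gen_0: "Bt_gen 0 m f = B_op m f"
proof -
  obtain N where N: "degree_le N f" using ex_degree_le by blast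
  have "Bt_gen 0 m f = (\<Sum>i\<le>N. if i = 0 then B_op m f else 0)"
    unfolding Bt_gen_sum[OF N]
    by (rule sum.cong) (auto simp: QF_0 perp_1 power_0_left)
  then show ?thesis by simp
qed

lemma immaculate_eq: "immaculate \<alpha> = HL_gen 0 \<alpha>"
  by (simp add: immaculate_def HL_gen_def Bt_gen_0[abs_def])

lemma pairing_neg_one_power: "pairing ((-1) ^ i * g * f) G = (-1) ^ i * pairing (g * f) G"
proof -
  have "(-1) ^ i = (Poly_Mapping.single 0 ((-1) ^ i) :: 'a nsym)"
    by (induction i) (auto simp: mult_single single_uminus[symmetric] simp flip: single_one)
  then have "(-1) ^ i * g * f = nsym_scale ((-1) ^ i) (g * f)"
    by (simp add: nsym_scale_conv mult.assoc)
  then show ?thesis by (simp add: pairing_scale_left)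
qed

lemma pairing_B_op:
  assumes "degree_le N f" "G \<in> QSym"
  shows "pairing (B_op (int m) f) G = (\<Sum>i\<le>N. (-1) ^ i * pairing f (QF_ones i * coeff_x0 (m + i) G))"
proof -
  have "qinv G" using assms(2) by (simp add: QSym_iff)
  then have "pairing (H_gen (int m + int i) * perp (QF_ones i) f) G
      = pairing f (QF_ones i * coeff_x0 (m + i) G)" for i
    using pairing_H_gen_times[of G "m + i" "perp (QF_ones i) f"]
    by (simp add: pairing_perp coeff_x0_in_QSym assms(2))
  then show ?thesis
    by (simp add: B_op_sum[OF assms(1)] pairing_sum_left pairing_neg_one_power)
qed

lemma pairing_Bt_gen:
  assumes "G \<in> QSym"
  shows "pairing (Bt_gen q (int m) f) G = pairing f (Bt_adj q m G)"
proof -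
  obtain N where N: "degree_le N f" using ex_degree_le by blast
  let ?F = "\<lambda>k i. QF k * (QF_ones i * coeff_x0 (m + k + i) G)"
  \<comment> \<open>As \<open>perp\<close> does not raise the degree, the bound \<open>N\<close> for
    \<open>f\<close> also serves the inner sum, for every \<open>k\<close>.\<close>
  have "pairing (B_op (int m + int k) (perp (QF k) f)) G = (\<Sum>i\<le>N. (-1) ^ i * pairing f (?F k i))" for k
    using pairing_B_op[OF degree_le_perp[OF N, of "QF k"] assms, of "m + k"]
    by (simp add: pairing_perp coeff_x0_in_QSym assms QSym_times)
  then have "pairing (Bt_gen q (int m) f) G
      = pairing f (\<Sum>k\<le>N. mps_scale (q ^ k) (\<Sum>i\<le>N. mps_scale ((-1) ^ i) (?F k i)))"
    by (simp add: Bt_gen_sum[OF N] pairing_sum_left pairing_scale_left pairing_sum_right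
        pairing_scale_right)
  also have "\<dots> = pairing f (Bt_adj q m G)"
  proof (rule pairing_cong[OF N])
    fix c assume c: "mdeg c \<le> N"
    have "mps_coeff (\<Sum>k\<le>N. mps_scale (q ^ k) (\<Sum>i\<le>N. mps_scale ((-1) ^ i) (?F k i))) c
      = (\<Sum>k\<le>N. \<Sum>i\<le>N. \<Sum>(v, w)\<in>splits c. \<Sum>(u, b)\<in>splits w.
          q ^ k * ((-1) ^ i * (mps_coeff (QF k) v * (mps_coeff (QF_ones i) u * mps_coeff G (mcons (m + k + i) b)))))"
      by (simp add: mps_coeff_times sum_distrib_left case_prod_unfold)
    also have "\<dots> = (\<Sum>(v, w)\<in>splits c. \<Sum>(u, b)\<in>splits w. \<Sum>k\<le>N. \<Sum>i\<le>N.
          q ^ k * ((-1) ^ i * (mps_coeff (QF k) v * (mps_coeff (QF_ones i) u * mps_coeff G (mcons (m + k + i) b)))))"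
      unfolding case_prod_unfold
      by (subst sum.swap, subst (2) sum.swap)
         (simp add: sum.swap[of _ "{..N}" "splits _"])
    also have "\<dots> = (\<Sum>(v, w)\<in>splits c. \<Sum>(u, b)\<in>splits w.
        mps_coeff (H_plus q) v * mps_coeff E_minus u * mps_coeff G (mcons (m + mdeg v + mdeg u) b))"
    proof (intro sum.cong refl, clarsimp, intro sum.cong refl, clarsimp)
      fix v u b assume "c = v + (u + b)"
      then have vu: "mdeg v \<le> N" "mdeg u \<le> N" using c by auto
      let ?Y = "mps_coeff (H_plus q) v * mps_coeff E_minus u * mps_coeff G (mcons (m + mdeg v + mdeg u) b)"
      \<comment> \<open>\<open>QF k\<close> and \<open>QF_ones i\<close> are homogeneous, so the
        degrees of \<open>v\<close> and \<open>u\<close> select one pair \<open>(k, i)\<close>; the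
        double sum collapses to the kernel.\<close>
      have "q ^ k * ((-1) ^ i * (mps_coeff (QF k) v * (mps_coeff (QF_ones i) u * mps_coeff G (mcons (m + k + i) b))))
        = (if k = mdeg v then if i = mdeg u then ?Y else 0 else 0)" for k i
        by (simp add: mps_coeff_QF mps_coeff_QF_ones H_plus_def E_minus_def)
      moreover have "(\<Sum>k\<le>N. \<Sum>i\<le>N. if k = mdeg v then if i = mdeg u then ?Y else 0 else 0)
          = (\<Sum>k\<le>N. if k = mdeg v then ?Y else 0)"
        using vu by (intro sum.cong) auto
      ultimately show "(\<Sum>k\<le>N. \<Sum>i\<le>N. q ^ k * ((-1) ^ i * (mps_coeff (QF k) v * (mps_coeff (QF_ones i) u * mps_coeff G (mcons (m + k + i) b)))))
        = ?Y"
        using vu by simp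
    qed
    also have "\<dots> = mps_coeff (Bt_adj q m G) c"
      unfolding sum_splits_assoc
      by (auto simp: Bt_adj_def HL_kernel_def mps_coeff_times sum_distrib_right case_prod_unfold add.assoc
          intro!: sum.cong)
    finally show "mps_coeff (\<Sum>k\<le>N. mps_scale (q ^ k) (\<Sum>i\<le>N. mps_scale ((-1) ^ i) (?F k i))) c
      = mps_coeff (Bt_adj q m G) c" .
  qed
  finally show ?thesis .
qed

text \<open>Adjunction reverses composition: the operator of the first part is outermost, so its
  adjoint is the first to act on \<open>G\<close>, and \<open>foldr\<close> turns into
  \<open>fold\<close>. Pairing with 1 then reads off the constant term.\<close>

theorem pairing_HL_gen:
  assumes "G \<in> QSym"
  shows "pairing (HL_gen q \<alpha>) G = mps_coeff (fold (Bt_adj q) (parts \<alpha>) G) 0"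
proof -
  have "pairing (foldr (\<lambda>a. Bt_gen q (int a)) xs 1) G = mps_coeff (fold (Bt_adj q) xs G) 0" for xs
    using assms
  proof (induction xs arbitrary: G)
    case Nil
    have "pairing (H_comp 0) G = mps_coeff G 0"
      by (simp add: pairing_H_comp comp_monomial_def zero_composition.rep_eq)
    then show ?case by (simp add: H_comp_def)
  next
    case (Cons a xs)
    then show ?case by (simp add: pairing_Bt_gen Bt_adj_in_QSym)
  qed
  then show ?thesis by (simp add: HL_gen_def)
qed

section \<open>The product formula for the pairing\<close>

abbreviation umon :: "nat \<Rightarrow> monomial"
  where "umon j \<equiv> Poly_Mapping.single j (Suc 0)"

lemma mdeg_pos_iff [simp]: "0 < mdeg m \<longleftrightarrow> m \<noteq> 0"
  using mdeg_eq_0_iff[of m] by linarith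

abbreviation xvr :: "nat \<Rightarrow> 'a :: comm_ring_1 mps"
  where "xvr j \<equiv> xpow (umon j)"

lemma mps_coeff_xvr_times:
  "mps_coeff (xvr j * f) m = (if lkp m j = 0 then 0 else mps_coeff f (m - umon j))"
proof (cases "lkp m j = 0")
  case True
  have "m \<noteq> umon j + k" for k
    using True by (metis add_is_0 lookup_add lookup_single_eq nat.distinct(1))
  then show ?thesis using True by (simp add: mps_coeff_xpow_times_eq_0)
next
  case False
  have "m = umon j + (m - umon j)"
    by (rule poly_mapping_eqI) (use False in \<open>auto simp: lookup_add lookup_minus lookup_single when_def\<close>)
  then show ?thesis using False by (metis mps_coeff_xpow_times)
qed

section \<open>Truncation to finitely many variables; the kernel as a product\<close>

definition trunc :: "nat \<Rightarrow> 'a :: comm_ring_1 mps \<Rightarrow> 'a mps"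
  where "trunc n f = Abs_mps (\<lambda>m. if kys m \<subseteq> {..<n} then mps_coeff f m else 0)"

lemma mps_coeff_trunc [simp]: "mps_coeff (trunc n f) m = (if kys m \<subseteq> {..<n} then mps_coeff f m else 0)"
  by (simp add: trunc_def)

lemma keys_add_monomial: "kys (a + b) = kys a \<union> kys b"
  by (auto simp: in_keys_iff lookup_add)

lemma kys_lessThan_Suc: "kys m \<subseteq> {..<Suc N} \<longleftrightarrow> kys (m - Poly_Mapping.single N k) \<subseteq> {..<Suc N}"
  by (auto simp: subset_iff in_keys_iff lookup_minus lookup_single when_def split: if_splits)

lemma kys_lessThan_iff: "kys m \<subseteq> {..<N} \<longleftrightarrow> kys m \<subseteq> {..<Suc N} \<and> lkp m N = 0"
  unfolding subset_iff in_keys_iff lessThan_iff less_Suc_eq by (metis less_irrefl)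

lemma mdeg_minus_single: "lkp m j \<noteq> 0 \<Longrightarrow> mdeg m = Suc (mdeg (m - umon j))"
proof -
  assume "lkp m j \<noteq> 0"
  then have "m = umon j + (m - umon j)"
    by (intro poly_mapping_eqI) (auto simp: lookup_add lookup_minus lookup_single when_def)
  then have "mdeg m = mdeg (umon j) + mdeg (m - umon j)"
    by (metis mdeg_add)
  then show ?thesis by simp
qed

text \<open>Truncations stand in for the infinite product. The factor for \<open>x_N\<close> is
  peeled off by distinguishing the exponent of \<open>x_N\<close>: absent, 1, or at least 2, where
  both sides vanish.\<close>

lemma trunc_E_minus: "trunc N (E_minus :: 'a :: comm_ring_1 mps) = (\<Prod>j<N. 1 - xvr j)"
proof (induction N)
  case 0
  show ?case by (rule mps_eqI) (auto simp: E_minus_def squarefree_mon_def)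
next
  case (Suc N)
  have "trunc (Suc N) E_minus = trunc N E_minus * (1 - xvr N :: 'a mps)"
  proof (rule mps_eqI)
    fix m :: monomial
    let ?m = "m - umon N"
    have eq: "mps_coeff (trunc N E_minus * (1 - xvr N :: 'a mps)) m
        = mps_coeff (trunc N E_minus) m - (if lkp m N = 0 then 0 else mps_coeff (trunc N E_minus) ?m)"
      by (simp add: right_diff_distrib mult.commute[of _ "xvr N"] mps_coeff_xvr_times)
    consider "lkp m N = 0" | "lkp m N = 1" | "lkp m N \<ge> 2" by linarith
    then show "mps_coeff (trunc (Suc N) E_minus) m = mps_coeff (trunc N E_minus * (1 - xvr N :: 'a mps)) m"
    proof cases
      case 1
      then show ?thesis unfolding eq by (simp add: kys_lessThan_iff[of m N])
    next
      case 2
      have "squarefree_mon ?m \<longleftrightarrow> squarefree_mon m"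
        using 2 unfolding squarefree_mon_def
        by (intro iff_allI) (auto simp: lookup_minus lookup_single when_def)
      moreover have "lkp ?m N = 0" using 2 by (simp add: lookup_minus)
      ultimately show ?thesis
        unfolding eq using 2 mdeg_minus_single[of m N] kys_lessThan_Suc[of m N 1]
        by (simp add: kys_lessThan_iff[of m N] kys_lessThan_iff[of ?m N] E_minus_def)
    next
      case 3
      then have "\<not> squarefree_mon m" "lkp ?m N \<noteq> 0"
        by (auto simp: squarefree_mon_def lookup_minus not_le intro!: exI[of _ N])
      then show ?thesis unfolding eq using 3
        by (simp add: kys_lessThan_iff[of m N] kys_lessThan_iff[of ?m N] E_minus_def)
    qed
  qed
  then show ?case using Suc by simp
qed

text \<open>Multiplication by \<open>1 - q x_N\<close> cancels all terms containing
  \<open>x_N\<close>, so the variables disappear one at a time.\<close>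

lemma trunc_H_plus: "trunc N (H_plus q) * (\<Prod>j<N. 1 - mps_scale q (xvr j)) = 1"
proof (induction N)
  case 0
  show ?case by (rule mps_eqI) (auto simp: H_plus_def)
next
  case (Suc N)
  have "trunc (Suc N) (H_plus q) * (1 - mps_scale q (xvr N)) = trunc N (H_plus q)"
  proof (rule mps_eqI)
    fix m :: monomial
    let ?m = "m - umon N"
    have eq: "mps_coeff (trunc (Suc N) (H_plus q) * (1 - mps_scale q (xvr N))) m
        = mps_coeff (trunc (Suc N) (H_plus q)) m
          - q * (if lkp m N = 0 then 0 else mps_coeff (trunc (Suc N) (H_plus q)) ?m)"
      by (simp add: right_diff_distrib mult.commute[of _ "mps_scale q (xvr N)"] mps_coeff_scale_times
          mps_coeff_xvr_times)
    show "mps_coeff (trunc (Suc N) (H_plus q) * (1 - mps_scale q (xvr N))) m = mps_coeff (trunc N (H_plus q)) m"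
    proof (cases "lkp m N = 0")
      case True
      then show ?thesis unfolding eq by (simp add: kys_lessThan_iff[of m N])
    next
      case False
      then show ?thesis
        unfolding eq using mdeg_minus_single[of m N] kys_lessThan_Suc[of m N 1]
        by (simp add: kys_lessThan_iff[of m N] H_plus_def)
    qed
  qed
  then have "trunc (Suc N) (H_plus q) * (1 - mps_scale q (xvr N)) * (\<Prod>j<N. 1 - mps_scale q (xvr j)) = 1"
    using Suc by simp
  then show ?case by (simp only: prod.lessThan_Suc ac_simps)
qed

text \<open>The quotient \<open>(1 - y) / (1 - q y)\<close> at the monomial \<open>y = x^p\<close>,
  for nonzero \<open>p\<close>.\<close>

definition x_factor :: "'a :: comm_ring_1 \<Rightarrow> monomial \<Rightarrow> 'a mps"
  where "x_factor q p = (1 - xpow p) * mps_geom (mps_scale q (xpow p))"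

lemma umon_nonzero [simp]: "umon j \<noteq> 0" "0 \<noteq> umon j"
  by (metis lookup_single_eq lookup_zero nat.distinct(1))+

lemma trunc_H_plus_eq: "trunc N (H_plus q) = (\<Prod>j<N. mps_geom (mps_scale q (xvr j)))"
proof -
  let ?P = "\<Prod>j<N. 1 - mps_scale q (xvr j)" and ?G = "\<Prod>j<N. mps_geom (mps_scale q (xvr j))"
  have "?P * ?G = 1" by (simp add: prod.distrib[symmetric] mps_geom)
  then have "trunc N (H_plus q) = trunc N (H_plus q) * (?P * ?G)" by simp
  also have "\<dots> = (trunc N (H_plus q) * ?P) * ?G" by (simp only: mult.assoc)
  also have "\<dots> = ?G" by (simp only: trunc_H_plus mult_1_left)
  finally show ?thesis .
qed

lemma mps_coeff_times_trunc:
  assumes "kys c \<subseteq> {..<N}"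
  shows "mps_coeff (trunc N f * trunc N g) c = mps_coeff (f * g) c"
  by (rule mps_coeff_times_cong) (use assms in \<open>auto simp: keys_add_monomial\<close>)

lemma HL_kernel_coeff:
  assumes "kys c \<subseteq> {..<N}"
  shows "mps_coeff (HL_kernel q) c = mps_coeff (\<Prod>j<N. x_factor q (umon j)) c"
  unfolding x_factor_def prod.distrib trunc_H_plus_eq[symmetric] trunc_E_minus[symmetric] HL_kernel_def
    mps_coeff_times_trunc[OF assms] by (simp only: mult.commute)

lemma mps_scale_1 [simp]: "mps_scale 1 f = f"
  by (rule mps_eqI) simp

text \<open>Numerator and denominator cancel at \<open>q = 1\<close>. This gives the specialization
  \<open>q = 1\<close> and also the classical relation between elementary and complete
  functions.\<close>

lemma HL_kernel_1: "HL_kernel (1 :: 'a :: comm_ring_1) = 1"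
proof (rule mps_eqI)
  fix c
  obtain N where N: "kys c \<subseteq> {..<N}"
    by (meson finite_keys finite_nat_iff_bounded)
  have "x_factor (1 :: 'a) (umon j) = 1" for j
    unfolding x_factor_def
    using mps_geom[of "xvr j :: 'a mps"]
    by simp
  then show "mps_coeff (HL_kernel (1 :: 'a)) c = mps_coeff 1 c"
    by (simp add: HL_kernel_coeff[OF N])
qed

text \<open>The positive root \<open>x_b / x_a\<close> written in the simple ratios
  \<open>z_i = x_i / x_(i-1)\<close>.\<close>

definition zroot :: "nat \<Rightarrow> nat \<Rightarrow> monomial"
  where "zroot a b = (\<Sum>i\<in>{a<..b}. umon i)"

lemma lookup_zroot: "lkp (zroot a b) i = (if a < i \<and> i \<le> b then 1 else 0)"
  by (simp add: zroot_def lookup_sum lookup_single when_def)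

lemma tail_single_zroot:
  "a \<le> b \<Longrightarrow> tail (umon b) = tail (umon a) + zroot a b"
  by (rule poly_mapping_eqI) (auto simp: lookup_add lookup_zroot lookup_tail_single)

lemma mcons_zroot: "mcons 0 (zroot a b) = zroot (Suc a) (Suc b)"
  by (rule monomial_eqI_0_Suc) (auto simp: lookup_zroot)

lemma mcons_tail_single: "mcons 0 (tail (umon j)) = zroot 0 (Suc j)"
  by (rule monomial_eqI_0_Suc) (auto simp: lookup_zroot lookup_tail_single)

lemma zroot_nonzero: "a < b \<Longrightarrow> zroot a b \<noteq> 0"
  by (metis lookup_zroot lookup_zero order_refl one_neq_zero)

definition HL_prod :: "'a :: comm_ring_1 \<Rightarrow> nat \<Rightarrow> 'a mps"
  where "HL_prod q N = (\<Prod>a<N. \<Prod>b\<in>{a<..<N}. x_factor q (zroot a b))"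

lemma prod_pairs_Suc:
  fixes f :: "nat \<Rightarrow> nat \<Rightarrow> 'a :: comm_monoid_mult"
  shows "(\<Prod>a<Suc N. \<Prod>b\<in>{a<..<Suc N}. f a b)
    = (\<Prod>j<N. f 0 (Suc j)) * (\<Prod>a<N. \<Prod>b\<in>{a<..<N}. f (Suc a) (Suc b))"
proof -
  have "{0<..<Suc N} = Suc ` {..<N}"
    by (auto simp: image_iff gr0_conv_Suc)
  then have "(\<Prod>b\<in>{0<..<Suc N}. f 0 b) = (\<Prod>j<N. f 0 (Suc j))"
    by (simp add: prod.reindex)
  moreover have "(\<Prod>b\<in>{Suc a<..<Suc N}. f (Suc a) b) = (\<Prod>b\<in>{a<..<N}. f (Suc a) (Suc b))" for a
  proof -
    have "{Suc a<..<Suc N} = Suc ` {a<..<N}"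
    proof (intro equalityI subsetI)
      fix x assume x: "x \<in> {Suc a<..<Suc N}"
      then obtain y where "x = Suc y" by (cases x) auto
      then show "x \<in> Suc ` {a<..<N}" using x by simp
    qed auto
    then show ?thesis by (simp add: prod.reindex)
  qed
  ultimately show ?thesis by (subst prod.lessThan_Suc_shift) simp
qed

lemma push_x_factor:
  assumes "monomial_hom \<theta>" "p \<noteq> 0"
  shows "push \<theta> (x_factor q p) = x_factor q (\<theta> p)"
  unfolding x_factor_def using assms
  by (simp add: push_times push_diff push_1 push_geom push_scale push_xpow)

lemma monomial_hom_mcons: "monomial_hom (mcons 0)"
  using monomial_hom_relabel[of Suc] by (simp add: relabel_Suc[abs_def])

text \<open>The pairs with \<open>a = 0\<close> form the kernel in the remaining variables, because
  \<open>x_(j+1) / x_0 = z_1 ... z_(j+1)\<close> is the shift of \<open>tail (umon j)\<close>. The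
  other pairs are a shifted copy of the smaller product.\<close>

lemma HL_prod_Suc:
  "HL_prod q (Suc N) = push (mcons 0) (push tail (\<Prod>j<N. x_factor q (umon j)) * HL_prod q N)"
proof -
  have t0: "tail p \<noteq> 0" if "p \<noteq> 0" for p using that tail_eq_iff[of p 0] by simp
  show ?thesis
    unfolding HL_prod_def prod_pairs_Suc
    by (simp add: push_times push_prod push_x_factor monomial_hom_mcons monomial_hom_tail
        mcons_zroot mcons_tail_single t0 zroot_nonzero)
qed

lemma x_factor_coeff_0: "p \<noteq> 0 \<Longrightarrow> mps_coeff (x_factor q p) 0 = 1"
  by (simp add: x_factor_def)

lemma mps_coeff_prod_0 [simp]: "mps_coeff (prod f A) 0 = (\<Prod>x\<in>A. mps_coeff (f x) 0)"
  by (induction A rule: infinite_finite_induct) auto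

lemma HL_prod_coeff_0 [simp]: "mps_coeff (HL_prod q N) 0 = 1"
  by (simp add: HL_prod_def x_factor_coeff_0 zroot_nonzero)

lemma supp_x_factor: "submonoid S \<Longrightarrow> p \<in> S \<Longrightarrow> supp (x_factor q p) \<subseteq> S"
  unfolding x_factor_def
  by (intro supp_times supp_diff supp_1 supp_geom supp_scale)
    (use supp_xpow[of p] in auto)

text \<open>The exponent of \<open>z_0\<close> records the total degree in the \<open>x_i\<close>,
  and ratios have degree 0.\<close>

lemma HL_prod_supp_0: "mps_coeff (HL_prod q N) u \<noteq> 0 \<Longrightarrow> lkp u 0 = 0"
proof -
  have "submonoid {u. lkp u 0 = 0}" by (simp add: submonoid_def lookup_add)
  then have "supp (HL_prod q N) \<subseteq> {u. lkp u 0 = 0}"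
    unfolding HL_prod_def by (intro supp_prod supp_x_factor) (auto simp: lookup_zroot)
  then show "mps_coeff (HL_prod q N) u \<noteq> 0 \<Longrightarrow> lkp u 0 = 0" by (auto simp: in_supp)
qed

lemma mps_coeff_times_push_mcons:
  "mps_coeff (f * push (mcons 0) g) (mcons t m) = (\<Sum>(s, u)\<in>splits m. mps_coeff f (mcons t s) * mps_coeff g u)"
proof -
  have "mps_coeff (f * push (mcons 0) g) (mcons t m)
      = (\<Sum>(s, u)\<in>(\<lambda>(s, u). (mcons t s, mcons 0 u)) ` splits m. mps_coeff f s * mps_coeff (push (mcons 0) g) u)"
    unfolding mps_coeff_times
  proof (rule sum.mono_neutral_right)
    show "(\<lambda>(s, u). (mcons t s, mcons 0 u)) ` splits m \<subseteq> splits (mcons t m)"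
      by (auto simp: mcons_add[of t 0, simplified, symmetric])
    show "\<forall>p\<in>splits (mcons t m) - (\<lambda>(s, u). (mcons t s, mcons 0 u)) ` splits m.
        (case p of (s, u) \<Rightarrow> mps_coeff f s * mps_coeff (push (mcons 0) g) u) = 0"
    proof safe
      fix s u assume su: "(s, u) \<in> splits (mcons t m)" "(s, u) \<notin> (\<lambda>(s, u). (mcons t s, mcons 0 u)) ` splits m"
      obtain r s' where s: "s = mcons r s'" by (rule mcons_cases)
      show "mps_coeff f s * mps_coeff (push (mcons 0) g) u = 0"
      proof (cases "mps_coeff (push (mcons 0) g) u = 0")
        case False
        then obtain u' where u: "u = mcons 0 u'"
          by (rule push_coeff_nonzeroE[OF monomial_hom_mcons])
        then have "mcons t m = mcons r (s' + u')"
          using su(1) s by (simp add: mcons_add[of r 0, simplified])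
        then have "r = t" "s' + u' = m" by auto
        then have "(s, u) \<in> (\<lambda>(s, u). (mcons t s, mcons 0 u)) ` splits m"
          using s u by force
        then show ?thesis using su(2) by simp
      qed simp
    qed
  qed simp
  also have "\<dots> = (\<Sum>(s, u)\<in>splits m. mps_coeff f (mcons t s) * mps_coeff g u)"
    by (subst sum.reindex) (auto simp: inj_on_def push_coeff[OF monomial_hom_mcons] intro!: sum.cong)
  finally show ?thesis .
qed

text \<open>The first entry of a tail is the total degree. Prescribing it to be \<open>t\<close>
  fixes the exponent of \<open>x_0\<close> as \<open>t\<close> minus the degree of the remaining
  variables.\<close>

lemma mps_coeff_push_tail_mcons:
  assumes "lkp s 0 \<le> t"
  shows "mps_coeff (push tail G) (mcons t s) = mps_coeff (push tail (coeff_x0 (t - lkp s 0) G)) s"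
proof (cases "s \<in> range tail")
  case True
  then obtain b where s: "s = tail b" by auto
  then have "mcons t s = tail (mcons (t - mdeg b) b)"
    using assms by (simp add: tail_mcons lookup_tail_0)
  then show ?thesis
    by (simp add: s push_coeff monomial_hom_tail lookup_tail_0)
next
  case False
  have "mcons t s \<noteq> tail k" for k
    using False by (cases k rule: mcons_cases) (auto simp: tail_mcons)
  then show ?thesis using False by (subst (1 2) push_coeff_notin) auto
qed

definition hom_part :: "nat \<Rightarrow> 'a :: comm_ring_1 mps \<Rightarrow> 'a mps"
  where "hom_part r f = Abs_mps (\<lambda>m. if mdeg m = r then mps_coeff f m else 0)"

lemma mps_coeff_push_tail_hom_part:
  "mps_coeff (push tail (hom_part r f)) k = (if lkp k 0 = r then mps_coeff (push tail f) k else 0)"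
proof (cases "k \<in> range tail")
  case True
  then show ?thesis
    by (auto simp: push_coeff monomial_hom_tail lookup_tail_0 hom_part_def)
qed (simp add: push_coeff_notin)

text \<open>In \<open>Bt_adj\<close> the exponent of \<open>x_0\<close> depends on the degree of the
  kernel term. Splitting the kernel by degree turns it into a sum of honest products, to which
  \<open>push_times\<close> applies.\<close>

lemma mps_coeff_Bt_adj:
  assumes "mdeg c \<le> R"
  shows "mps_coeff (Bt_adj q m G) c
    = mps_coeff (\<Sum>r\<le>R. hom_part r (HL_kernel q) * coeff_x0 (m + r) G) c"
proof -
  have "mps_coeff (\<Sum>r\<le>R. hom_part r (HL_kernel q) * coeff_x0 (m + r) G) c
    = (\<Sum>(a, b)\<in>splits c. \<Sum>r\<le>R. if r = mdeg a then mps_coeff (HL_kernel q) a * mps_coeff G (mcons (m + r) b) else 0)"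
    unfolding mps_coeff_sum mps_coeff_times case_prod_unfold
    by (subst sum.swap) (auto intro!: sum.cong simp: hom_part_def)
  also have "\<dots> = (\<Sum>(a, b)\<in>splits c. mps_coeff (HL_kernel q) a * mps_coeff G (mcons (m + mdeg a) b))"
    using assms by (intro sum.cong) auto
  finally show ?thesis by (simp add: Bt_adj_def)
qed

lemma push_tail_cong:
  assumes "\<And>c. mdeg c \<le> R \<Longrightarrow> mps_coeff f c = mps_coeff g c" "lkp p 0 \<le> R"
  shows "mps_coeff (push tail f) p = mps_coeff (push tail g) p"
proof (cases "p \<in> range tail")
  case True
  then show ?thesis using assms by (auto simp: push_coeff monomial_hom_tail lookup_tail_0)
qed (simp add: push_coeff_notin)

lemma keys_tail: "kys (tail m) \<subseteq> {..<n} \<longleftrightarrow> kys m \<subseteq> {..<n}"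
proof
  assume t: "kys (tail m) \<subseteq> {..<n}"
  show "kys m \<subseteq> {..<n}"
  proof
    fix i assume "i \<in> kys m"
    then have "i \<in> kys (tail m)" using lookup_tail_step[of m i] by (simp add: in_keys_iff)
    then show "i \<in> {..<n}" using t by blast
  qed
qed (rule keys_tail_subset)

lemma nth_Cons_mcons: "Poly_Mapping.nth (x # xs) = mcons x (Poly_Mapping.nth xs)"
  by (rule monomial_eqI_0_Suc) (simp_all add: nth.rep_eq)

lemma keys_nth_subset: "kys (Poly_Mapping.nth xs) \<subseteq> {..<length xs}"
  by (auto simp: in_keys_iff nth.rep_eq nth_default_def simp del: keys_nth split: if_splits)

text \<open>Each step of the induction adds a variable in front and with it the factors of its
  ratios to all later variables. \<open>N\<close> may exceed the number of parts, so one value can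
  serve all partitions with at most \<open>N\<close> parts.\<close>

theorem fold_Bt_adj:
  "length xs \<le> N \<Longrightarrow> mps_coeff (fold (Bt_adj q) xs G) 0
    = mps_coeff (push tail G * HL_prod q N) (tail (Poly_Mapping.nth xs))"
proof (induction xs arbitrary: N G)
  case Nil
  then show ?case
    using push_coeff[OF monomial_hom_tail, of G 0] by simp
next
  case (Cons m ys)
  then obtain M where N: "N = Suc M" and M: "length ys \<le> M" by (cases N) auto
  define \<tau> where "\<tau> = tail (Poly_Mapping.nth ys)"
  \<comment> \<open>The total size of the remaining parts: no kernel term of larger degree can
    contribute at \<open>\<tau>\<close>.\<close>
  define R where "R = lkp \<tau> 0"
  define K where "K = push tail (HL_kernel q)"
  define C where "C r = push tail (coeff_x0 (m + r) G)" for r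
  let ?P = "HL_prod q M"
  have keys: "kys \<tau> \<subseteq> {..<M}"
    unfolding \<tau>_def keys_tail
    by (rule subset_trans[OF keys_nth_subset]) (use M in simp)
  have K: "mps_coeff K k = mps_coeff (push tail (\<Prod>j<M. x_factor q (umon j))) k"
    if "kys k \<subseteq> {..<M}" for k
  proof (cases "k \<in> range tail")
    case True
    then show ?thesis using that
      by (auto simp: K_def push_coeff monomial_hom_tail keys_tail intro: HL_kernel_coeff)
  qed (simp add: K_def push_coeff_notin)
  \<comment> \<open>\<open>?P\<close> is free of \<open>z_0\<close>, so the degree of the kernel
    factor can be read off as the \<open>z_0\<close> exponent of \<open>u\<close>.\<close>
  have Kr: "mps_coeff (push tail (hom_part r (HL_kernel q)) * ?P) u
      = (if r = lkp u 0 then mps_coeff (K * ?P) u else 0)" for r u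
  proof -
    have "mps_coeff (push tail (hom_part r (HL_kernel q)) * ?P) u
        = (\<Sum>(k, v)\<in>splits u. if r = lkp u 0 then mps_coeff K k * mps_coeff ?P v else 0)"
      unfolding mps_coeff_times
    proof (rule sum.cong[OF refl])
      fix p assume "p \<in> splits u"
      then obtain k v where p: "p = (k, v)" and u: "u = k + v" by (cases p) auto
      show "(case p of (k, v) \<Rightarrow> mps_coeff (push tail (hom_part r (HL_kernel q))) k * mps_coeff ?P v)
          = (case p of (k, v) \<Rightarrow> if r = lkp u 0 then mps_coeff K k * mps_coeff ?P v else 0)"
        unfolding p prod.case using HL_prod_supp_0[of q M v]
        by (cases "mps_coeff ?P v = 0") (auto simp: mps_coeff_push_tail_hom_part K_def u lookup_add)
    qed
    then show ?thesis by (auto simp: mps_coeff_times case_prod_unfold)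
  qed
  have "mps_coeff (fold (Bt_adj q) (m # ys) G) 0 = mps_coeff (push tail (Bt_adj q m G) * ?P) \<tau>"
    using Cons.IH[OF M] by (simp add: \<tau>_def)
  also have "\<dots> = mps_coeff (push tail (\<Sum>r\<le>R. hom_part r (HL_kernel q) * coeff_x0 (m + r) G) * ?P) \<tau>"
    by (rule mps_coeff_times_cong, rule push_tail_cong[OF mps_coeff_Bt_adj])
      (auto simp: R_def lookup_add)
  also have "push tail (\<Sum>r\<le>R. hom_part r (HL_kernel q) * coeff_x0 (m + r) G) * ?P
      = (\<Sum>r\<le>R. C r * (push tail (hom_part r (HL_kernel q)) * ?P))"
    unfolding push_sum sum_distrib_right
    by (intro sum.cong refl) (simp add: push_times monomial_hom_tail C_def ac_simps)
  also have "mps_coeff \<dots> \<tau> = (\<Sum>(s, u)\<in>splits \<tau>. \<Sum>r\<le>R. if r = lkp u 0 then mps_coeff (C r) s * mps_coeff (K * ?P) u else 0)"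
    unfolding mps_coeff_sum mps_coeff_times[of "C _"] case_prod_unfold
    by (subst sum.swap) (auto intro!: sum.cong simp: Kr)
  also have "\<dots> = (\<Sum>(s, u)\<in>splits \<tau>. mps_coeff (C (lkp u 0)) s * mps_coeff (K * ?P) u)"
    by (intro sum.cong) (auto simp: R_def lookup_add)
  also have "\<dots> = (\<Sum>(s, u)\<in>splits \<tau>. mps_coeff (push tail G) (mcons (m + R) s)
      * mps_coeff (push tail (\<Prod>j<M. x_factor q (umon j)) * ?P) u)"
  proof (rule sum.cong[OF refl])
    fix p assume "p \<in> splits \<tau>"
    then obtain s u where p: "p = (s, u)" and su: "\<tau> = s + u" by (cases p) auto
    have "kys u \<subseteq> {..<M}" using keys su by (simp add: keys_add_monomial)
    then have "mps_coeff (K * ?P) u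
        = mps_coeff (push tail (\<Prod>j<M. x_factor q (umon j)) * ?P) u"
      by (intro mps_coeff_times_cong K) (auto simp: keys_add_monomial)
    \<comment> \<open>Here \<open>R\<close> is the sum of the \<open>z_0\<close> exponents of
      \<open>s\<close> and \<open>u\<close>. The exponent \<open>m + lkp u 0\<close> demanded of
      \<open>x_0\<close> is thus \<open>(m + R) - lkp s 0\<close>, as encoded by
      \<open>mcons (m + R) s\<close>.\<close>
    moreover have "mps_coeff (C (lkp u 0)) s = mps_coeff (push tail G) (mcons (m + R) s)"
      by (subst mps_coeff_push_tail_mcons) (auto simp: R_def su lookup_add C_def)
    ultimately show "(case p of (s, u) \<Rightarrow> mps_coeff (C (lkp u 0)) s * mps_coeff (K * ?P) u)
        = (case p of (s, u) \<Rightarrow> mps_coeff (push tail G) (mcons (m + R) s)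
          * mps_coeff (push tail (\<Prod>j<M. x_factor q (umon j)) * ?P) u)"
      by (simp add: p)
  qed
  also have "\<dots> = mps_coeff (push tail G * HL_prod q N) (mcons (m + R) \<tau>)"
    by (simp add: N HL_prod_Suc mps_coeff_times_push_mcons)
  also have "mcons (m + R) \<tau> = tail (Poly_Mapping.nth (m # ys))"
    by (simp add: nth_Cons_mcons tail_mcons R_def \<tau>_def lookup_tail_0)
  finally show ?case .
qed

corollary pairing_HL_gen_prod:
  assumes "G \<in> QSym" "comp_length \<alpha> \<le> N"
  shows "pairing (HL_gen q \<alpha>) G = mps_coeff (push tail G * HL_prod q N) (tail (comp_monomial \<alpha>))"
  using assms fold_Bt_adj[of "parts \<alpha>" N q G]
  by (simp add: pairing_HL_gen comp_length_def comp_monomial_def)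

text \<open>The source of triangularity: a nontrivial product of ratios keeps the \<open>z_0\<close>
  exponent, hence the degree, and has positive degree in the \<open>z_i\<close>.\<close>

lemma push_tail_HL_prod_nonzeroE:
  assumes "mps_coeff (push tail G * HL_prod q N) (tail m) \<noteq> 0"
  obtains \<gamma> where "mps_coeff G \<gamma> \<noteq> 0" "mdeg \<gamma> = mdeg m" "\<gamma> = m \<or> ht \<gamma> < ht m"
proof -
  obtain s u where su: "s + u = tail m" "mps_coeff (push tail G) s \<noteq> 0" "mps_coeff (HL_prod q N) u \<noteq> 0"
    using assms by (rule times_coeff_nonzeroE)
  obtain \<gamma> where \<gamma>: "s = tail \<gamma>" "mps_coeff G \<gamma> \<noteq> 0"
    using su(2) by (rule push_coeff_nonzeroE[OF monomial_hom_tail])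
  have "lkp u 0 = 0" using su(3) by (rule HL_prod_supp_0)
  then have "mdeg \<gamma> = mdeg m"
    using arg_cong[OF su(1), of "\<lambda>k. lkp k 0"] by (simp add: lookup_add \<gamma>(1) lookup_tail_0)
  moreover have "\<gamma> = m \<or> ht \<gamma> < ht m"
  proof (cases "u = 0")
    case False
    then have "mdeg u > 0" by simp
    moreover have "ht \<gamma> + mdeg u = ht m" using arg_cong[OF su(1), of mdeg] \<gamma>(1) by simp
    ultimately show ?thesis by linarith
  qed (use su \<gamma> in simp)
  ultimately show ?thesis using that \<gamma>(2) by blast
qed

text \<open>A nonconstant monomial of \<open>P\<close> would have to multiply a term of
  \<open>G\<close> of height below that of \<open>m\<close>. Leading coefficients are therefore
  unaffected by multiplication with \<open>P\<close>.\<close>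

lemma push_tail_diag:
  assumes "\<And>\<gamma>. mps_coeff G \<gamma> \<noteq> 0 \<Longrightarrow> ht m \<le> ht \<gamma>" "mps_coeff P 0 = 1"
  shows "mps_coeff (push tail G * P) (tail m) = mps_coeff G m"
proof -
  have "mps_coeff (push tail G * P) (tail m) = mps_coeff (push tail G) (tail m) * mps_coeff P 0"
  proof (rule mps_coeff_times_unique)
    fix s u assume su: "s + u = tail m" "mps_coeff (push tail G) s \<noteq> 0"
    then obtain \<gamma> where \<gamma>: "s = tail \<gamma>" "mps_coeff G \<gamma> \<noteq> 0"
      by (auto elim: push_coeff_nonzeroE[OF monomial_hom_tail])
    have "ht \<gamma> + mdeg u = ht m" using arg_cong[OF su(1), of mdeg] \<gamma>(1) by simp
    then have "mdeg u = 0" using assms(1)[OF \<gamma>(2)] by linarith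
    then have "u = 0" by simp
    then show "s = tail m \<and> u = 0" using su by simp
  qed simp
  then show ?thesis by (simp add: push_coeff monomial_hom_tail assms(2))
qed

section \<open>Coefficients in the basis of complete functions\<close>

text \<open>The homomorphisms in use are \<open>to_fract\<close>, which yields polynomiality in
  \<open>q\<close>, and evaluation at \<open>c\<close>, which yields the specializations.\<close>

definition is_ring_hom :: "('a :: comm_ring_1 \<Rightarrow> 'b :: comm_ring_1) \<Rightarrow> bool"
  where "is_ring_hom \<phi> \<longleftrightarrow> \<phi> 1 = 1 \<and> (\<forall>a b. \<phi> (a + b) = \<phi> a + \<phi> b) \<and> (\<forall>a b. \<phi> (a * b) = \<phi> a * \<phi> b)"

lemma is_ring_homD:
  assumes "is_ring_hom \<phi>"
  shows "\<phi> 1 = 1" "\<phi> (a + b) = \<phi> a + \<phi> b" "\<phi> (a * b) = \<phi> a * \<phi> b" "\<phi> 0 = 0" "\<phi> (- a) = - \<phi> a"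
    "\<phi> (sum f A) = (\<Sum>x\<in>A. \<phi> (f x))" "\<phi> (a ^ k) = \<phi> a ^ k"
proof -
  show 1: "\<phi> 1 = 1" "\<phi> (a + b) = \<phi> a + \<phi> b" "\<phi> (a * b) = \<phi> a * \<phi> b" for a b
    using assms by (auto simp: is_ring_hom_def)
  show 0: "\<phi> 0 = 0" using 1(2)[of 0 0] by simp
  show "\<phi> (- a) = - \<phi> a" using 1(2)[of "- a" a] 0 by (simp add: eq_neg_iff_add_eq_0)
  show "\<phi> (sum f A) = (\<Sum>x\<in>A. \<phi> (f x))"
    by (induction A rule: infinite_finite_induct) (simp_all add: 0 1)
  show "\<phi> (a ^ k) = \<phi> a ^ k" by (induction k) (simp_all add: 1)
qed

lemma HL_kernel_hom:
  assumes "is_ring_hom \<phi>"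
  shows "mps_coeff (HL_kernel (\<phi> q)) m = \<phi> (mps_coeff (HL_kernel q) m)"
proof -
  note hom = is_ring_homD[OF assms]
  have "\<phi> ((-1) ^ k) = (-1) ^ k" for k by (simp add: hom)
  then show ?thesis
    by (auto simp: HL_kernel_def mps_coeff_times hom H_plus_def E_minus_def intro!: sum.cong)
qed

lemma fold_Bt_adj_hom:
  assumes "is_ring_hom \<phi>" "\<And>m. mps_coeff G' m = \<phi> (mps_coeff G m)"
  shows "mps_coeff (fold (Bt_adj (\<phi> q)) xs G') c = \<phi> (mps_coeff (fold (Bt_adj q) xs G) c)"
  using assms(2)
proof (induction xs arbitrary: G G')
  case (Cons a xs)
  have "mps_coeff (Bt_adj (\<phi> q) a G') m = \<phi> (mps_coeff (Bt_adj q a G) m)" for m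
    by (auto simp: Bt_adj_def is_ring_homD[OF assms(1)] HL_kernel_hom[OF assms(1)] Cons.prems
        intro!: sum.cong)
  then show ?case by (simp add: Cons.IH)
qed simp

text \<open>The adjoint form of the coefficient makes sense over every commutative ring, in
  particular over \<open>rat poly\<close>, while \<open>HL_gen\<close> is defined over
  fields.\<close>

definition HL_coeff :: "'a :: comm_ring_1 \<Rightarrow> composition \<Rightarrow> composition \<Rightarrow> 'a"
  where "HL_coeff q \<alpha> \<beta> = mps_coeff (fold (Bt_adj q) (parts \<alpha>) (QM \<beta>)) 0"

lemma lookup_HL_gen: "Poly_Mapping.lookup (HL_gen q \<alpha>) \<beta> = HL_coeff q \<alpha> \<beta>"
  by (simp add: HL_coeff_def flip: pairing_HL_gen pairing_QM)

lemma HL_coeff_hom: "is_ring_hom \<phi> \<Longrightarrow> HL_coeff (\<phi> q) \<alpha> \<beta> = \<phi> (HL_coeff q \<alpha> \<beta>)"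
  unfolding HL_coeff_def by (rule fold_Bt_adj_hom) (auto simp: mps_coeff_QM is_ring_homD)

lemma is_ring_hom_to_fract: "is_ring_hom to_fract"
  by (simp add: is_ring_hom_def)

lemma is_ring_hom_poly: "is_ring_hom (\<lambda>p. poly p c)"
  by (simp add: is_ring_hom_def)

definition HL_poly :: "composition \<Rightarrow> rat poly nsym"
  where "HL_poly \<alpha> = Abs_poly_mapping (HL_coeff (monom 1 1) \<alpha>)"

lemma lookup_HL_poly: "Poly_Mapping.lookup (HL_poly \<alpha>) \<beta> = HL_coeff (monom 1 1) \<alpha> \<beta>"
proof -
  have "HL_coeff qvar \<alpha> \<beta> = to_fract (HL_coeff (monom 1 1) \<alpha> \<beta>)" for \<beta>
    unfolding qvar_def by (rule HL_coeff_hom[OF is_ring_hom_to_fract])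
  \<comment> \<open>Finiteness of the support is inherited from \<open>HL_gen\<close> over the
    fractions, because \<open>to_fract\<close> is injective.\<close>
  then have "{\<beta>. HL_coeff (monom 1 (1::nat)) \<alpha> \<beta> \<noteq> (0 :: rat poly)} = Poly_Mapping.keys (HL_gen qvar \<alpha>)"
    by (auto simp: in_keys_iff lookup_HL_gen)
  then have "finite {\<beta>. HL_coeff (monom 1 (1::nat)) \<alpha> \<beta> \<noteq> (0 :: rat poly)}" by simp
  then show ?thesis by (simp add: HL_poly_def)
qed

lemma lookup_nsym_of_poly: "Poly_Mapping.lookup (nsym_of_poly f) \<beta> = to_fract (Poly_Mapping.lookup f \<beta>)"
  by (simp add: nsym_of_poly_def Poly_Mapping.map.rep_eq when_def)

lemma inj_nsym_of_poly: "inj nsym_of_poly"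
proof (rule injI, rule poly_mapping_eqI)
  fix f g \<beta> assume "nsym_of_poly f = nsym_of_poly g"
  then have "to_fract (Poly_Mapping.lookup f \<beta>) = to_fract (Poly_Mapping.lookup g \<beta>)"
    by (metis lookup_nsym_of_poly)
  then show "Poly_Mapping.lookup f \<beta> = Poly_Mapping.lookup g \<beta>" by simp
qed

lemma HL_nsym_of_poly: "HL_nsym \<alpha> = nsym_of_poly (HL_poly \<alpha>)"
  by (rule poly_mapping_eqI)
    (simp add: HL_nsym_eq lookup_HL_gen lookup_nsym_of_poly lookup_HL_poly qvar_def
      HL_coeff_hom[OF is_ring_hom_to_fract])

lemma specialize_HL: "specialize c (HL_nsym \<alpha>) = HL_gen c \<alpha>"
proof (rule poly_mapping_eqI)
  fix \<beta>
  have "inv nsym_of_poly (HL_nsym \<alpha>) = HL_poly \<alpha>"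
    by (simp add: HL_nsym_of_poly inv_f_f inj_nsym_of_poly)
  then have "Poly_Mapping.lookup (specialize c (HL_nsym \<alpha>)) \<beta> = poly (HL_coeff (monom 1 1) \<alpha> \<beta>) c"
    by (simp add: specialize_def Poly_Mapping.map.rep_eq when_def lookup_HL_poly)
  also have "\<dots> = HL_coeff (poly (monom 1 1) c) \<alpha> \<beta>"
    by (rule HL_coeff_hom[OF is_ring_hom_poly, symmetric])
  finally show "Poly_Mapping.lookup (specialize c (HL_nsym \<alpha>)) \<beta> = Poly_Mapping.lookup (HL_gen c \<alpha>) \<beta>"
    by (simp add: poly_monom lookup_HL_gen)
qed

lemma Bt_adj_1: "Bt_adj 1 r G = coeff_x0 r G"
proof (rule mps_eqI)
  fix c
  have "mps_coeff (Bt_adj 1 r G) c = (\<Sum>(a, b)\<in>{(0, c)}. mps_coeff (HL_kernel 1) a * mps_coeff G (mcons (r + mdeg a) b))"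
    unfolding Bt_adj_def mps_coeff_Abs
    by (rule sum.mono_neutral_right) (auto simp: HL_kernel_1 split: if_splits)
  then show "mps_coeff (Bt_adj 1 r G) c = mps_coeff (coeff_x0 r G) c"
    by (simp add: HL_kernel_1)
qed

lemma HL_gen_1: "HL_gen 1 \<alpha> = H_comp \<alpha>"
proof -
  have "mps_coeff (fold coeff_x0 xs G) 0 = mps_coeff G (Poly_Mapping.nth xs)" for xs and G :: "'a mps"
    by (induction xs arbitrary: G) (auto simp: nth_Cons_mcons)
  moreover have "Bt_adj 1 = (coeff_x0 :: nat \<Rightarrow> 'a mps \<Rightarrow> 'a mps)"
    by (intro ext) (simp add: Bt_adj_1)
  ultimately show ?thesis
    by (intro nsym_eqI) (simp add: pairing_HL_gen pairing_H_comp comp_monomial_def)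
qed

section \<open>Triangularity\<close>

lemma ht_sum: "ht m = (\<Sum>i\<in>kys m. Suc i * lkp m i)"
proof -
  obtain N where N: "kys m \<subseteq> {..<N}" by (meson finite_keys finite_nat_iff_bounded)
  have "ht m = (\<Sum>i<N. lkp (tail m) i)"
    by (rule mdeg_sum) (use N in \<open>auto dest: keys_tail_subset\<close>)
  also have "\<dots> = (\<Sum>i<N. \<Sum>j\<in>kys m. if i \<le> j then lkp m j else 0)"
    by (simp add: lookup_tail)
  also have "\<dots> = (\<Sum>j\<in>kys m. \<Sum>i<N. if i \<le> j then lkp m j else 0)"
    by (rule sum.swap)
  also have "\<dots> = (\<Sum>j\<in>kys m. Suc j * lkp m j)"
  proof (rule sum.cong[OF refl])
    fix j assume "j \<in> kys m"
    then have "{..<N} \<inter> {i. i \<le> j} = {..j}" using N by auto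
    then show "(\<Sum>i<N. if i \<le> j then lkp m j else 0) = Suc j * lkp m j"
      by (simp add: sum.If_cases)
  qed
  finally show ?thesis .
qed

lemma ht_sum': "kys m \<subseteq> {..<N} \<Longrightarrow> ht m = (\<Sum>i<N. Suc i * lkp m i)"
  unfolding ht_sum by (rule sum.mono_neutral_left) (auto simp: in_keys_iff)

abbreviation cht :: "composition \<Rightarrow> nat"
  where "cht \<alpha> \<equiv> ht (comp_monomial \<alpha>)"

text \<open>Closing the gaps between the variables moves exponents to the left.\<close>

lemma cht_comp_of_le: "cht (comp_of m) \<le> ht m"
proof -
  obtain \<pi> where \<pi>: "strict_mono \<pi>" "m = relabel \<pi> (comp_monomial (comp_of m))"
    by (rule relabel_comp_of)
  let ?m = "comp_monomial (comp_of m)"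
  have inj: "inj \<pi>" using \<pi>(1) by (rule strict_mono_inj)
  have "ht (relabel \<pi> ?m) = (\<Sum>i\<in>kys ?m. Suc (\<pi> i) * lkp ?m i)"
    unfolding ht_sum[of "relabel \<pi> ?m"] keys_relabel[OF inj]
    by (subst sum.reindex) (use inj in \<open>auto intro: inj_on_subset\<close>)
  also have "\<dots> \<ge> ht ?m"
    unfolding ht_sum[of ?m] by (intro sum_mono mult_right_mono) (auto simp: strict_mono_imp_increasing \<pi>(1))
  finally show ?thesis using \<pi>(2) by simp
qed

lemma HL_coeff_prod:
  "HL_coeff q \<alpha> \<beta> = mps_coeff (push tail (QM \<beta>) * HL_prod q (comp_length \<alpha>)) (tail (comp_monomial \<alpha>))"
  unfolding HL_coeff_def comp_monomial_def by (rule fold_Bt_adj) (simp add: comp_length_def)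

lemma HL_coeff_triangular:
  assumes "HL_coeff q \<alpha> \<beta> \<noteq> 0"
  shows "comp_size \<beta> = comp_size \<alpha>" "\<beta> = \<alpha> \<or> cht \<beta> < cht \<alpha>"
proof -
  obtain \<gamma> where \<gamma>: "mps_coeff (QM \<beta>) \<gamma> \<noteq> (0 :: 'a)" "mdeg \<gamma> = mdeg (comp_monomial \<alpha>)"
    "\<gamma> = comp_monomial \<alpha> \<or> ht \<gamma> < cht \<alpha>"
    using assms unfolding HL_coeff_prod by (rule push_tail_HL_prod_nonzeroE)
  then have "comp_of \<gamma> = \<beta>" by (auto simp: mps_coeff_QM split: if_splits)
  then show "comp_size \<beta> = comp_size \<alpha>" "\<beta> = \<alpha> \<or> cht \<beta> < cht \<alpha>"
    using \<gamma>(2,3) cht_comp_of_le[of \<gamma>] by auto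
qed

lemma HL_coeff_diag: "HL_coeff q \<alpha> \<alpha> = 1"
  unfolding HL_coeff_prod
  by (subst push_tail_diag) (use cht_comp_of_le in \<open>auto simp: mps_coeff_QM split: if_splits\<close>)

lemma (in vector_space) independent_by_functionals:
  assumes "\<And>v. v \<in> S \<Longrightarrow> \<exists>f. (\<forall>x y. f (x + y) = f x + f y) \<and> (\<forall>c x. f (scale c x) = c * f x)
    \<and> f v \<noteq> 0 \<and> (\<forall>w\<in>S. w \<noteq> v \<longrightarrow> f w = 0)"
  shows "independent S"
proof
  assume "dependent S"
  then obtain t u v where t: "finite t" "t \<subseteq> S" "(\<Sum>v\<in>t. scale (u v) v) = 0" "v \<in> t" "u v \<noteq> 0"
    by (auto simp: dependent_explicit)
  have "v \<in> S" using t by blast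
  from assms[OF this] obtain f where "(\<forall>x y. f (x + y) = f x + f y) \<and> (\<forall>c x. f (scale c x) = c * f x)
    \<and> f v \<noteq> 0 \<and> (\<forall>w\<in>S. w \<noteq> v \<longrightarrow> f w = 0)"
    by (rule exE)
  then have f: "\<And>x y. f (x + y) = f x + f y" "\<And>c x. f (scale c x) = c * f x" "f v \<noteq> 0"
    "\<And>w. w \<in> S \<Longrightarrow> w \<noteq> v \<Longrightarrow> f w = 0"
    by simp_all
  have f0: "f 0 = 0" using f(2)[of 0 0] by simp
  have "f (\<Sum>v\<in>t. scale (u v) v) = (\<Sum>w\<in>t. u w * f w)"
    using t(1) by (induction t) (auto simp: f f0)
  also have "\<dots> = (\<Sum>w\<in>{v}. u w * f w)"
    by (rule sum.mono_neutral_right) (use t f(4) in auto)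
  finally show False using t f(3) f0 by simp
qed

text \<open>An independent spanning subset of \<open>V\<close> is at least as large as
  \<open>A\<close>, hence all of \<open>V\<close>. With this, spanning alone, which triangularity
  provides, suffices for a basis.\<close>

lemma (in vector_space) spanning_card_imp_independent:
  assumes "finite V" "independent A" "A \<subseteq> span V" "card V \<le> card A"
  shows "independent V" "card V = card A"
proof -
  obtain B where B: "B \<subseteq> V" "independent B" "V \<subseteq> span B"
    using maximal_independent_subset[of V] by blast
  have finB: "finite B" using B(1) assms(1) by (rule finite_subset)
  have "A \<subseteq> span B" using assms(3) span_mono[OF B(3)] by (simp add: span_span)
  then have "card A \<le> card B"
    using independent_span_bound[OF finB assms(2)] by simp
  moreover have "card B \<le> card V" using B(1) assms(1) by (rule card_mono[rotated])
  ultimately have "card B = card V" "card V = card A" using assms(4) by auto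
  then show "independent V" "card V = card A"
    using card_subset_eq[OF assms(1) B(1)] B(2) by auto
qed

lemma H_comp_eq_iff [simp]: "H_comp \<alpha> = (H_comp \<beta> :: 'a :: comm_ring_1 nsym) \<longleftrightarrow> \<alpha> = \<beta>"
  unfolding H_comp_def by (metis lookup_single_eq lookup_single_not_eq one_neq_zero)

lemma independent_H_comp: "NSym.independent (H_comp ` S :: 'a :: field nsym set)"
proof (rule NSym.independent_by_functionals)
  fix v :: "'a nsym" assume "v \<in> H_comp ` S"
  then obtain \<alpha> where v: "v = H_comp \<alpha>" by auto
  show "\<exists>f. (\<forall>x y. f (x + y) = f x + f y) \<and> (\<forall>c x. f (nsym_scale c x) = c * f x) \<and> f v \<noteq> 0
      \<and> (\<forall>w\<in>H_comp ` S. w \<noteq> v \<longrightarrow> f w = 0)"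
    by (rule exI[of _ "\<lambda>x. Poly_Mapping.lookup x \<alpha>"])
      (auto simp: v lookup_add H_comp_eq_iff, auto simp: H_comp_def lookup_single when_def)
qed

text \<open>Unitriangularity is inverted by induction on the height:
  \<open>HL_gen q \<alpha>\<close> is \<open>H_comp \<alpha>\<close> plus terms of smaller height
  and equal size.\<close>

lemma H_comp_in_span_HL: "comp_size \<alpha> = n \<Longrightarrow> H_comp \<alpha> \<in> NSym.span (HL_gen q ` {\<alpha>. comp_size \<alpha> = n})"
proof (induction "cht \<alpha>" arbitrary: \<alpha> rule: less_induct)
  case less
  let ?V = "NSym.span (HL_gen q ` {\<alpha>. comp_size \<alpha> = n})"
  let ?K = "Poly_Mapping.keys (HL_gen q \<alpha>)"
  have K: "\<alpha> \<in> ?K" by (simp add: in_keys_iff lookup_HL_gen HL_coeff_diag)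
  have "HL_gen q \<alpha> = (\<Sum>\<beta>\<in>?K. nsym_scale (HL_coeff q \<alpha> \<beta>) (H_comp \<beta>))"
    using nsym_expand[of "HL_gen q \<alpha>"] by (simp add: lookup_HL_gen)
  also have "\<dots> = H_comp \<alpha> + (\<Sum>\<beta>\<in>?K - {\<alpha>}. nsym_scale (HL_coeff q \<alpha> \<beta>) (H_comp \<beta>))"
    using K by (subst sum.remove[of _ \<alpha>]) (simp_all add: HL_coeff_diag)
  finally have "H_comp \<alpha> = HL_gen q \<alpha> - (\<Sum>\<beta>\<in>?K - {\<alpha>}. nsym_scale (HL_coeff q \<alpha> \<beta>) (H_comp \<beta>))"
    by (rule eq_diff_eq[THEN iffD2, OF sym])
  moreover have "(\<Sum>\<beta>\<in>?K - {\<alpha>}. nsym_scale (HL_coeff q \<alpha> \<beta>) (H_comp \<beta>)) \<in> ?V"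
  proof (intro NSym.span_sum NSym.span_scale)
    fix \<beta> assume "\<beta> \<in> ?K - {\<alpha>}"
    then have "HL_coeff q \<alpha> \<beta> \<noteq> 0" "\<beta> \<noteq> \<alpha>" by (auto simp: in_keys_iff lookup_HL_gen)
    then show "H_comp \<beta> \<in> ?V"
      using HL_coeff_triangular[of q \<alpha> \<beta>] less by auto
  qed
  moreover have "HL_gen q \<alpha> \<in> ?V" by (rule NSym.span_base) (use less.prems in auto)
  ultimately show ?case by (simp add: NSym.span_diff)
qed

theorem HL_gen_basis:
  fixes q :: "'a :: field"
  shows "NSym.independent (HL_gen q ` {\<alpha>. comp_size \<alpha> = n})"
    "NSym.span (HL_gen q ` {\<alpha>. comp_size \<alpha> = n}) = NSym_deg n"
proof -
  let ?S = "{\<alpha>. comp_size \<alpha> = n}"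
  let ?HL = "HL_gen q ` ?S" and ?H = "H_comp ` ?S :: 'a nsym set"
  have H: "?H \<subseteq> NSym.span ?HL" using H_comp_in_span_HL by auto
  have "card ?HL \<le> card ?S" by (rule card_image_le) simp
  also have "card ?S = card ?H" by (rule card_image[symmetric]) (auto simp: inj_on_def)
  finally show "NSym.independent ?HL"
    using H by (intro NSym.spanning_card_imp_independent(1)[OF _ independent_H_comp]) auto
  have "?HL \<subseteq> NSym.span ?H"
  proof clarify
    fix \<alpha> assume \<alpha>: "n = comp_size \<alpha>"
    have "(\<Sum>\<beta>\<in>Poly_Mapping.keys (HL_gen q \<alpha>). nsym_scale (HL_coeff q \<alpha> \<beta>) (H_comp \<beta>)) \<in> NSym.span ?H"
    proof (intro NSym.span_sum NSym.span_scale NSym.span_base imageI CollectI)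
      fix \<beta> assume "\<beta> \<in> Poly_Mapping.keys (HL_gen q \<alpha>)"
      then show "comp_size \<beta> = n"
        using HL_coeff_triangular(1)[of q \<alpha> \<beta>] by (simp add: \<alpha> in_keys_iff lookup_HL_gen)
    qed
    then show "HL_gen q \<alpha> \<in> NSym.span (H_comp ` {\<beta>. comp_size \<beta> = comp_size \<alpha>})"
      using nsym_expand[of "HL_gen q \<alpha>"] by (simp add: lookup_HL_gen \<alpha>)
  qed
  then show "NSym.span ?HL = NSym_deg n"
    unfolding NSym_deg_def using H by (intro NSym.span_eq[THEN iffD2]) auto
qed

section \<open>Symmetric functions\<close>

definition sinv :: "'a :: comm_ring_1 mps \<Rightarrow> bool"
  where "sinv f \<longleftrightarrow> (\<forall>\<pi> m. bij \<pi> \<longrightarrow> mps_coeff f (relabel \<pi> m) = mps_coeff f m)"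

lemma lookup_relabel_bij: "bij \<pi> \<Longrightarrow> lkp (relabel \<pi> m) j = lkp m (inv \<pi> j)"
  by (simp add: lookup_relabel bij_is_inj bij_is_surj)

lemma map_key_eq_relabel: "bij \<pi> \<Longrightarrow> Poly_Mapping.map_key \<pi> m = relabel (inv \<pi>) m"
  by (rule poly_mapping_eqI)
    (simp add: map_key.rep_eq bij_is_inj lookup_relabel_bij bij_imp_bij_inv inv_inv_eq)

lemma Sym_iff: "f \<in> Sym \<longleftrightarrow> bounded_degree f \<and> sinv f"
proof -
  have "(\<forall>\<pi> m. bij \<pi> \<longrightarrow> mps_coeff f (Poly_Mapping.map_key \<pi> m) = mps_coeff f m) \<longleftrightarrow> sinv f"
    unfolding sinv_def by (metis bij_imp_bij_inv inv_inv_eq map_key_eq_relabel)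
  then show ?thesis by (simp add: Sym_def)
qed

text \<open>An injection such as \<open>Suc\<close> is not a permutation, but only its values on the
  finite set \<open>?K\<close> of variables matter: the rest of \<open>L\<close> can be matched with
  the complement of the image, of equal size. Hence symmetric functions are quasisymmetric.\<close>

lemma relabel_extend:
  assumes "inj (\<pi> :: nat \<Rightarrow> nat)"
  obtains \<sigma> where "bij \<sigma>" "relabel \<sigma> m = relabel \<pi> m"
proof -
  let ?K = "kys m"
  define L where "L = ?K \<union> \<pi> ` ?K"
  have fin: "finite L" by (simp add: L_def)
  have "card (L - ?K) = card (L - \<pi> ` ?K)"
    using fin assms by (simp add: card_Diff_subset L_def card_image inj_on_subset)
  then obtain g where g: "bij_betw g (L - ?K) (L - \<pi> ` ?K)"
    using fin by (meson finite_Diff finite_same_card_bij)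
  define \<sigma> where "\<sigma> i = (if i \<in> ?K then \<pi> i else if i \<in> L then g i else i)" for i
  have "bij_betw \<sigma> ?K (\<pi> ` ?K)"
    unfolding bij_betw_def using assms by (auto simp: \<sigma>_def inj_on_def inj_def)
  moreover have "bij_betw \<sigma> (L - ?K) (L - \<pi> ` ?K)"
    using g by (rule bij_betw_cong[THEN iffD1, rotated]) (auto simp: \<sigma>_def)
  moreover have "bij_betw \<sigma> (- L) (- L)"
    by (rule bij_betw_cong[THEN iffD1, OF _ bij_betw_id]) (auto simp: \<sigma>_def L_def)
  ultimately have "bij_betw \<sigma> (?K \<union> (L - ?K) \<union> - L) (\<pi> ` ?K \<union> (L - \<pi> ` ?K) \<union> - L)"
    by (intro bij_betw_combine) (auto simp: L_def)
  moreover have "?K \<union> (L - ?K) \<union> - L = UNIV" "\<pi> ` ?K \<union> (L - \<pi> ` ?K) \<union> - L = UNIV"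
    by (auto simp: L_def)
  ultimately have bij: "bij \<sigma>" by simp
  have "relabel \<sigma> m = relabel \<pi> m"
  proof (rule poly_mapping_eqI)
    fix j
    have im: "\<sigma> ` ?K = \<pi> ` ?K" by (simp add: \<sigma>_def)
    show "lkp (relabel \<sigma> m) j = lkp (relabel \<pi> m) j"
    proof (cases "j \<in> \<pi> ` ?K")
      case True
      then obtain i where i: "i \<in> ?K" "j = \<pi> i" by auto
      then have "j = \<sigma> i" by (simp add: \<sigma>_def)
      then show ?thesis using i(2) lookup_relabel_image[OF assms, of m i]
          lookup_relabel_image[OF bij_is_inj[OF bij], of m i] by simp
    next
      case False
      then have "j \<notin> kys (relabel \<sigma> m)" "j \<notin> kys (relabel \<pi> m)"
        using im by (simp_all add: keys_relabel bij_is_inj bij assms)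
      then show ?thesis by (simp add: in_keys_iff)
    qed
  qed
  then show ?thesis using that bij by blast
qed

lemma sinvD: "sinv f \<Longrightarrow> inj \<pi> \<Longrightarrow> mps_coeff f (relabel \<pi> m) = mps_coeff f m"
  by (metis relabel_extend sinv_def)

lemma sinv_qinv: "sinv f \<Longrightarrow> qinv f"
  by (simp add: qinv_def sinvD strict_mono_inj)

lemma Sym_QSym: "f \<in> Sym \<Longrightarrow> f \<in> QSym"
  by (simp add: Sym_iff QSym_iff sinv_qinv)

lemma sinv_add: "sinv f \<Longrightarrow> sinv g \<Longrightarrow> sinv (f + g)"
  and sinv_scale: "sinv f \<Longrightarrow> sinv (mps_scale c f)"
  and sinv_0: "sinv 0"
  by (auto simp: sinv_def)

lemma sinv_sum: "(\<And>x. x \<in> A \<Longrightarrow> sinv (f x)) \<Longrightarrow> sinv (sum f A)"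
  by (induction A rule: infinite_finite_induct) (auto simp: sinv_add sinv_0)

lemma sinv_times: "sinv f \<Longrightarrow> sinv g \<Longrightarrow> sinv (f * g)"
  by (auto simp: sinv_def mps_coeff_times sum_splits_relabel bij_is_inj)

lemma bounded_degree_sum: "(\<And>x. x \<in> A \<Longrightarrow> bounded_degree (f x)) \<Longrightarrow> bounded_degree (sum f A)"
  by (induction A rule: infinite_finite_induct) (auto simp: bounded_degree_add)

lemma Sym_add: "f \<in> Sym \<Longrightarrow> g \<in> Sym \<Longrightarrow> f + g \<in> Sym"
  and Sym_scale: "f \<in> Sym \<Longrightarrow> mps_scale c f \<in> Sym"
  and Sym_times: "f \<in> Sym \<Longrightarrow> g \<in> Sym \<Longrightarrow> f * g \<in> Sym"
  by (simp_all add: Sym_iff sinv_add sinv_scale sinv_times bounded_degree_add bounded_degree_scale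
      bounded_degree_times)

lemma Sym_diff: "f \<in> Sym \<Longrightarrow> g \<in> Sym \<Longrightarrow> f - g \<in> Sym"
  using Sym_add[of f "mps_scale (- 1) g"] Sym_scale[of g "- 1"]
  by (metis MPS.scale_minus_left MPS.scale_one add_uminus_conv_diff)

lemma Sym_sum: "(\<And>x. x \<in> A \<Longrightarrow> f x \<in> Sym) \<Longrightarrow> sum f A \<in> Sym"
  by (simp add: Sym_iff sinv_sum bounded_degree_sum)

section \<open>Partitions\<close>

definition sort_comp :: "composition \<Rightarrow> composition"
  where "sort_comp \<alpha> = Abs_composition (rev (sort (parts \<alpha>)))"

lemma parts_sort_comp: "parts (sort_comp \<alpha>) = rev (sort (parts \<alpha>))"
  unfolding sort_comp_def by (rule Abs_composition_inverse) (use comp_pos[of \<alpha>] in \<open>auto intro: gr0I\<close>)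

abbreviation part_of :: "monomial \<Rightarrow> composition"
  where "part_of m \<equiv> sort_comp (comp_of m)"

lemma is_partition_sort_comp [simp]: "is_partition (sort_comp \<alpha>)"
  by (simp add: is_partition_def parts_sort_comp sorted_wrt_rev)

lemma sort_comp_partition: "is_partition \<nu> \<Longrightarrow> sort_comp \<nu> = \<nu>"
proof -
  assume "is_partition \<nu>"
  then have "sorted (rev (parts \<nu>))" by (simp add: is_partition_def sorted_wrt_rev)
  then have "sort (parts \<nu>) = rev (parts \<nu>)"
    by (intro properties_for_sort) simp_all
  then show ?thesis by (simp add: parts_inject[symmetric] parts_sort_comp)
qed

lemma comp_size_sort_comp [simp]: "comp_size (sort_comp \<alpha>) = comp_size \<alpha>"
  by (simp add: comp_size_def parts_sort_comp flip: sum_mset_sum_list)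

lemma sort_comp_eqI: "mset (parts \<alpha>) = mset (parts \<beta>) \<Longrightarrow> sort_comp \<alpha> = sort_comp \<beta>"
  by (simp add: parts_inject[symmetric] parts_sort_comp) (intro properties_for_sort, simp_all)

lemma mset_exponents: "mset (exponents m) = image_mset (lkp m) (mset_set (kys m))"
  using mset_set_set[of "sorted_list_of_set (kys m)"] by (simp add: exponents_def)

lemma part_of_relabel: "inj \<pi> \<Longrightarrow> part_of (relabel \<pi> m) = part_of m"
proof -
  assume inj: "inj \<pi>"
  then have "mset_set (\<pi> ` kys m) = image_mset \<pi> (mset_set (kys m))"
    by (metis image_mset_mset_set inj_on_subset subset_UNIV)
  then have "mset (exponents (relabel \<pi> m)) = mset (exponents m)"
    using inj by (simp add: mset_exponents keys_relabel multiset.map_comp o_def)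
  then show ?thesis by (intro sort_comp_eqI) simp
qed

lemma relabel_sort_comp:
  obtains p where "p permutes {..<comp_length \<alpha>}"
    "comp_monomial \<alpha> = relabel p (comp_monomial (sort_comp \<alpha>))"
proof -
  have "mset (parts (sort_comp \<alpha>)) = mset (parts \<alpha>)" by (simp add: parts_sort_comp)
  then obtain p where p: "p permutes {..<length (parts \<alpha>)}"
    "permute_list p (parts \<alpha>) = parts (sort_comp \<alpha>)"
    by (metis mset_eq_permutation)
  have "comp_monomial \<alpha> = relabel p (comp_monomial (sort_comp \<alpha>))"
  proof (rule poly_mapping_eqI)
    fix j
    have bij: "bij p" using p(1) by (rule permutes_bij)
    obtain i where i: "j = p i" using bij by (metis bij_pointE)
    have len: "length (parts (sort_comp \<alpha>)) = length (parts \<alpha>)" by (simp add: parts_sort_comp)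
    have lt: "p i < length (parts \<alpha>) \<longleftrightarrow> i < length (parts \<alpha>)"
      using p(1) by (metis lessThan_iff permutes_in_image)
    have "part \<alpha> (p i) = part (sort_comp \<alpha>) i"
      using lt permute_list_nth[OF p(1), of i]
      by (cases "i < length (parts \<alpha>)") (simp_all add: part_def nth_default_def p(2) len)
    then show "lkp (comp_monomial \<alpha>) j = lkp (relabel p (comp_monomial (sort_comp \<alpha>))) j"
      using bij by (simp add: i bij_is_inj lookup_comp_monomial)
  qed
  then show ?thesis using that p(1) by (simp add: comp_length_def)
qed

lemma sinv_sort: "sinv f \<Longrightarrow> mps_coeff f (comp_monomial (sort_comp \<alpha>)) = mps_coeff f (comp_monomial \<alpha>)"
  by (metis permutes_inj relabel_sort_comp sinvD)

lemma sinv_coeff: "sinv f \<Longrightarrow> mps_coeff f m = mps_coeff f (comp_monomial (part_of m))"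
  by (metis qinv_coeff sinv_qinv sinv_sort)

lemma part_of_comp_monomial: "is_partition \<nu> \<Longrightarrow> part_of (comp_monomial \<nu>) = \<nu>"
  by (simp add: sort_comp_partition)

text \<open>When the maximum \<open>b\<close> is inserted, all of \<open>A\<close> lies below
  \<open>b\<close>, so \<open>b\<close> is at least \<open>card A\<close>; equality forces an
  initial segment.\<close>

lemma sum_nat_set_ge:
  fixes A :: "nat set"
  assumes "finite A"
  shows "\<Sum>{..<card A} \<le> \<Sum>A \<and> (\<Sum>{..<card A} = \<Sum>A \<longrightarrow> A = {..<card A})"
  using assms
proof (induction A rule: finite_linorder_max_induct)
  case (insert b A)
  then have "A \<subseteq> {..<b}" by auto
  then have "card A \<le> b" using card_mono[of "{..<b}" A] by simp
  moreover have "b \<notin> A" using insert by auto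
  ultimately show ?case using insert by (auto simp: lessThan_Suc)
qed simp

text \<open>Abel summation: distinct values make every partial sum of \<open>u i - i\<close>
  nonnegative, and the weights \<open>l i\<close> decrease.\<close>

lemma rearrangement:
  fixes l u :: "nat \<Rightarrow> nat"
  assumes "\<And>i j. i \<le> j \<Longrightarrow> j < n \<Longrightarrow> l j \<le> l i" "inj_on u {..<n}"
  shows "(\<Sum>i<n. i * l i) \<le> (\<Sum>i<n. u i * l i)"
proof -
  define d where "d i = int (u i) - int i" for i
  have S: "0 \<le> (\<Sum>i<k. d i)" if "k \<le> n" for k
  proof -
    have inj: "inj_on u {..<k}" using assms(2) that by (auto intro: inj_on_subset)
    have "\<Sum>{..<card (u ` {..<k})} \<le> \<Sum>(u ` {..<k})" using sum_nat_set_ge by simp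
    then have "(\<Sum>i<k. i) \<le> (\<Sum>i<k. u i)" by (simp add: card_image[OF inj] sum.reindex[OF inj])
    then have "int (\<Sum>i<k. i) \<le> int (\<Sum>i<k. u i)" by (simp only: of_nat_le_iff)
    then show ?thesis by (simp add: d_def sum_subtractf)
  qed
  \<comment> \<open>The invariant keeps the last weight as a common factor. At \<open>k = 0\<close>
    the truncated index \<open>k - 1\<close> meets an empty sum.\<close>
  have "(\<Sum>i<k. d i) * int (l (k - 1)) \<le> (\<Sum>i<k. d i * int (l i))" if "k \<le> n" for k
    using that
  proof (induction k)
    case (Suc k)
    have "(\<Sum>i<k. d i) * int (l k) \<le> (\<Sum>i<k. d i) * int (l (k - 1))"
      using S[of k] Suc.prems assms(1)[of "k - 1" k] by (intro mult_left_mono) auto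
    also have "\<dots> \<le> (\<Sum>i<k. d i * int (l i))" using Suc by simp
    finally show ?case by (simp add: algebra_simps)
  qed simp
  from this[of n] S[of n] have "0 \<le> (\<Sum>i<n. d i * int (l i))"
    by (meson dual_order.trans mult_nonneg_nonneg of_nat_0_le_iff order_refl)
  then have "int (\<Sum>i<n. i * l i) \<le> int (\<Sum>i<n. u i * l i)"
    by (simp add: d_def left_diff_distrib sum_subtractf)
  then show ?thesis by linarith
qed

lemma ht_relabel: "inj \<pi> \<Longrightarrow> kys m \<subseteq> {..<n} \<Longrightarrow> ht (relabel \<pi> m) = (\<Sum>i<n. Suc (\<pi> i) * lkp m i)"
proof -
  assume inj: "inj \<pi>" and m: "kys m \<subseteq> {..<n}"
  have "ht (relabel \<pi> m) = (\<Sum>i\<in>kys m. Suc (\<pi> i) * lkp m i)"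
    unfolding ht_sum keys_relabel[OF inj]
    by (subst sum.reindex) (use inj in \<open>auto intro: inj_on_subset\<close>)
  also have "\<dots> = (\<Sum>i<n. Suc (\<pi> i) * lkp m i)"
    by (rule sum.mono_neutral_left) (use m in \<open>auto simp: in_keys_iff\<close>)
  finally show ?thesis .
qed

lemma ht_relabel_ge:
  assumes "inj \<pi>" "kys m \<subseteq> {..<n}" "\<And>i j. i \<le> j \<Longrightarrow> j < n \<Longrightarrow> lkp m j \<le> lkp m i"
  shows "ht m \<le> ht (relabel \<pi> m)"
  unfolding ht_relabel[OF assms(1,2)] ht_sum'[OF assms(2)]
  using rearrangement[of n "lkp m" \<pi>] assms by (simp add: sum.distrib inj_on_subset)

lemma partition_antimono:
  assumes "is_partition \<nu>" "i \<le> j"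
  shows "part \<nu> j \<le> part \<nu> i"
proof (cases "j < length (parts \<nu>) \<and> i < j")
  case True
  then show ?thesis
    using assms by (auto simp: is_partition_def part_def nth_default_def sorted_wrt_iff_nth_less)
next
  case False
  then show ?thesis using assms(2) by (cases "i = j") (auto simp: part_def nth_default_def)
qed

lemma keys_comp_monomial: "kys (comp_monomial \<alpha>) \<subseteq> {..<comp_length \<alpha>}"
  unfolding comp_monomial_def comp_length_def by (rule keys_nth_subset)

lemma cht_part_of_le: "cht (part_of m) \<le> ht m"
proof -
  let ?\<alpha> = "comp_of m"
  obtain p where p: "p permutes {..<comp_length ?\<alpha>}"
    "comp_monomial ?\<alpha> = relabel p (comp_monomial (sort_comp ?\<alpha>))"
    by (rule relabel_sort_comp)
  have "cht (sort_comp ?\<alpha>) \<le> cht ?\<alpha>"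
    unfolding p(2)
    by (rule ht_relabel_ge[OF permutes_inj[OF p(1)] keys_comp_monomial])
      (simp add: lookup_comp_monomial partition_antimono)
  then show ?thesis using cht_comp_of_le[of m] by linarith
qed

text \<open>The monomial symmetric function if \<open>\<nu>\<close> is a partition, and 0
  otherwise.\<close>

definition msym :: "composition \<Rightarrow> 'a :: comm_ring_1 mps"
  where "msym \<nu> = Abs_mps (\<lambda>m. if part_of m = \<nu> then 1 else 0)"

lemma mps_coeff_msym: "mps_coeff (msym \<nu>) m = (if part_of m = \<nu> then 1 else 0)"
  by (simp add: msym_def)

lemma msym_in_Sym: "msym \<nu> \<in> Sym"
  unfolding Sym_iff
proof
  show "bounded_degree (msym \<nu>)"
    by (rule bounded_degreeI[of _ "comp_size \<nu>"]) (auto simp: mps_coeff_msym split: if_splits)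
qed (simp add: sinv_def mps_coeff_msym part_of_relabel bij_is_inj)

lemma Sym_expand:
  assumes "sinv f" "\<And>m. mps_coeff f m \<noteq> 0 \<Longrightarrow> mdeg m \<le> d"
  shows "f = (\<Sum>\<nu> | is_partition \<nu> \<and> comp_size \<nu> \<le> d. mps_scale (mps_coeff f (comp_monomial \<nu>)) (msym \<nu>))"
proof (rule mps_eqI)
  fix m
  have fin: "finite {\<nu>. is_partition \<nu> \<and> comp_size \<nu> \<le> d}"
    by (rule finite_subset[OF _ finite_comp_size_le[of d]]) auto
  show "mps_coeff f m = mps_coeff (\<Sum>\<nu> | is_partition \<nu> \<and> comp_size \<nu> \<le> d.
      mps_scale (mps_coeff f (comp_monomial \<nu>)) (msym \<nu>)) m"
    using assms(2)[of m] sinv_coeff[OF assms(1), of m] fin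
    by (auto simp: mps_coeff_msym if_distrib cong: if_cong)
qed

section \<open>The dual basis\<close>

lemma pairing_HL_msym:
  assumes "is_partition \<kappa>" "is_partition \<nu>"
  shows "pairing (HL_gen q \<kappa>) (msym \<nu>) \<noteq> 0 \<Longrightarrow> comp_size \<nu> = comp_size \<kappa> \<and> (\<nu> = \<kappa> \<or> cht \<nu> < cht \<kappa>)"
    and "pairing (HL_gen q \<kappa>) (msym \<kappa>) = 1"
proof -
  note prod = pairing_HL_gen_prod[OF Sym_QSym[OF msym_in_Sym] order_refl]
  show "comp_size \<nu> = comp_size \<kappa> \<and> (\<nu> = \<kappa> \<or> cht \<nu> < cht \<kappa>)"
    if nz: "pairing (HL_gen q \<kappa>) (msym \<nu>) \<noteq> 0"
  proof -
    obtain \<gamma> where \<gamma>: "mps_coeff (msym \<nu>) \<gamma> \<noteq> (0 :: 'a)" "mdeg \<gamma> = mdeg (comp_monomial \<kappa>)"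
      "\<gamma> = comp_monomial \<kappa> \<or> ht \<gamma> < cht \<kappa>"
      using nz unfolding prod by (rule push_tail_HL_prod_nonzeroE)
    have "part_of \<gamma> = \<nu>" using \<gamma>(1) by (simp add: mps_coeff_msym split: if_splits)
    then show ?thesis
      using \<gamma>(2,3) cht_part_of_le[of \<gamma>] part_of_comp_monomial[OF assms(1)]
      by (metis comp_size_comp_of comp_size_sort_comp le_less_trans mdeg_comp_monomial)
  qed
  show "pairing (HL_gen q \<kappa>) (msym \<kappa>) = 1"
    unfolding prod using part_of_comp_monomial[OF assms(1)] cht_part_of_le
    by (subst push_tail_diag) (auto simp: mps_coeff_msym split: if_splits)
qed

text \<open>A term of minimal height in a nonzero symmetric difference may be taken with sorted
  exponents, and by \<open>push_tail_diag\<close> the pairing with the corresponding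
  \<open>HL_gen q \<kappa>\<close> reads off its coefficient.\<close>

lemma Sym_eqI_HL:
  assumes "F \<in> Sym" "G \<in> Sym"
    "\<And>\<kappa>. is_partition \<kappa> \<Longrightarrow> pairing (HL_gen q \<kappa>) F = pairing (HL_gen q \<kappa>) G"
  shows "F = G"
proof (rule ccontr)
  assume "F \<noteq> G"
  define D where "D = F - G"
  have D: "D \<in> Sym" unfolding D_def by (rule Sym_diff[OF assms(1,2)])
  have "\<exists>m. mps_coeff D m \<noteq> 0"
    using \<open>F \<noteq> G\<close> by (auto simp: D_def intro: mps_eqI)
  then obtain m where m: "mps_coeff D m \<noteq> 0" "\<And>k. mps_coeff D k \<noteq> 0 \<Longrightarrow> ht m \<le> ht k"
    using ex_has_least_nat[of "\<lambda>m. mps_coeff D m \<noteq> 0" _ ht] by blast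
  let ?\<kappa> = "part_of m"
  have "mps_coeff D (comp_monomial ?\<kappa>) \<noteq> 0"
    using m(1) D sinv_coeff[of D m] by (simp add: Sym_iff)
  moreover have "pairing (HL_gen q ?\<kappa>) D = mps_coeff D (comp_monomial ?\<kappa>)"
    unfolding pairing_HL_gen_prod[OF Sym_QSym[OF D] order_refl]
    by (rule push_tail_diag) (use m(2) cht_part_of_le[of m] in \<open>auto intro: order_trans\<close>)
  ultimately show False using assms(3)[of ?\<kappa>] by (simp add: D_def pairing_diff_right)
qed

text \<open>Back-substitution from the greatest height downwards: \<open>msym \<mu>\<close> already
  pairs to 1 with its own partition, and its other nonzero pairings lie at greater height, where the
  duals are available. The measure \<open>B - cht \<mu>\<close> counts down from the top.\<close>

lemma ex_dual:
  fixes q :: "'a :: field"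
  assumes "is_partition \<mu>"
  shows "\<exists>G\<in>Sym. \<forall>\<kappa>. is_partition \<kappa> \<longrightarrow> pairing (HL_gen q \<kappa>) G = (if \<kappa> = \<mu> then 1 else 0)"
proof -
  define n where "n = comp_size \<mu>"
  let ?S = "{\<nu>. is_partition \<nu> \<and> comp_size \<nu> = n}"
  have fin: "finite ?S" by (rule finite_subset[OF _ finite_comp_size_eq[of n]]) auto
  define B where "B = Max (cht ` ?S)"
  have B: "cht \<nu> \<le> B" if "\<nu> \<in> ?S" for \<nu>
    unfolding B_def by (rule Max_ge) (use that fin in auto)
  have "\<mu> \<in> ?S" using assms by (simp add: n_def)
  then show ?thesis
  proof (induction "B - cht \<mu>" arbitrary: \<mu> rule: less_induct)
    case less
    let ?T = "{\<kappa> \<in> ?S. cht \<mu> < cht \<kappa>}"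
    have "\<exists>G\<in>Sym. \<forall>\<kappa>. is_partition \<kappa> \<longrightarrow> pairing (HL_gen q \<kappa>) G = (if \<kappa> = \<rho> then 1 else 0)"
      if "\<rho> \<in> ?T" for \<rho>
      by (rule less(1)) (use that B[of \<rho>] in auto)
    then obtain G where G: "\<And>\<rho>. \<rho> \<in> ?T \<Longrightarrow> G \<rho> \<in> Sym"
      "\<And>\<rho> \<kappa>. \<rho> \<in> ?T \<Longrightarrow> is_partition \<kappa> \<Longrightarrow> pairing (HL_gen q \<kappa>) (G \<rho>) = (if \<kappa> = \<rho> then 1 else 0)"
      by (metis (no_types, lifting))
    let ?c = "\<lambda>\<kappa>. pairing (HL_gen q \<kappa>) (msym \<mu>)"
    define F where "F = msym \<mu> - (\<Sum>\<rho>\<in>?T. mps_scale (?c \<rho>) (G \<rho>))"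
    have "F \<in> Sym" unfolding F_def using G(1) by (intro Sym_diff msym_in_Sym Sym_sum Sym_scale)
    moreover have "pairing (HL_gen q \<kappa>) F = (if \<kappa> = \<mu> then 1 else 0)" if \<kappa>: "is_partition \<kappa>" for \<kappa>
    proof -
      have "(\<Sum>\<rho>\<in>?T. ?c \<rho> * pairing (HL_gen q \<kappa>) (G \<rho>)) = (\<Sum>\<rho>\<in>?T. if \<rho> = \<kappa> then ?c \<kappa> else 0)"
        using G(2) \<kappa> by (intro sum.cong) auto
      also have "\<dots> = (if \<kappa> \<in> ?T then ?c \<kappa> else 0)"
        using fin by simp
      finally have "pairing (HL_gen q \<kappa>) F = ?c \<kappa> - (if \<kappa> \<in> ?T then ?c \<kappa> else 0)"
        by (simp add: F_def pairing_diff_right pairing_sum_right pairing_scale_right)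
      then show ?thesis
        using pairing_HL_msym[OF \<kappa>, of \<mu> q] less(2) \<kappa> by (cases "?c \<kappa> = 0") auto
    qed
    ultimately show ?case by blast
  qed
qed

definition HL_dual :: "'a :: field \<Rightarrow> composition \<Rightarrow> 'a mps"
  where "HL_dual q \<mu> = (SOME G. G \<in> Sym \<and>
    (\<forall>\<kappa>. is_partition \<kappa> \<longrightarrow> pairing (HL_gen q \<kappa>) G = (if \<kappa> = \<mu> then 1 else 0)))"

lemma HL_dual:
  assumes "is_partition \<mu>"
  shows "HL_dual q \<mu> \<in> Sym"
    "is_partition \<kappa> \<Longrightarrow> pairing (HL_gen q \<kappa>) (HL_dual q \<mu>) = (if \<kappa> = \<mu> then 1 else 0)"
proof -
  have "\<exists>G. G \<in> Sym \<and> (\<forall>\<kappa>. is_partition \<kappa> \<longrightarrow> pairing (HL_gen q \<kappa>) G = (if \<kappa> = \<mu> then 1 else 0))"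
    using ex_dual[OF assms, of q] by blast
  from someI_ex[OF this] show "HL_dual q \<mu> \<in> Sym"
    "is_partition \<kappa> \<Longrightarrow> pairing (HL_gen q \<kappa>) (HL_dual q \<mu>) = (if \<kappa> = \<mu> then 1 else 0)"
    unfolding HL_dual_def by blast+
qed

text \<open>Through this expansion, Hall products with the dual family determine those with the
  monomial functions, which read off coefficients in the basis \<open>h_comp\<close>.\<close>

lemma msym_expand:
  assumes "is_partition \<nu>"
  shows "msym \<nu> = (\<Sum>\<mu> | is_partition \<mu> \<and> comp_size \<mu> = comp_size \<nu>.
    mps_scale (pairing (HL_gen q \<mu>) (msym \<nu>)) (HL_dual q \<mu>))" (is "_ = ?R")
proof (rule Sym_eqI_HL[OF msym_in_Sym])
  let ?S = "{\<mu>. is_partition \<mu> \<and> comp_size \<mu> = comp_size \<nu>}"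
  have fin: "finite ?S" by (rule finite_subset[OF _ finite_comp_size_eq[of "comp_size \<nu>"]]) auto
  show "?R \<in> Sym" by (intro Sym_sum Sym_scale) (auto intro: HL_dual(1))
  fix \<kappa> assume \<kappa>: "is_partition \<kappa>"
  have "pairing (HL_gen q \<kappa>) ?R = (\<Sum>\<mu>\<in>?S. if \<mu> = \<kappa> then pairing (HL_gen q \<kappa>) (msym \<nu>) else 0)"
    unfolding pairing_sum_right pairing_scale_right
    by (rule sum.cong) (auto simp: HL_dual(2) \<kappa>)
  also have "\<dots> = pairing (HL_gen q \<kappa>) (msym \<nu>)"
    using fin pairing_HL_msym(1)[OF \<kappa> assms, of q] \<kappa>
    by (cases "pairing (HL_gen q \<kappa>) (msym \<nu>) = 0") auto
  finally show "pairing (HL_gen q \<kappa>) (msym \<nu>) = pairing (HL_gen q \<kappa>) ?R" by simp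
qed

section \<open>The complete symmetric functions form a basis\<close>

lemma h_gen_eq_QF: "h_gen r = QF r"
  by (rule mps_eqI) (simp add: h_gen_def mps_coeff_QF)

lemma h_comp_add: "h_comp (\<alpha> + \<beta>) = h_comp \<alpha> * h_comp \<beta>"
  by (simp add: h_comp_def plus_composition.rep_eq)

lemma h_comp_sort: "h_comp (sort_comp \<alpha>) = h_comp \<alpha>"
  by (simp add: h_comp_def parts_sort_comp flip: prod_mset_prod_list)

lemma h_comp_in_Sym: "(h_comp \<alpha> :: 'a :: field mps) \<in> Sym"
proof -
  have QF: "(QF r :: 'a mps) \<in> Sym" for r
    by (auto simp: Sym_iff sinv_def mps_coeff_QF bij_is_inj intro!: bounded_degreeI[of _ r] split: if_splits)
  then have "(1 :: 'a mps) \<in> Sym"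
    unfolding QF_0[symmetric] .
  with QF have "(prod_list (map h_gen xs) :: 'a mps) \<in> Sym" for xs
    by (induction xs) (auto simp: h_gen_eq_QF Sym_times)
  then show ?thesis by (simp add: h_comp_def)
qed

text \<open>A degree filtration: the spaces stay finite dimensional, so that independence can be
  settled by counting, and the bounds add under products.\<close>

definition h_span :: "nat \<Rightarrow> 'a :: field mps set"
  where "h_span d = MPS.span (h_comp ` {\<alpha>. comp_size \<alpha> \<le> d})"

lemma h_span_times:
  assumes "f \<in> h_span a" "g \<in> h_span b"
  shows "f * g \<in> h_span (a + b)"
  using assms(1) unfolding h_span_def
proof (induction rule: MPS.span_induct_alt)
  case base
  show ?case by (simp add: MPS.span_zero)
next
  case (step c x y)
  from step(1) obtain \<alpha> where \<alpha>: "x = h_comp \<alpha>" "comp_size \<alpha> \<le> a" by auto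
  have "x * g \<in> MPS.span (h_comp ` {\<alpha>. comp_size \<alpha> \<le> a + b})"
    using assms(2) unfolding h_span_def
  proof (induction rule: MPS.span_induct_alt)
    case base
    show ?case by (simp add: MPS.span_zero)
  next
    case (step c' x' y')
    from step(1) obtain \<beta> where \<beta>: "x' = h_comp \<beta>" "comp_size \<beta> \<le> b" by auto
    have "x * x' = h_comp (\<alpha> + \<beta>)" by (simp add: \<alpha> \<beta> h_comp_add)
    moreover have "comp_size (\<alpha> + \<beta>) \<le> a + b"
      using \<alpha> \<beta> by (simp add: comp_size_def plus_composition.rep_eq)
    ultimately have "x * x' \<in> MPS.span (h_comp ` {\<alpha>. comp_size \<alpha> \<le> a + b})"
      by (simp add: MPS.span_base)
    then show ?case
      using step by (simp add: distrib_left times_mps_scale MPS.span_add MPS.span_scale)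
  qed
  then show ?case
    using step by (simp add: distrib_right mps_scale_times MPS.span_add MPS.span_scale)
qed

lemma h_span_mono: "a \<le> b \<Longrightarrow> f \<in> h_span a \<Longrightarrow> f \<in> h_span b"
proof -
  assume "a \<le> b" and f: "f \<in> h_span a"
  then have "h_span a \<subseteq> (h_span b :: 'a mps set)"
    unfolding h_span_def by (intro MPS.span_mono) auto
  then show ?thesis using f by blast
qed

lemma QF_in_h_span: "QF r \<in> h_span r"
proof (cases "r = 0")
  case True
  have "QF 0 = h_comp 0" by (simp add: QF_0 h_comp_def zero_composition.rep_eq)
  then show ?thesis using True
    by (auto simp: h_span_def comp_size_def zero_composition.rep_eq intro!: MPS.span_base)
next
  case False
  then have "QF r = h_comp (single_part r)" "comp_size (single_part r) = r"
    by (simp_all add: h_comp_def single_part.rep_eq h_gen_eq_QF comp_size_def)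
  then show ?thesis by (auto simp: h_span_def intro!: MPS.span_base)
qed

text \<open>The degree \<open>n\<close> part of the identity stating that the product of all
  \<open>(1 - x_i) / (1 - x_i)\<close> is 1.\<close>

lemma alternating_QF_sum:
  assumes "0 < n"
  shows "(\<Sum>i\<le>n. mps_scale ((-1) ^ i) (QF_ones i * QF (n - i))) = (0 :: 'a :: comm_ring_1 mps)"
proof (rule mps_eqI)
  fix m
  have "mps_coeff (\<Sum>i\<le>n. mps_scale ((-1) ^ i) (QF_ones i * QF (n - i))) m
      = (\<Sum>(u, v)\<in>splits m. \<Sum>i\<le>n. (-1) ^ i * (mps_coeff (QF_ones i) u * mps_coeff (QF (n - i)) v) :: 'a)"
    by (simp add: mps_coeff_times sum_distrib_left case_prod_unfold sum.swap[of _ "splits m"])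
  also have "\<dots> = (\<Sum>(u, v)\<in>splits m. if mdeg m = n then mps_coeff E_minus u * mps_coeff (H_plus 1) v else 0)"
  proof (rule sum.cong[OF refl])
    fix p assume "p \<in> splits m"
    then obtain u v where p: "p = (u, v)" and m: "m = u + v" by (cases p) auto
    have "(\<Sum>i\<le>n. (-1) ^ i * (mps_coeff (QF_ones i) u * mps_coeff (QF (n - i)) v) :: 'a)
      = (\<Sum>i\<le>n. if i = mdeg u then if mdeg m = n then mps_coeff E_minus u * mps_coeff (H_plus 1) v else 0 else 0)"
      by (rule sum.cong) (auto simp: mps_coeff_QF mps_coeff_QF_ones E_minus_def H_plus_def m)
    also have "\<dots> = (if mdeg m = n then mps_coeff E_minus u * mps_coeff (H_plus 1) v else 0)"
      by (auto simp: m)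
    finally show "(case p of (u, v) \<Rightarrow> \<Sum>i\<le>n. (-1) ^ i * (mps_coeff (QF_ones i) u * mps_coeff (QF (n - i)) v))
      = (case p of (u, v) \<Rightarrow> if mdeg m = n then mps_coeff (E_minus :: 'a mps) u * mps_coeff (H_plus 1) v else 0)"
      unfolding p prod.case .
  qed
  also have "\<dots> = (if mdeg m = n then mps_coeff (HL_kernel 1) m else 0)"
    by (simp add: HL_kernel_def mult.commute[of "H_plus 1"] mps_coeff_times case_prod_unfold)
  also have "\<dots> = 0" using assms by (auto simp: HL_kernel_1)
  finally show "mps_coeff (\<Sum>i\<le>n. mps_scale ((-1) ^ i) (QF_ones i * QF (n - i))) m = mps_coeff (0 :: 'a mps) m"
    by simp
qed

lemma QF_ones_in_h_span: "QF_ones n \<in> h_span n"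
proof (induction n rule: less_induct)
  case (less n)
  have sub: "MPS.subspace (h_span n :: 'a mps set)"
    unfolding h_span_def by (rule MPS.subspace_span)
  show ?case
  proof (cases "n = 0")
    case True
    have "QF_ones 0 = (QF 0 :: 'a mps)"
      by (rule mps_eqI) (auto simp: mps_coeff_QF_ones mps_coeff_QF squarefree_mon_def)
    then show ?thesis using True QF_in_h_span[of 0] by simp
  next
    case False
    let ?S = "\<Sum>i<n. mps_scale ((-1) ^ i) (QF_ones i * QF (n - i)) :: 'a mps"
    have "(\<Sum>i<Suc n. mps_scale ((-1) ^ i) (QF_ones i * QF (n - i))) = (0 :: 'a mps)"
      using alternating_QF_sum[of n] False by (simp add: lessThan_Suc_atMost)
    then have S: "mps_scale ((-1) ^ n) (QF_ones n) = - ?S"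
      by (simp add: QF_0 eq_neg_iff_add_eq_0 add.commute)
    have "?S \<in> h_span n"
    proof (rule MPS.subspace_sum[OF sub], rule MPS.subspace_scale[OF sub])
      fix i assume i: "i \<in> {..<n}"
      then have "QF_ones i * QF (n - i) \<in> (h_span (i + (n - i)) :: 'a mps set)"
        by (intro h_span_times less QF_in_h_span) auto
      then show "QF_ones i * QF (n - i) \<in> (h_span n :: 'a mps set)" using i by simp
    qed
    \<comment> \<open>Scaling by the sign a second time isolates \<open>QF_ones n\<close>.\<close>
    then have "mps_scale ((-1) ^ n) (mps_scale ((-1) ^ n) (QF_ones n)) \<in> (h_span n :: 'a mps set)"
      unfolding S by (intro MPS.subspace_scale[OF sub] MPS.subspace_neg[OF sub])
    moreover have "mps_scale ((-1) ^ n) (mps_scale ((-1) ^ n) (QF_ones n)) = (QF_ones n :: 'a mps)"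
      by (simp add: power_mult_distrib[symmetric])
    ultimately show ?thesis by simp
  qed
qed

text \<open>The monomial \<open>x_0 ... x_(l-1)\<close>, the term of least height in
  \<open>QF_ones l\<close>.\<close>

definition ones_mon :: "nat \<Rightarrow> monomial"
  where "ones_mon l = (\<Sum>i<l. umon i)"

lemma lookup_ones_mon: "lkp (ones_mon l) i = (if i < l then 1 else 0)"
  by (simp add: ones_mon_def lookup_sum lookup_single when_def)

text \<open>Products of elementary symmetric functions have a unique monomial of minimal height, and
  every partition arises as such a monomial.\<close>

lemma QF_ones_leading:
  assumes "mps_coeff (QF_ones l) m \<noteq> (0 :: 'a :: comm_ring_1)"
  shows "m = ones_mon l \<or> ht (ones_mon l) < ht m"
proof -
  have sq: "squarefree_mon m" and deg: "mdeg m = l"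
    using assms by (auto simp: mps_coeff_QF_ones split: if_splits)
  have one: "lkp m i = 1" if "i \<in> kys m" for i
    using sq that unfolding squarefree_mon_def in_keys_iff by (metis le_neq_implies_less less_one)
  have card: "card (kys m) = l" using deg one by (simp add: mdeg_def)
  have "ht m = (\<Sum>i\<in>kys m. Suc i)" unfolding ht_sum using one by (intro sum.cong) auto
  then have htm: "ht m = \<Sum>(kys m) + l" using card by (simp add: sum.distrib sum_Suc)
  have "ht (ones_mon l) = (\<Sum>i<l. Suc i * lkp (ones_mon l) i)"
    by (rule ht_sum') (auto simp: in_keys_iff lookup_ones_mon split: if_splits)
  also have "\<dots> = \<Sum>{..<l} + l" by (simp add: lookup_ones_mon sum_Suc)
  finally have hto: "ht (ones_mon l) = \<Sum>{..<l} + l" .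
  show ?thesis
  proof (cases "kys m = {..<l}")
    case True
    have "m = ones_mon l"
    proof (rule poly_mapping_eqI)
      fix i
      have "i < l \<longleftrightarrow> i \<in> kys m" by (simp only: True lessThan_iff)
      then show "lkp m i = lkp (ones_mon l) i"
        using one[of i] unfolding lookup_ones_mon in_keys_iff by (cases "lkp m i = 0") simp_all
    qed
    then show ?thesis by simp
  next
    case False
    then have "\<Sum>{..<l} < \<Sum>(kys m)" using sum_nat_set_ge[of "kys m"] card by auto
    then show ?thesis using htm hto by simp
  qed
qed

lemma squarefree_ones_mon: "squarefree_mon (ones_mon l)" "mdeg (ones_mon l) = l"
proof -
  show "squarefree_mon (ones_mon l)" by (simp add: squarefree_mon_def lookup_ones_mon)
  have "mdeg (ones_mon l) = (\<Sum>i<l. lkp (ones_mon l) i)"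
    by (rule mdeg_sum) (auto simp: in_keys_iff lookup_ones_mon split: if_splits)
  then show "mdeg (ones_mon l) = l" by (simp add: lookup_ones_mon)
qed

text \<open>With the exponents of \<open>m\<close> as row lengths of a Young diagram,
  \<open>E\<close> is the product of the elementary functions indexed by its column lengths.\<close>

lemma ex_leading:
  assumes "\<And>i j. i \<le> j \<Longrightarrow> lkp m j \<le> lkp m i"
  shows "\<exists>E \<in> h_span (mdeg m). sinv E \<and> mps_coeff E m = (1 :: 'a :: field)
    \<and> (\<forall>k. mps_coeff E k \<noteq> 0 \<longrightarrow> mdeg k = mdeg m \<and> (k = m \<or> ht m < ht k))"
  using assms
proof (induction "mdeg m" arbitrary: m rule: less_induct)
  case less
  show ?case
  proof (cases "m = 0")
    case True
    have "sinv (1 :: 'a mps)"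
      using h_comp_in_Sym[of 0, where 'a = 'a] by (simp add: h_comp_def zero_composition.rep_eq Sym_iff)
    then show ?thesis using QF_in_h_span[of 0, where 'a = 'a] True
      by (intro bexI[of _ 1]) (auto simp: QF_0 split: if_splits)
  next
    case False
    \<comment> \<open>The length of the first column, that is, the number of nonzero exponents;
      dividing by \<open>ones_mon l\<close> removes this column.\<close>
    define l where "l = (LEAST i. lkp m i = 0)"
    have "\<exists>i. lkp m i = 0" by (metis ex_new_if_finite finite_keys in_keys_iff infinite_UNIV_nat)
    then have l0: "lkp m l = 0" unfolding l_def by (rule LeastI_ex)
    have lpos: "lkp m i \<noteq> 0" if "i < l" for i using that not_less_Least unfolding l_def by blast
    have lz: "lkp m i = 0" if "l \<le> i" for i using less.prems[OF that] l0 by simp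
    have "l \<noteq> 0" using False lz by (auto intro: poly_mapping_eqI)
    define m' where "m' = m - ones_mon l"
    have m': "lkp m' i = (if i < l then lkp m i - 1 else 0)" for i
      by (simp add: m'_def lookup_minus lookup_ones_mon lz)
    have m: "m = ones_mon l + m'"
      using lpos lz by (intro poly_mapping_eqI) (auto simp: lookup_add m' lookup_ones_mon)
    have "mdeg m' < mdeg m" using \<open>l \<noteq> 0\<close> by (simp add: m squarefree_ones_mon)
    moreover have "lkp m' j \<le> lkp m' i" if "i \<le> j" for i j
      using less.prems[OF that] that by (auto simp: m' diff_le_mono)
    ultimately obtain E where E: "E \<in> h_span (mdeg m')" "sinv E" "mps_coeff E m' = (1 :: 'a)"
      "\<And>k. mps_coeff E k \<noteq> 0 \<Longrightarrow> mdeg k = mdeg m' \<and> (k = m' \<or> ht m' < ht k)"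
      using less.hyps[of m'] by blast
    let ?F = "QF_ones l * E"
    have "?F \<in> h_span (mdeg m)"
      using h_span_times[OF QF_ones_in_h_span[of l] E(1)] by (simp add: m squarefree_ones_mon)
    moreover have "sinv (QF_ones l :: 'a mps)"
      by (simp add: sinv_def mps_coeff_QF_ones bij_is_inj squarefree_mon_relabel)
    then have "sinv ?F" using E(2) by (rule sinv_times)
    moreover have lead: "mdeg k = mdeg m \<and> (k = m \<and> a = ones_mon l \<and> b = m' \<or> ht m < ht k)"
      if "a + b = k" "mps_coeff (QF_ones l) a \<noteq> (0 :: 'a)" "mps_coeff E b \<noteq> 0" for a b k
    proof -
      have "mdeg a = l" using that(2) by (simp add: mps_coeff_QF_ones split: if_splits)
      then have "mdeg k = mdeg m"
        using that(1) E(4)[OF that(3)] by (auto simp: m squarefree_ones_mon)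
      moreover have "ht k = ht a + ht b" "ht m = ht (ones_mon l) + ht m'"
        using that(1) by (auto simp: m tail_add)
      ultimately show ?thesis
        using QF_ones_leading[OF that(2)] E(4)[OF that(3)] that(1) m by auto
    qed
    moreover have "mps_coeff ?F m = 1"
    proof -
      have "mps_coeff ?F m = mps_coeff (QF_ones l) (ones_mon l) * mps_coeff E m'"
      proof (rule mps_coeff_times_unique)
        fix a b assume "a + b = m" "mps_coeff (QF_ones l) a \<noteq> (0 :: 'a)" "mps_coeff E b \<noteq> 0"
        from lead[OF this] show "a = ones_mon l \<and> b = m'" by blast
      qed (simp add: m)
      then show ?thesis by (simp add: mps_coeff_QF_ones squarefree_ones_mon E(3))
    qed
    moreover have "mdeg k = mdeg m \<and> (k = m \<or> ht m < ht k)" if "mps_coeff ?F k \<noteq> 0" for k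
      using that lead by (elim times_coeff_nonzeroE) blast
    ultimately show ?thesis by blast
  qed
qed

text \<open>The product of elementary functions with leading term \<open>\<nu>\<close> differs from
  \<open>msym \<nu>\<close> by monomial functions of greater height, which are covered by downward
  induction.\<close>

lemma msym_in_h_span:
  assumes "is_partition \<nu>"
  shows "msym \<nu> \<in> h_span (comp_size \<nu>)"
proof -
  define n where "n = comp_size \<nu>"
  let ?S = "{\<nu>. is_partition \<nu> \<and> comp_size \<nu> = n}"
  have fin: "finite ?S" by (rule finite_subset[OF _ finite_comp_size_eq[of n]]) auto
  define B where "B = Max (cht ` ?S)"
  have B: "cht \<nu> \<le> B" if "\<nu> \<in> ?S" for \<nu>
    unfolding B_def by (rule Max_ge) (use that fin in auto)
  have sub: "MPS.subspace (h_span n :: 'a mps set)"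
    unfolding h_span_def by (rule MPS.subspace_span)
  have "\<nu> \<in> ?S" using assms by (simp add: n_def)
  then have "msym \<nu> \<in> (h_span n :: 'a mps set)"
  proof (induction "B - cht \<nu>" arbitrary: \<nu> rule: less_induct)
    case less
    have "lkp (comp_monomial \<nu>) j \<le> lkp (comp_monomial \<nu>) i" if "i \<le> j" for i j
      using partition_antimono[of \<nu>] that less.prems by (simp add: lookup_comp_monomial)
    from ex_leading[OF this] obtain E where E: "E \<in> h_span n" "sinv E"
      "mps_coeff E (comp_monomial \<nu>) = (1 :: 'a)"
      "\<And>k. mps_coeff E k \<noteq> 0 \<Longrightarrow> mdeg k = n \<and> (k = comp_monomial \<nu> \<or> cht \<nu> < ht k)"
      using less.prems by auto
    let ?P = "{\<rho>. is_partition \<rho> \<and> comp_size \<rho> \<le> n}"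
    let ?t = "\<lambda>\<rho>. mps_scale (mps_coeff E (comp_monomial \<rho>)) (msym \<rho>)"
    have finP: "finite ?P" by (rule finite_subset[OF _ finite_comp_size_le[of n]]) auto
    have "E = (\<Sum>\<rho>\<in>?P. ?t \<rho>)" by (rule Sym_expand[OF E(2)]) (use E(4) in auto)
    also have "\<dots> = msym \<nu> + (\<Sum>\<rho>\<in>?P - {\<nu>}. ?t \<rho>)"
      using less.prems finP E(3) by (subst sum.remove[of _ \<nu>]) auto
    finally have "msym \<nu> = E - (\<Sum>\<rho>\<in>?P - {\<nu>}. ?t \<rho>)"
      by (rule eq_diff_eq[THEN iffD2, OF sym])
    moreover have "(\<Sum>\<rho>\<in>?P - {\<nu>}. ?t \<rho>) \<in> h_span n"
    proof (rule MPS.subspace_sum[OF sub])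
      fix \<rho> assume \<rho>: "\<rho> \<in> ?P - {\<nu>}"
      show "?t \<rho> \<in> h_span n"
      proof (cases "mps_coeff E (comp_monomial \<rho>) = 0")
        case True
        then show ?thesis by (simp add: MPS.subspace_0[OF sub])
      next
        case False
        have "comp_monomial \<rho> \<noteq> comp_monomial \<nu>"
          using \<rho> by (metis DiffD2 comp_of_comp_monomial singletonI)
        then have "cht \<nu> < cht \<rho>" "\<rho> \<in> ?S" using E(4)[OF False] \<rho> by auto
        then have "(msym \<rho> :: 'a mps) \<in> h_span n" using B[of \<rho>] by (intro less.hyps) auto
        then show ?thesis by (rule MPS.subspace_scale[OF sub])
      qed
    qed
    ultimately show ?case using E(1) by (simp add: MPS.subspace_diff[OF sub])
  qed
  then show ?thesis by (simp add: n_def)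
qed

abbreviation partitions_le :: "nat \<Rightarrow> composition set"
  where "partitions_le d \<equiv> {\<nu>. is_partition \<nu> \<and> comp_size \<nu> \<le> d}"

lemma finite_partitions_le: "finite (partitions_le d)"
  by (rule finite_subset[OF _ finite_comp_size_le[of d]]) auto

lemma h_span_eq: "h_span d = MPS.span (h_comp ` partitions_le d)"
proof -
  have "h_comp ` {\<alpha>. comp_size \<alpha> \<le> d} = (h_comp ` partitions_le d :: 'a mps set)"
  proof (intro equalityI subsetI)
    fix f :: "'a mps" assume "f \<in> h_comp ` {\<alpha>. comp_size \<alpha> \<le> d}"
    then obtain \<alpha> where "f = h_comp (sort_comp \<alpha>)" "comp_size \<alpha> \<le> d"
      by (auto simp: h_comp_sort)
    then show "f \<in> h_comp ` partitions_le d" by auto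
  qed auto
  then show ?thesis by (simp add: h_span_def)
qed

text \<open>The monomial functions are independent and lie in the span of the equally indexed
  \<open>h_comp\<close>. Counting gives independence of the latter, and equality of cardinals gives
  their distinctness.\<close>

lemma h_comp_partitions_le:
  shows "MPS.independent (h_comp ` partitions_le d :: 'a :: field mps set)"
    "inj_on (h_comp :: composition \<Rightarrow> 'a mps) (partitions_le d)"
proof -
  let ?P = "partitions_le d"
  let ?M = "msym ` ?P :: 'a mps set" and ?V = "h_comp ` ?P :: 'a mps set"
  have m: "mps_coeff (msym \<nu>) (comp_monomial \<mu>) = (if \<nu> = \<mu> then 1 else (0 :: 'a))" if "is_partition \<mu>" for \<mu> \<nu>
    using part_of_comp_monomial[OF that] by (auto simp: mps_coeff_msym)
  have inj: "inj_on (msym :: composition \<Rightarrow> 'a mps) ?P"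
    by (rule inj_onI) (metis (no_types, lifting) m mem_Collect_eq one_neq_zero)
  have "MPS.independent ?M"
  proof (rule MPS.independent_by_functionals)
    fix v assume "v \<in> ?M"
    then obtain \<mu> where \<mu>: "is_partition \<mu>" "v = msym \<mu>" by auto
    show "\<exists>f. (\<forall>x y. f (x + y) = f x + f y) \<and> (\<forall>c x. f (mps_scale c x) = c * f x) \<and> f v \<noteq> 0
        \<and> (\<forall>w\<in>?M. w \<noteq> v \<longrightarrow> f w = 0)"
      by (rule exI[of _ "\<lambda>f. mps_coeff f (comp_monomial \<mu>)"]) (use \<mu> m in auto)
  qed
  note M = this
  have span: "?M \<subseteq> MPS.span ?V"
  proof clarify
    fix \<nu> assume "is_partition \<nu>" "comp_size \<nu> \<le> d"
    then show "msym \<nu> \<in> MPS.span ?V"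
      using msym_in_h_span h_span_mono h_span_eq by blast
  qed
  have card: "card ?V \<le> card ?M"
    using card_image_le[OF finite_partitions_le] by (simp add: card_image[OF inj])
  note V = MPS.spanning_card_imp_independent[OF finite_imageI[OF finite_partitions_le] M span card]
  show "MPS.independent ?V" by (rule V(1))
  show "inj_on (h_comp :: composition \<Rightarrow> 'a mps) ?P"
    using V(2) by (intro eq_card_imp_inj_on finite_partitions_le) (simp add: card_image[OF inj])
qed

abbreviation h_basis :: "'a :: field mps set"
  where "h_basis \<equiv> h_comp ` Collect is_partition"

lemma h_comp_eq_iff:
  assumes "is_partition \<mu>" "is_partition \<nu>"
  shows "h_comp \<mu> = (h_comp \<nu> :: 'a :: field mps) \<longleftrightarrow> \<mu> = \<nu>"
  using inj_onD[OF h_comp_partitions_le(2)[of "max (comp_size \<mu>) (comp_size \<nu>)", where 'a = 'a], of \<mu> \<nu>] assms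
  by auto

lemma independent_h_basis: "MPS.independent (h_basis :: 'a :: field mps set)"
proof
  assume "MPS.dependent (h_basis :: 'a mps set)"
  then obtain t u v where t: "finite t" "t \<subseteq> (h_basis :: 'a mps set)"
    "(\<Sum>v\<in>t. mps_scale (u v) v) = 0" "v \<in> t" "u v \<noteq> 0"
    by (auto simp: MPS.dependent_explicit)
  from finite_subset_image[OF t(1,2)] obtain C where C: "C \<subseteq> Collect is_partition" "finite C" "t = h_comp ` C"
    by blast
  define d where "d = Max (comp_size ` C)"
  have "comp_size \<nu> \<le> d" if "\<nu> \<in> C" for \<nu>
    unfolding d_def by (rule Max_ge) (use that C(2) in auto)
  then have "t \<subseteq> h_comp ` partitions_le d" using C by auto
  then have "MPS.dependent (h_comp ` partitions_le d :: 'a mps set)"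
    using t unfolding MPS.dependent_explicit by blast
  then show False using h_comp_partitions_le(1) by blast
qed

section \<open>The Hall inner product and its adjunction with \<open>chi\<close>\<close>

lemma hall_explicit:
  assumes S: "finite S" "S \<subseteq> Collect is_partition"
  shows "hall (\<Sum>\<nu>\<in>S. mps_scale (c \<nu>) (h_comp \<nu>)) g = (\<Sum>\<nu>\<in>S. c \<nu> * mps_coeff g (comp_monomial \<nu>))"
proof -
  have rep: "MPS.representation h_basis (\<Sum>\<nu>\<in>S. mps_scale (c \<nu>) (h_comp \<nu>)) (h_comp \<mu>) = (if \<mu> \<in> S then c \<mu> else 0)"
    if \<mu>: "is_partition \<mu>" for \<mu>
  proof -
    have span: "h_comp \<nu> \<in> MPS.span h_basis" if "\<nu> \<in> S" for \<nu>
      using that S by (intro MPS.span_base) auto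
    have "MPS.representation h_basis (\<Sum>\<nu>\<in>S. mps_scale (c \<nu>) (h_comp \<nu>)) (h_comp \<mu>)
      = (\<Sum>\<nu>\<in>S. MPS.representation h_basis (mps_scale (c \<nu>) (h_comp \<nu>)) (h_comp \<mu>))"
      by (subst MPS.representation_sum[OF independent_h_basis]) (auto intro: span MPS.span_scale)
    also have "\<dots> = (\<Sum>\<nu>\<in>S. if \<nu> = \<mu> then c \<mu> else 0)"
    proof (rule sum.cong[OF refl])
      fix \<nu> assume \<nu>: "\<nu> \<in> S"
      have "MPS.representation h_basis (mps_scale (c \<nu>) (h_comp \<nu>)) (h_comp \<mu>)
        = c \<nu> * MPS.representation h_basis (h_comp \<nu>) (h_comp \<mu>)"
        by (subst MPS.representation_scale[OF independent_h_basis]) (auto intro: span \<nu>)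
      also have "MPS.representation h_basis (h_comp \<nu>) = (\<lambda>v. if v = h_comp \<nu> then 1 else 0)"
        by (rule MPS.representation_basis[OF independent_h_basis]) (use \<nu> S in auto)
      finally show "MPS.representation h_basis (mps_scale (c \<nu>) (h_comp \<nu>)) (h_comp \<mu>)
        = (if \<nu> = \<mu> then c \<mu> else 0)"
        using h_comp_eq_iff[OF \<mu>, of \<nu>] \<nu> S by auto
    qed
    finally show ?thesis using S by simp
  qed
  have "hall (\<Sum>\<nu>\<in>S. mps_scale (c \<nu>) (h_comp \<nu>)) g
    = Sum_any (\<lambda>\<nu>. if \<nu> \<in> S then c \<nu> * mps_coeff g (comp_monomial \<nu>) else 0)"
    unfolding hall_def using S by (intro arg_cong[of _ _ Sum_any] ext) (auto simp: rep)
  also have "\<dots> = (\<Sum>\<nu>\<in>S. if \<nu> \<in> S then c \<nu> * mps_coeff g (comp_monomial \<nu>) else 0)"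
    by (rule Sum_any.expand_superset[OF S(1)]) auto
  finally show ?thesis by simp
qed

lemma chi_expand:
  fixes f :: "'a :: field nsym"
  shows "chi f = (\<Sum>\<nu>\<in>sort_comp ` Poly_Mapping.keys f.
  mps_scale (\<Sum>\<alpha> | \<alpha> \<in> Poly_Mapping.keys f \<and> sort_comp \<alpha> = \<nu>. Poly_Mapping.lookup f \<alpha>) (h_comp \<nu>))"
proof -
  have "chi f = (\<Sum>\<nu>\<in>sort_comp ` Poly_Mapping.keys f. \<Sum>\<alpha> | \<alpha> \<in> Poly_Mapping.keys f \<and> sort_comp \<alpha> = \<nu>.
      mps_scale (Poly_Mapping.lookup f \<alpha>) (h_comp \<alpha>))"
    unfolding chi_def by (rule sum.image_gen) simp
  also have "\<dots> = (\<Sum>\<nu>\<in>sort_comp ` Poly_Mapping.keys f. \<Sum>\<alpha> | \<alpha> \<in> Poly_Mapping.keys f \<and> sort_comp \<alpha> = \<nu>.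
      mps_scale (Poly_Mapping.lookup f \<alpha>) (h_comp \<nu>))"
    by (intro sum.cong refl) (auto simp: h_comp_sort)
  finally show ?thesis by (simp add: MPS.scale_sum_left)
qed

text \<open>\<open>h_comp\<close> depends only on the sorted composition, and a symmetric
  \<open>G\<close> has equal coefficients at all rearrangements; so grouping the terms of
  \<open>f\<close> by \<open>sort_comp\<close> turns one pairing into the other.\<close>

lemma hall_chi:
  assumes "sinv G"
  shows "hall (chi f) G = pairing f G"
proof -
  have "hall (chi f) G = (\<Sum>\<nu>\<in>sort_comp ` Poly_Mapping.keys f.
      (\<Sum>\<alpha> | \<alpha> \<in> Poly_Mapping.keys f \<and> sort_comp \<alpha> = \<nu>. Poly_Mapping.lookup f \<alpha>) * mps_coeff G (comp_monomial \<nu>))"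
    unfolding chi_expand by (rule hall_explicit) auto
  also have "\<dots> = (\<Sum>\<nu>\<in>sort_comp ` Poly_Mapping.keys f. \<Sum>\<alpha> | \<alpha> \<in> Poly_Mapping.keys f \<and> sort_comp \<alpha> = \<nu>.
      Poly_Mapping.lookup f \<alpha> * mps_coeff G (comp_monomial \<alpha>))"
  proof (intro sum.cong refl)
    fix \<nu>
    have "mps_coeff G (comp_monomial \<nu>) = mps_coeff G (comp_monomial \<alpha>)" if "sort_comp \<alpha> = \<nu>" for \<alpha>
      using sinv_sort[OF assms, of \<alpha>] that by simp
    then show "(\<Sum>\<alpha> | \<alpha> \<in> Poly_Mapping.keys f \<and> sort_comp \<alpha> = \<nu>. Poly_Mapping.lookup f \<alpha>) * mps_coeff G (comp_monomial \<nu>)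
      = (\<Sum>\<alpha> | \<alpha> \<in> Poly_Mapping.keys f \<and> sort_comp \<alpha> = \<nu>. Poly_Mapping.lookup f \<alpha> * mps_coeff G (comp_monomial \<alpha>))"
      unfolding sum_distrib_right by (intro sum.cong) auto
  qed
  also have "\<dots> = pairing f G"
    unfolding pairing_def by (rule sum.image_gen[symmetric]) simp
  finally show ?thesis .
qed

lemma chi_in_Sym: "chi f \<in> Sym"
  unfolding chi_def by (intro Sym_sum Sym_scale h_comp_in_Sym)

lemma Sym_h_expand:
  assumes "f \<in> Sym"
  obtains d c where "f = (\<Sum>\<nu>\<in>partitions_le d. mps_scale (c \<nu>) (h_comp \<nu>))"
proof -
  obtain d where d: "\<And>m. mps_coeff f m \<noteq> 0 \<Longrightarrow> mdeg m \<le> d" and s: "sinv f"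
    using assms by (auto simp: Sym_iff bounded_degree_def)
  have "(\<Sum>\<nu>\<in>partitions_le d. mps_scale (mps_coeff f (comp_monomial \<nu>)) (msym \<nu>)) \<in> MPS.span (h_comp ` partitions_le d)"
  proof (intro MPS.span_sum MPS.span_scale)
    fix \<nu> assume "\<nu> \<in> partitions_le d"
    then show "msym \<nu> \<in> MPS.span (h_comp ` partitions_le d)"
      using msym_in_h_span h_span_mono h_span_eq by blast
  qed
  then have "f \<in> MPS.span (h_comp ` partitions_le d)"
    using Sym_expand[OF s d] by simp
  then obtain u where "f = (\<Sum>v\<in>h_comp ` partitions_le d. mps_scale (u v) v)"
    by (auto simp: MPS.span_finite[OF finite_imageI[OF finite_partitions_le]])
  then have "f = (\<Sum>\<nu>\<in>partitions_le d. mps_scale (u (h_comp \<nu>)) (h_comp \<nu>))"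
    by (simp add: sum.reindex[OF h_comp_partitions_le(2)])
  then show ?thesis by (rule that)
qed

lemma hall_diff_left:
  assumes "f \<in> Sym" "f' \<in> Sym"
  shows "hall (f - f') g = hall f g - hall f' g"
proof -
  obtain d c where f: "f = (\<Sum>\<nu>\<in>partitions_le d. mps_scale (c \<nu>) (h_comp \<nu>))"
    using assms(1) by (rule Sym_h_expand)
  obtain d' c' where f': "f' = (\<Sum>\<nu>\<in>partitions_le d'. mps_scale (c' \<nu>) (h_comp \<nu>))"
    using assms(2) by (rule Sym_h_expand)
  define D where "D = max d d'"
  \<comment> \<open>Extension by zero puts both expansions over one finite index set, where
    \<open>hall_explicit\<close> applies to the difference.\<close>
  define e where "e \<nu> = (if \<nu> \<in> partitions_le d then c \<nu> else 0)" for \<nu>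
  define e' where "e' \<nu> = (if \<nu> \<in> partitions_le d' then c' \<nu> else 0)" for \<nu>
  have e: "f = (\<Sum>\<nu>\<in>partitions_le D. mps_scale (e \<nu>) (h_comp \<nu>))"
    unfolding f by (rule sum.mono_neutral_cong_left[OF finite_partitions_le]) (auto simp: D_def e_def)
  have e': "f' = (\<Sum>\<nu>\<in>partitions_le D. mps_scale (e' \<nu>) (h_comp \<nu>))"
    unfolding f' by (rule sum.mono_neutral_cong_left[OF finite_partitions_le]) (auto simp: D_def e'_def)
  have "f - f' = (\<Sum>\<nu>\<in>partitions_le D. mps_scale (e \<nu> - e' \<nu>) (h_comp \<nu>))"
    by (simp add: e e' sum_subtractf MPS.scale_left_diff_distrib)
  then show ?thesis
    unfolding e e' by (simp add: hall_explicit[OF finite_partitions_le] Collect_mono left_diff_distrib sum_subtractf)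
qed

lemma hall_sum_right:
  assumes "f \<in> Sym"
  shows "hall f (\<Sum>x\<in>A. mps_scale (b x) (g x)) = (\<Sum>x\<in>A. b x * hall f (g x))"
proof -
  obtain d c where f: "f = (\<Sum>\<nu>\<in>partitions_le d. mps_scale (c \<nu>) (h_comp \<nu>))"
    using assms(1) by (rule Sym_h_expand)
  show ?thesis
    by (simp add: f hall_explicit[OF finite_partitions_le] Collect_mono sum_distrib_left
        sum.swap[of _ A] mult.left_commute)
qed

text \<open>The Hall product with \<open>msym \<nu>\<close> is the coefficient of
  \<open>h_comp \<nu>\<close>, and \<open>msym \<nu>\<close> is a combination of the duals.\<close>

lemma Sym_eqI_hall:
  assumes "f \<in> Sym" "f' \<in> Sym"
    "\<And>\<mu>. is_partition \<mu> \<Longrightarrow> hall f (HL_dual q \<mu>) = hall f' (HL_dual q \<mu>)"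
  shows "f = f'"
proof -
  have D: "f - f' \<in> Sym" using assms by (intro Sym_diff)
  then obtain d c where f: "f - f' = (\<Sum>\<nu>\<in>partitions_le d. mps_scale (c \<nu>) (h_comp \<nu>))"
    by (rule Sym_h_expand)
  have "c \<nu> = 0" if \<nu>: "\<nu> \<in> partitions_le d" for \<nu>
  proof -
    have "is_partition \<nu>" using \<nu> by simp
    have "hall (f - f') (msym \<nu>) = (\<Sum>\<mu> | is_partition \<mu> \<and> comp_size \<mu> = comp_size \<nu>.
        pairing (HL_gen q \<mu>) (msym \<nu>) * hall (f - f') (HL_dual q \<mu>))"
      by (subst msym_expand[OF \<open>is_partition \<nu>\<close>, of q]) (rule hall_sum_right[OF D])
    also have "\<dots> = 0"
      by (rule sum.neutral) (simp add: hall_diff_left assms)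
    finally have "(\<Sum>\<mu>\<in>partitions_le d. c \<mu> * mps_coeff (msym \<nu>) (comp_monomial \<mu>)) = 0"
      unfolding f by (subst (asm) hall_explicit[OF finite_partitions_le]) auto
    moreover have "(\<Sum>\<mu>\<in>partitions_le d. c \<mu> * mps_coeff (msym \<nu>) (comp_monomial \<mu>))
        = (\<Sum>\<mu>\<in>partitions_le d. if \<mu> = \<nu> then c \<nu> else 0)"
      by (rule sum.cong) (auto simp: mps_coeff_msym sort_comp_partition)
    ultimately show ?thesis using \<nu> finite_partitions_le[of d] by simp
  qed
  then have "f - f' = 0" unfolding f by (intro sum.neutral) simp
  then show ?thesis by simp
qed

text \<open>Existence in the description of \<open>HL_Q'\<close> is \<open>hall_chi\<close> applied
  to the dual family; uniqueness is \<open>Sym_eqI_hall\<close>.\<close>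

lemma chi_HL_eq_HL_Q':
  assumes P: "\<And>\<mu>. is_partition \<mu> \<Longrightarrow> HL_P \<mu> = HL_dual qvar \<mu>" and "is_partition \<nu>"
  shows "chi (HL_nsym \<nu>) = HL_Q' \<nu>"
proof -
  have hall: "hall (chi (HL_nsym \<nu>)) (HL_P \<mu>) = (if \<mu> = \<nu> then 1 else 0)" if "is_partition \<mu>" for \<mu>
    using HL_dual[OF that, where q = qvar] assms(2) that
    by (auto simp: P hall_chi Sym_iff HL_nsym_eq)
  show ?thesis
    unfolding HL_Q'_def
  proof (rule the_equality[symmetric])
    show "chi (HL_nsym \<nu>) \<in> Sym \<and> (\<forall>\<mu>. is_partition \<mu> \<longrightarrow> hall (chi (HL_nsym \<nu>)) (HL_P \<mu>) = (if \<mu> = \<nu> then 1 else 0))"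
      using hall chi_in_Sym by blast
    fix f assume "f \<in> Sym \<and> (\<forall>\<mu>. is_partition \<mu> \<longrightarrow> hall f (HL_P \<mu>) = (if \<mu> = \<nu> then 1 else 0))"
    then show "f = chi (HL_nsym \<nu>)"
      using hall P by (intro Sym_eqI_hall[where q = qvar] chi_in_Sym) auto
  qed
qed

section \<open>Products over pairs and permutations\<close>

lemma prod_pairs_Sigma:
  "(\<Prod>a<n. \<Prod>b\<in>{a<..<n}. f a b) = (\<Prod>(a, b)\<in>{(a, b). a < b \<and> b < n}. f a b)" for n :: nat
proof -
  have "(SIGMA a:{..<n}. {a<..<n}) = {(a, b). a < b \<and> b < n}" by auto
  then show ?thesis by (simp add: prod.Sigma)
qed

text \<open>\<open>w\<close> permutes the two-element subsets; \<open>a\<close> comes first in the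
  image of an ordered pair exactly when \<open>inv w a < inv w b\<close>.\<close>

lemma prod_pairs_permutes:
  fixes n :: nat
  assumes w: "w permutes {..<n}"
  shows "(\<Prod>i<n. \<Prod>j\<in>{i<..<n}. g (w i) (w j))
    = (\<Prod>a<n. \<Prod>b\<in>{a<..<n}. if inv w a < inv w b then g a b else g b a)"
proof -
  have wi: "w (inv w x) = x" "inv w (w x) = x" for x using w by (simp_all add: permutes_inverses)
  have wlt: "w x < n \<longleftrightarrow> x < n" "inv w x < n \<longleftrightarrow> x < n" for x
    using permutes_in_image[OF w, of x] permutes_in_image[OF permutes_inv[OF w], of x] by simp_all
  have inj: "w x = w y \<longleftrightarrow> x = y" "inv w x = inv w y \<longleftrightarrow> x = y" for x y
    by (metis wi)+
  have "(\<Prod>(i, j)\<in>{(a, b). a < b \<and> b < n}. g (w i) (w j))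
    = (\<Prod>(a, b)\<in>{(a, b). a < b \<and> b < n}. if inv w a < inv w b then g a b else g b a)"
  by (rule prod.reindex_bij_witness
      [where i = "\<lambda>(a, b). if inv w a < inv w b then (inv w a, inv w b) else (inv w b, inv w a)"
         and j = "\<lambda>(i, j). if w i < w j then (w i, w j) else (w j, w i)"])
      (auto simp: wi wlt inj not_less le_less split: if_splits)
  then show ?thesis by (simp only: prod_pairs_Sigma)
qed

text \<open>The sign as a product over inversions: it takes values in any commutative ring and has
  the shape produced by \<open>prod_pairs_permutes\<close>.\<close>

definition perm_sign :: "nat \<Rightarrow> (nat \<Rightarrow> nat) \<Rightarrow> 'a :: comm_ring_1"
  where "perm_sign n w = (\<Prod>a<n. \<Prod>b\<in>{a<..<n}. if inv w a < inv w b then 1 else - 1)"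

lemma prod_pairs_antisym:
  fixes g :: "nat \<Rightarrow> nat \<Rightarrow> 'a :: comm_ring_1"
  assumes "w permutes {..<n}" "\<And>a b. a < b \<Longrightarrow> b < n \<Longrightarrow> g b a = - g a b"
  shows "(\<Prod>i<n. \<Prod>j\<in>{i<..<n}. g (w i) (w j)) = perm_sign n w * (\<Prod>i<n. \<Prod>j\<in>{i<..<n}. g i j)"
  unfolding prod_pairs_permutes[OF assms(1)] perm_sign_def prod.distrib[symmetric]
  by (intro prod.cong refl) (simp add: assms(2))

lemma perm_sign_cases: "(perm_sign n w :: 'a :: comm_ring_1) = 1 \<or> (perm_sign n w :: 'a) = - 1"
proof -
  have signs: "prod f A = 1 \<or> prod f A = (- 1)" if "\<And>x. x \<in> A \<Longrightarrow> f x = 1 \<or> f x = (- 1 :: 'a)"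
    for f :: "nat \<Rightarrow> 'a" and A
    using that
  proof (induction A rule: infinite_finite_induct)
    case (insert x F)
    then have "f x = 1 \<or> f x = - 1" "prod f F = 1 \<or> prod f F = - 1" by auto
    then show ?case using insert(1,2) by auto
  qed auto
  show ?thesis unfolding perm_sign_def by (rule signs, rule signs) simp
qed

lemma perm_sign_adjacent:
  assumes "Suc c < n"
  shows "perm_sign n (transpose c (Suc c)) = - 1"
proof -
  let ?P = "{(a, b). a < b \<and> b < n}"
  have "finite ?P" by (rule finite_subset[of _ "{..<n} \<times> {..<n}"]) auto
  moreover have "(if inv (transpose c (Suc c)) a < inv (transpose c (Suc c)) b then 1 else - 1)
      = (if (a, b) = (c, Suc c) then - 1 else (1 :: 'a))" if "a < b" for a b
    using that by (auto simp: transpose_def)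
  then have "perm_sign n (transpose c (Suc c)) = (\<Prod>p\<in>?P. if p = (c, Suc c) then - 1 else (1 :: 'a))"
    unfolding perm_sign_def prod_pairs_Sigma by (intro prod.cong) (auto split: if_splits)
  ultimately show ?thesis using assms by simp
qed

section \<open>Monomials with decreasing exponents\<close>

definition decr :: "monomial \<Rightarrow> bool"
  where "decr m \<longleftrightarrow> (\<forall>i j. i \<le> j \<longrightarrow> lkp m j \<le> lkp m i)"

lemma finite_downclosed:
  fixes A :: "nat set"
  assumes "finite A" "\<And>i j. i \<le> j \<Longrightarrow> j \<in> A \<Longrightarrow> i \<in> A"
  shows "A = {..<card A}"
proof -
  obtain k where k: "k \<notin> A" by (meson assms(1) ex_new_if_finite infinite_UNIV_nat)
  define l where "l = (LEAST i. i \<notin> A)"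
  have "l \<notin> A" unfolding l_def by (rule LeastI[of "\<lambda>i. i \<notin> A", OF k])
  moreover have "i \<in> A" if "i < l" for i using that not_less_Least unfolding l_def by blast
  ultimately have "A = {..<l}" using assms(2) by (auto simp: not_le[symmetric])
  then show ?thesis by simp
qed

lemma relabel_comp: "inj \<pi> \<Longrightarrow> inj \<rho> \<Longrightarrow> relabel \<pi> (relabel \<rho> m) = relabel (\<pi> \<circ> \<rho>) m"
proof (rule poly_mapping_eqI)
  fix j assume inj: "inj \<pi>" "inj \<rho>"
  then have c: "inj (\<pi> \<circ> \<rho>)" by (rule inj_compose)
  show "lkp (relabel \<pi> (relabel \<rho> m)) j = lkp (relabel (\<pi> \<circ> \<rho>) m) j"
  proof (cases "j \<in> range (\<pi> \<circ> \<rho>)")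
    case True
    then obtain i where "j = (\<pi> \<circ> \<rho>) i" by blast
    then show ?thesis using lookup_relabel_image[OF c, of m i] inj by simp
  next
    case False
    then have "j \<notin> kys (relabel \<pi> (relabel \<rho> m))" "j \<notin> kys (relabel (\<pi> \<circ> \<rho>) m)"
      using inj c by (auto simp: keys_relabel)
    then show ?thesis by (simp add: in_keys_iff)
  qed
qed

text \<open>For decreasing exponents the positions with exponent above \<open>t\<close> form an
  initial segment, determined by its size, and relabelling preserves that size.\<close>

lemma decr_relabel_eq:
  assumes "inj \<pi>" "decr m" "decr (relabel \<pi> m)"
  shows "relabel \<pi> m = m"
proof -
  define A where "A t k = {i. Suc t \<le> lkp k i}" for t k
  have down: "A t k = {..<card (A t k)}" if "decr k" for t k
  proof (rule finite_downclosed)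
    show "finite (A t k)"
      by (rule finite_subset[of _ "kys k"]) (auto simp: A_def in_keys_iff)
    show "i \<in> A t k" if "i \<le> j" "j \<in> A t k" for i j
      using that \<open>decr k\<close> unfolding A_def decr_def by (auto intro: order_trans)
  qed
  have "A t (relabel \<pi> m) = \<pi> ` A t m" for t
  proof (intro equalityI subsetI)
    fix i assume i: "i \<in> A t (relabel \<pi> m)"
    then have "i \<in> range \<pi>"
      using lookup_relabel_notin[OF assms(1), of i m] by (cases "i \<in> range \<pi>") (auto simp: A_def)
    then show "i \<in> \<pi> ` A t m" using i assms(1) by (auto simp: A_def)
  qed (use assms(1) in \<open>auto simp: A_def\<close>)
  then have "card (A t (relabel \<pi> m)) = card (A t m)" for t
    using assms(1) by (simp add: card_image inj_on_subset)
  then have A: "A t (relabel \<pi> m) = A t m" for t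
    using down assms(2,3) by metis
  show ?thesis
  proof (rule poly_mapping_eqI)
    fix i
    have "t < lkp (relabel \<pi> m) i \<longleftrightarrow> t < lkp m i" for t
      using A[of t] by (auto simp: A_def Suc_le_eq)
    then show "lkp (relabel \<pi> m) i = lkp m i" by (metis less_irrefl linorder_neqE_nat)
  qed
qed

lemma decr_comp_monomial: "is_partition \<nu> \<Longrightarrow> decr (comp_monomial \<nu>)"
  by (simp add: decr_def lookup_comp_monomial partition_antimono)

lemma comp_monomial_part_of:
  assumes "decr m"
  shows "comp_monomial (part_of m) = m"
proof -
  obtain \<pi> where \<pi>: "strict_mono \<pi>" "m = relabel \<pi> (comp_monomial (comp_of m))"
    by (rule relabel_comp_of)
  obtain p where p: "p permutes {..<comp_length (comp_of m)}"
    "comp_monomial (comp_of m) = relabel p (comp_monomial (part_of m))"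
    by (rule relabel_sort_comp)
  let ?k = "comp_monomial (part_of m)"
  have inj: "inj \<pi>" "inj p" using \<pi>(1) p(1) by (auto intro: strict_mono_inj permutes_inj)
  have m: "m = relabel (\<pi> \<circ> p) ?k" using \<pi>(2) p(2) relabel_comp[OF inj] by metis
  have "relabel (\<pi> \<circ> p) ?k = ?k"
    by (rule decr_relabel_eq) (use inj assms m in \<open>auto intro: inj_compose decr_comp_monomial\<close>)
  then show ?thesis using m by simp
qed

lemma comp_length_part_of: "kys m \<subseteq> {..<n} \<Longrightarrow> comp_length (part_of m) \<le> n"
proof -
  assume "kys m \<subseteq> {..<n}"
  then have "card (kys m) \<le> n" using card_mono[of "{..<n}" "kys m"] by simp
  then show ?thesis by (simp add: comp_length_def parts_sort_comp exponents_def)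
qed

lemma decrI:
  assumes "kys m \<subseteq> {..<n}" "\<And>i. Suc i < n \<Longrightarrow> lkp m (Suc i) \<le> lkp m i"
  shows "decr m"
proof -
  have "lkp m (Suc i) \<le> lkp m i" for i
  proof (cases "Suc i < n")
    case False
    then have "Suc i \<notin> kys m" using assms(1) by auto
    then show ?thesis by (simp add: in_keys_iff)
  qed (rule assms(2))
  then show ?thesis unfolding decr_def using lift_Suc_antimono_le[of "lkp m"] by blast
qed

lemma ex_sorting_permutation:
  assumes "kys m \<subseteq> {..<n}"
  obtains \<sigma> where "\<sigma> permutes {..<n}" "decr (relabel \<sigma> m)"
proof -
  define xs where "xs = map (lkp m) [0..<n]"
  have len: "length xs = n" by (simp add: xs_def)
  have "mset (rev (sort xs)) = mset xs" by simp
  then obtain p where p: "p permutes {..<n}" "permute_list p xs = rev (sort xs)"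
    using mset_eq_permutation len by metis
  have bij: "bij (inv p)" using p(1) by (metis permutes_bij permutes_inv)
  have pi: "inv (inv p) = p" using p(1) by (simp add: permutes_inv_inv)
  have l: "lkp (relabel (inv p) m) i = rev (sort xs) ! i" if "i < n" for i
  proof -
    have "p i < n" using permutes_in_image[OF p(1), of i] that by simp
    then show ?thesis using that p
      by (simp add: lookup_relabel_bij[OF bij] pi flip: p(2)) (simp add: permute_list_nth len xs_def)
  qed
  have sorted: "sorted_wrt (\<ge>) (rev (sort xs))" by (simp add: sorted_wrt_rev)
  have "decr (relabel (inv p) m)"
  proof (rule decrI[of _ n])
    show "kys (relabel (inv p) m) \<subseteq> {..<n}"
      using assms permutes_image[OF permutes_inv[OF p(1)]] by (auto simp: keys_relabel bij_is_inj[OF bij])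
    show "lkp (relabel (inv p) m) (Suc i) \<le> lkp (relabel (inv p) m) i" if "Suc i < n" for i
      using that sorted len by (simp add: l sorted_wrt_iff_nth_less)
  qed
  then show ?thesis using that permutes_inv[OF p(1)] by blast
qed

section \<open>Inversions in the stabilizer of a partition\<close>

lemma prod_pairs_last:
  fixes f :: "nat \<Rightarrow> nat \<Rightarrow> 'a :: comm_monoid_mult"
  shows "(\<Prod>a<Suc n. \<Prod>b\<in>{a<..<Suc n}. f a b)
    = (\<Prod>a<n. \<Prod>b\<in>{a<..<n}. f a b) * (\<Prod>a<n. f a n)"
proof -
  have "{a<..<Suc n} = insert n {a<..<n}" if "a < n" for a using that by auto
  then have "(\<Prod>b\<in>{a<..<Suc n}. f a b) = (\<Prod>b\<in>{a<..<n}. f a b) * f a n" if "a < n" for a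
    using that by (simp add: mult.commute)
  moreover have "{n<..<Suc n} = {}" by auto
  ultimately show ?thesis by (simp add: prod.distrib)
qed

text \<open>The cycle sending \<open>n\<close> to \<open>p\<close> and keeping the order of the
  positions below \<open>n\<close>. A permutation of \<open>{..<Suc n}\<close> is uniquely such a
  cycle after a permutation of \<open>{..<n}\<close>, with \<open>p\<close> the image of
  \<open>n\<close>.\<close>

definition rotate_to :: "nat \<Rightarrow> nat \<Rightarrow> nat \<Rightarrow> nat"
  where "rotate_to p n i = (if i < p \<or> n < i then i else if i < n then Suc i else p)"

lemma rotate_to_permutes: "p \<le> n \<Longrightarrow> rotate_to p n permutes {..<Suc n}"
proof (rule bij_imp_permutes)
  assume p: "p \<le> n"
  show "bij_betw (rotate_to p n) {..<Suc n} {..<Suc n}"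
    by (rule bij_betw_byWitness[where f' = "\<lambda>j. if j < p then j else if j = p then n else j - 1"])
      (use p in \<open>auto simp: rotate_to_def\<close>)
qed (simp add: rotate_to_def)

lemma rotate_to_less:
  "p \<le> n \<Longrightarrow> a < n \<Longrightarrow> b < n \<Longrightarrow> rotate_to p n a < rotate_to p n b \<longleftrightarrow> a < b"
  by (auto simp: rotate_to_def)

text \<open>The last position takes the value \<open>p\<close>; the \<open>n - p\<close> larger
  values all precede it, which gives as many new inversions.\<close>

lemma inv_prod_rotate:
  fixes q :: "'a :: comm_ring_1"
  assumes w: "w permutes {..<n}" and p: "p \<le> n"
  shows "(\<Prod>a<Suc n. \<Prod>b\<in>{a<..<Suc n}. if (rotate_to p n \<circ> w) b < (rotate_to p n \<circ> w) a then q else 1)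
    = q ^ (n - p) * (\<Prod>a<n. \<Prod>b\<in>{a<..<n}. if w b < w a then q else 1)"
proof -
  have lt: "w i < n \<longleftrightarrow> i < n" for i using permutes_in_image[OF w, of i] by simp
  have wn: "w n = n" using w by (simp add: permutes_not_in)
  have "(\<Prod>a<n. \<Prod>b\<in>{a<..<n}. if (rotate_to p n \<circ> w) b < (rotate_to p n \<circ> w) a then q else 1)
      = (\<Prod>a<n. \<Prod>b\<in>{a<..<n}. if w b < w a then q else 1)"
    by (intro prod.cong refl) (simp add: rotate_to_less p lt)
  moreover have "(\<Prod>a<n. if (rotate_to p n \<circ> w) n < (rotate_to p n \<circ> w) a then q else 1) = q ^ (n - p)"
  proof -
    have "(\<Prod>a<n. if (rotate_to p n \<circ> w) n < (rotate_to p n \<circ> w) a then q else 1)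
        = (\<Prod>a<n. if p \<le> w a then q else 1)"
      by (intro prod.cong refl) (use p lt in \<open>auto simp: rotate_to_def wn\<close>)
    also have "\<dots> = (\<Prod>a<n. if p \<le> a then q else 1)"
      using prod.permute[OF w, of "\<lambda>a. if p \<le> a then q else 1"] by (simp add: o_def)
    also have "\<dots> = q ^ card ({..<n} \<inter> {a. p \<le> a})"
      by (simp add: prod.If_cases)
    also have "{..<n} \<inter> {a. p \<le> a} = {p..<n}" by auto
    finally show ?thesis by simp
  qed
  ultimately show ?thesis unfolding prod_pairs_last by (simp only: mult.commute)
qed

lemma sum_permutes_Suc:
  fixes F :: "(nat \<Rightarrow> nat) \<Rightarrow> 'a :: comm_monoid_add"
  shows "(\<Sum>u | u permutes {..<Suc n}. F u) = (\<Sum>p\<le>n. \<Sum>w | w permutes {..<n}. F (rotate_to p n \<circ> w))"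
proof -
  have "(\<Sum>p\<le>n. \<Sum>w | w permutes {..<n}. F (rotate_to p n \<circ> w))
      = (\<Sum>(p, w)\<in>{..n} \<times> {w. w permutes {..<n}}. F (rotate_to p n \<circ> w))"
    by (simp add: sum.cartesian_product)
  also have "\<dots> = (\<Sum>u | u permutes {..<Suc n}. F u)"
  proof (rule sum.reindex_bij_witness
      [where j = "\<lambda>(p, w). rotate_to p n \<circ> w" and i = "\<lambda>u. (u n, inv (rotate_to (u n) n) \<circ> u)"])
    fix x assume "x \<in> {..n} \<times> {w. w permutes {..<n}}"
    then obtain p w where x: "x = (p, w)" "p \<le> n" "w permutes {..<n}" by auto
    have wn: "w n = n" using x(3) by (simp add: permutes_not_in)
    have r: "rotate_to p n permutes {..<Suc n}" using x(2) by (rule rotate_to_permutes)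
    have un: "(rotate_to p n \<circ> w) n = p" using x(2) by (simp add: wn rotate_to_def)
    have "inv (rotate_to p n) \<circ> (rotate_to p n \<circ> w) = w"
      using permutes_inv_o(2)[OF r] by (simp add: o_assoc)
    then show "((case x of (p, w) \<Rightarrow> rotate_to p n \<circ> w) n,
        inv (rotate_to ((case x of (p, w) \<Rightarrow> rotate_to p n \<circ> w) n) n) \<circ> (case x of (p, w) \<Rightarrow> rotate_to p n \<circ> w)) = x"
      using un by (simp add: x(1))
    have "w permutes {..<Suc n}" using x(3) by (rule permutes_subset) auto
    then show "(case x of (p, w) \<Rightarrow> rotate_to p n \<circ> w) \<in> {u. u permutes {..<Suc n}}"
      using r by (simp add: x(1) permutes_compose)
  next
    fix u assume "u \<in> {u. u permutes {..<Suc n}}"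
    then have u: "u permutes {..<Suc n}" by simp
    then have un: "u n \<le> n" using permutes_in_image[OF u, of n] by simp
    then have r: "rotate_to (u n) n permutes {..<Suc n}" by (rule rotate_to_permutes)
    show "(case (u n, inv (rotate_to (u n) n) \<circ> u) of (p, w) \<Rightarrow> rotate_to p n \<circ> w) = u"
      using permutes_inv_o(1)[OF r] by (simp add: o_assoc)
    have "inv (rotate_to (u n) n) \<circ> u permutes {..<n}"
    proof (rule permutes_superset)
      show "inv (rotate_to (u n) n) \<circ> u permutes {..<Suc n}"
        using u r by (intro permutes_compose permutes_inv)
      have "rotate_to (u n) n n = u n" using un by (simp add: rotate_to_def)
      then have "inv (rotate_to (u n) n) (u n) = n" using permutes_inv_eq[OF r] by metis
      then show "\<And>x. x \<in> {..<Suc n} - {..<n} \<Longrightarrow> (inv (rotate_to (u n) n) \<circ> u) x = x"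
        by (auto simp: less_Suc_eq)
    qed
    then show "(u n, inv (rotate_to (u n) n) \<circ> u) \<in> {..n} \<times> {w. w permutes {..<n}}"
      using un by simp
  qed auto
  finally show ?thesis by simp
qed

text \<open>Induction on the last position. It may be sent to any \<open>p\<close> in its block, at
  the cost of \<open>n - p\<close> inversions, so it contributes
  \<open>1 + q + ... + q^(m-1)\<close>, where \<open>m\<close> is the multiplicity of the value
  \<open>f n\<close> up to and including position \<open>n\<close>.\<close>

lemma stabilizer_inversions:
  fixes q :: "'a :: field" and f :: "nat \<Rightarrow> nat"
  assumes "\<And>i j. i \<le> j \<Longrightarrow> j < n \<Longrightarrow> f j \<le> f i" "\<And>i. i < n \<Longrightarrow> f i \<le> M" "q \<noteq> 1"
  shows "(\<Sum>u | u permutes {..<n}. if \<forall>i<n. f (u i) = f i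
      then \<Prod>a<n. \<Prod>b\<in>{a<..<n}. if u b < u a then q else 1 else 0)
    = (\<Prod>i\<le>M. \<Prod>j = 1..card {k. k < n \<and> f k = i}. (1 - q ^ j) / (1 - q))"
  using assms(1,2)
proof (induction n)
  case 0
  show ?case by simp
next
  case (Suc n)
  let ?I = "\<lambda>n u. \<Prod>a<n. \<Prod>b\<in>{a<..<n}. if u b < u a then q else 1"
  let ?W = "\<Sum>w | w permutes {..<n}. if \<forall>i<n. f (w i) = f i then ?I n w else 0"
  let ?m = "\<lambda>n i. card {k. k < n \<and> f k = i}"
  let ?t = "\<lambda>j. (1 - q ^ j) / (1 - q)"
  have stab: "(\<forall>i<Suc n. f ((rotate_to p n \<circ> w) i) = f i) \<longleftrightarrow> f p = f n \<and> (\<forall>i<n. f (w i) = f i)"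
    if p: "p \<le> n" and w: "w permutes {..<n}" for p w
  proof -
    have wn: "w n = n" using w by (simp add: permutes_not_in)
    have lt: "w i < n \<longleftrightarrow> i < n" for i using permutes_in_image[OF w, of i] by simp
    \<comment> \<open>By monotonicity \<open>f\<close> is constant from \<open>p\<close> to
      \<open>n\<close>, and the rotation moves only these positions.\<close>
    have "f (rotate_to p n x) = f x" if fp: "f p = f n" and x: "x < n" for x
    proof (cases "x < p")
      case False
      then have "f x \<le> f p" "f n \<le> f x" "f (Suc x) \<le> f p" "f n \<le> f (Suc x)"
        using Suc.prems(1) x by auto
      then show ?thesis using False x fp by (simp add: rotate_to_def)
    qed (simp add: rotate_to_def)
    then show ?thesis
      using lt p by (auto simp: less_Suc_eq wn rotate_to_def[of p n n])
  qed
  have "(\<Sum>u | u permutes {..<Suc n}. if \<forall>i<Suc n. f (u i) = f i then ?I (Suc n) u else 0)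
    = (\<Sum>p\<le>n. \<Sum>w | w permutes {..<n}. (if f p = f n then q ^ (n - p) else 0)
        * (if \<forall>i<n. f (w i) = f i then ?I n w else 0))"
    unfolding sum_permutes_Suc
  proof (intro sum.cong refl)
    fix p w assume "p \<in> {..n}" "w \<in> {w. w permutes {..<n}}"
    then have pw: "p \<le> n" "w permutes {..<n}" by auto
    show "(if \<forall>i<Suc n. f ((rotate_to p n \<circ> w) i) = f i then ?I (Suc n) (rotate_to p n \<circ> w) else 0)
        = (if f p = f n then q ^ (n - p) else 0) * (if \<forall>i<n. f (w i) = f i then ?I n w else 0)"
      unfolding stab[OF pw] inv_prod_rotate[OF pw(2,1)]
      by (auto simp del: prod_zero_iff)
  qed
  also have "\<dots> = (\<Sum>p\<le>n. if f p = f n then q ^ (n - p) else 0) * ?W"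
    by (rule sum_product[symmetric])
  also have "(\<Sum>p\<le>n. if f p = f n then q ^ (n - p) else 0) = ?t (?m (Suc n) (f n))"
  proof -
    \<comment> \<open>Counted back from \<open>n\<close>, the block of \<open>f n\<close> is an
      initial segment, so the sum is a geometric one.\<close>
    let ?A = "{j. j \<le> n \<and> f (n - j) = f n}"
    have fin: "finite ?A" by simp
    have A: "?A = {..<card ?A}"
    proof (rule finite_downclosed[OF fin])
      fix i j assume ij: "i \<le> j" "j \<in> ?A"
      have "f (n - i) \<le> f (n - j)" "f n \<le> f (n - i)"
        using Suc.prems(1)[of "n - j" "n - i"] Suc.prems(1)[of "n - i" n] ij(1) by simp_all
      then show "i \<in> ?A" using ij by simp
    qed
    have "(\<Sum>p\<le>n. if f p = f n then q ^ (n - p) else 0) = (\<Sum>p | p \<le> n \<and> f p = f n. q ^ (n - p))"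
      by (simp add: sum.If_cases Int_def)
    also have "\<dots> = (\<Sum>j\<in>?A. q ^ j)"
      by (rule sum.reindex_bij_witness[where i = "\<lambda>j. n - j" and j = "\<lambda>p. n - p"]) auto
    also have "\<dots> = ?t (card ?A)"
      by (subst A) (simp add: sum_gp_strict assms(3))
    also have "card ?A = ?m (Suc n) (f n)"
      by (rule bij_betw_same_card[of "\<lambda>j. n - j"], rule bij_betw_byWitness[where f' = "\<lambda>p. n - p"]) auto
    finally show ?thesis .
  qed
  also have "?W = (\<Prod>i\<le>M. \<Prod>j = 1..?m n i. ?t j)"
    by (rule Suc.IH) (use Suc.prems in auto)
  also have "?t (?m (Suc n) (f n)) * (\<Prod>i\<le>M. \<Prod>j = 1..?m n i. ?t j) = (\<Prod>i\<le>M. \<Prod>j = 1..?m (Suc n) i. ?t j)"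
  proof -
    have m: "?m (Suc n) i = (if i = f n then Suc (?m n i) else ?m n i)" for i
    proof -
      have "{k. k < Suc n \<and> f k = i} = (if i = f n then insert n {k. k < n \<and> f k = i} else {k. k < n \<and> f k = i})"
        by (auto simp: less_Suc_eq)
      then show ?thesis by simp
    qed
    have "(\<Prod>j = 1..?m (Suc n) i. ?t j) = (if i = f n then ?t (?m (Suc n) (f n)) else 1) * (\<Prod>j = 1..?m n i. ?t j)" for i
      by (simp add: m mult.commute)
    moreover have "f n \<le> M" using Suc.prems(2) by simp
    ultimately show ?thesis by (simp add: prod.distrib)
  qed
  finally show ?case .
qed

section \<open>The Hall--Littlewood polynomials\<close>

lemma relabel_single: "inj \<pi> \<Longrightarrow> relabel \<pi> (Poly_Mapping.single i k) = Poly_Mapping.single (\<pi> i) k"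
proof (rule poly_mapping_eqI)
  fix j assume inj: "inj \<pi>"
  show "lkp (relabel \<pi> (Poly_Mapping.single i k)) j = lkp (Poly_Mapping.single (\<pi> i) k) j"
  proof (cases "j \<in> range \<pi>")
    case True
    then show ?thesis using inj by (auto simp: lookup_single when_def inj_eq)
  next
    case False
    then have "\<pi> i \<noteq> j" by auto
    then show ?thesis using False by (simp add: lookup_relabel_notin[OF inj] lookup_single)
  qed
qed

lemma push_relabel_xvr: "inj \<pi> \<Longrightarrow> push (relabel \<pi>) (xvr a) = xvr (\<pi> a)"
  by (simp add: push_xpow monomial_hom_relabel relabel_single)

definition vand :: "nat \<Rightarrow> 'a :: comm_ring_1 mps"
  where "vand n = (\<Prod>a<n. \<Prod>b\<in>{a<..<n}. xvr a - xvr b)"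

text \<open>What a pair \<open>a < b\<close> leaves over the common denominator
  \<open>x_a - x_b\<close>. If it is inverted, its denominator \<open>x_b - x_a\<close> is negated,
  which turns the numerator \<open>x_b - q x_a\<close> into \<open>q x_a - x_b\<close>.\<close>

definition HL_pair :: "'a :: comm_ring_1 \<Rightarrow> (nat \<Rightarrow> nat) \<Rightarrow> nat \<Rightarrow> nat \<Rightarrow> 'a mps"
  where "HL_pair q u a b = (if u b < u a then mps_scale q (xvr a) - xvr b else xvr a - mps_scale q (xvr b))"

text \<open>The numerator of the symmetrization over the Vandermonde product; the sum runs over the
  inverses of the permutations in the definition of the Hall--Littlewood polynomial.\<close>

definition HL_num :: "'a :: comm_ring_1 \<Rightarrow> nat \<Rightarrow> composition \<Rightarrow> 'a mps"
  where "HL_num q n \<mu> = (\<Sum>u | u permutes {..<n}. xpow (relabel (inv u) (comp_monomial \<mu>))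
    * (\<Prod>a<n. \<Prod>b\<in>{a<..<n}. HL_pair q u a b))"

lemma push_vand:
  assumes "\<sigma> permutes {..<n}"
  shows "push (relabel \<sigma>) (vand n) = perm_sign n \<sigma> * vand n"
proof -
  have inj: "inj \<sigma>" using assms by (rule permutes_inj)
  have "push (relabel \<sigma>) (vand n) = (\<Prod>a<n. \<Prod>b\<in>{a<..<n}. xvr (\<sigma> a) - xvr (\<sigma> b))"
    unfolding vand_def
    by (simp add: push_prod push_diff push_relabel_xvr inj monomial_hom_relabel)
  also have "\<dots> = perm_sign n \<sigma> * (\<Prod>a<n. \<Prod>b\<in>{a<..<n}. xvr a - xvr b)"
    by (rule prod_pairs_antisym[OF assms]) simp
  finally show ?thesis by (simp add: vand_def)
qed

text \<open>Permuting the variables reindexes the sum by \<open>u \<circ> inv \<sigma>\<close>. The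
  sign arises because \<open>HL_pair\<close> changes sign when its two indices are
  exchanged.\<close>

lemma push_HL_num:
  assumes \<sigma>: "\<sigma> permutes {..<n}"
  shows "push (relabel \<sigma>) (HL_num q n \<mu>) = perm_sign n \<sigma> * HL_num q n \<mu>"
proof -
  let ?F = "\<lambda>u. xpow (relabel (inv u) (comp_monomial \<mu>)) * (\<Prod>a<n. \<Prod>b\<in>{a<..<n}. HL_pair q u a b)"
  have inj: "inj \<sigma>" and bij: "bij \<sigma>" using \<sigma> by (auto intro: permutes_inj permutes_bij)
  have "push (relabel \<sigma>) (?F u) = perm_sign n \<sigma> * ?F (u \<circ> inv \<sigma>)" if u: "u permutes {..<n}" for u
  proof -
    let ?u = "u \<circ> inv \<sigma>"
    have us: "?u (\<sigma> a) = u a" for a using inj by (simp add: inv_f_f)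
    have u': "?u permutes {..<n}" using u \<sigma> by (intro permutes_compose permutes_inv)
    have injs: "inj (inv u)" "bij u" using u by (auto intro: permutes_inj permutes_inv permutes_bij)
    have "push (relabel \<sigma>) (HL_pair q u a b) = HL_pair q ?u (\<sigma> a) (\<sigma> b)" for a b
      unfolding HL_pair_def us by (simp add: push_diff push_scale push_relabel_xvr inj)
    moreover have "relabel \<sigma> (relabel (inv u) m) = relabel (inv ?u) m" for m
    proof -
      have "inv ?u = inv (inv \<sigma>) \<circ> inv u"
        using bij injs(2) by (intro o_inv_distrib) (auto intro: bij_imp_bij_inv)
      then show ?thesis using bij by (simp add: relabel_comp inj injs inv_inv_eq)
    qed
    moreover have "(\<Prod>a<n. \<Prod>b\<in>{a<..<n}. HL_pair q ?u (\<sigma> a) (\<sigma> b))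
        = perm_sign n \<sigma> * (\<Prod>a<n. \<Prod>b\<in>{a<..<n}. HL_pair q ?u a b)"
    proof (rule prod_pairs_antisym[OF \<sigma>])
      fix a b :: nat assume "a < b"
      then have "?u a \<noteq> ?u b" using permutes_inj[OF u'] by (metis injD less_irrefl)
      then show "HL_pair q ?u b a = - HL_pair q ?u a b" by (auto simp: HL_pair_def)
    qed
    ultimately show ?thesis
      by (simp add: push_times push_prod push_xpow monomial_hom_relabel inj mult.left_commute)
  qed
  then have "push (relabel \<sigma>) (HL_num q n \<mu>) = (\<Sum>u | u permutes {..<n}. perm_sign n \<sigma> * ?F (u \<circ> inv \<sigma>))"
    unfolding HL_num_def push_sum by (intro sum.cong) auto
  also have "\<dots> = perm_sign n \<sigma> * (\<Sum>u | u permutes {..<n}. ?F (u \<circ> inv \<sigma>))"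
    by (rule sum_distrib_left[symmetric])
  also have "(\<Sum>u | u permutes {..<n}. ?F (u \<circ> inv \<sigma>)) = HL_num q n \<mu>"
    unfolding HL_num_def by (rule sum_permutations_compose_right[OF permutes_inv[OF \<sigma>], symmetric])
  finally show ?thesis .
qed

lemma push_trunc:
  assumes \<sigma>: "\<sigma> permutes {..<n}" and G: "sinv G"
  shows "push (relabel \<sigma>) (trunc n G) = trunc n G"
proof (rule push_eqI)
  have inj: "inj \<sigma>" and bij: "bij \<sigma>" using \<sigma> by (auto intro: permutes_inj permutes_bij)
  show "monomial_hom (relabel \<sigma>)" by (rule monomial_hom_relabel[OF inj])
  show "mps_coeff (trunc n G) (relabel \<sigma> m) = mps_coeff (trunc n G) m" for m
  proof -
    have "\<sigma> ` kys m \<subseteq> {..<n} \<longleftrightarrow> kys m \<subseteq> {..<n}"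
      using permutes_in_image[OF \<sigma>] by auto
    then show ?thesis by (simp add: keys_relabel inj sinvD[OF G])
  qed
  show "mps_coeff (trunc n G) m = 0" if "m \<notin> range (relabel \<sigma>)" for m
  proof -
    obtain k where "m = relabel \<sigma> k"
      using relabel_surj[OF inj, of m] bij_is_surj[OF bij] by auto
    then show ?thesis using that by simp
  qed
qed

lemma supp_sum:
  assumes "\<And>x. x \<in> A \<Longrightarrow> supp (f x) \<subseteq> S"
  shows "supp (sum f A) \<subseteq> S"
proof
  fix m assume "m \<in> supp (sum f A)"
  then have "\<exists>x\<in>A. mps_coeff (f x) m \<noteq> 0"
    by (auto simp: in_supp intro: sum.neutral)
  then show "m \<in> S" using assms unfolding subset_iff in_supp by blast
qed

lemma supp_vand: "supp (vand n) \<subseteq> {m. kys m \<subseteq> {..<n}}"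
  and supp_HL_num: "comp_length \<mu> \<le> n \<Longrightarrow> supp (HL_num q n \<mu>) \<subseteq> {m. kys m \<subseteq> {..<n}}"
proof -
  let ?S = "{m. kys m \<subseteq> {..<n}}"
  have S: "submonoid ?S" by (simp add: submonoid_def keys_add_monomial)
  have x: "supp (xvr a) \<subseteq> ?S" if "a < n" for a
    using supp_xpow[of "umon a"] that by auto
  show "supp (vand n) \<subseteq> ?S"
    unfolding vand_def by (intro supp_prod[OF S] supp_diff x) auto
  assume len: "comp_length \<mu> \<le> n"
  show "supp (HL_num q n \<mu>) \<subseteq> ?S"
    unfolding HL_num_def
  proof (rule supp_sum)
    fix u assume "u \<in> {u. u permutes {..<n}}"
    then have u: "inv u permutes {..<n}" by (simp add: permutes_inv)
    have "kys (comp_monomial \<mu>) \<subseteq> {..<n}" using keys_comp_monomial[of \<mu>] len by auto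
    then have "kys (relabel (inv u) (comp_monomial \<mu>)) \<subseteq> {..<n}"
      using permutes_image[OF u] by (auto simp: keys_relabel permutes_inj[OF u])
    then have "supp (xpow (relabel (inv u) (comp_monomial \<mu>))) \<subseteq> ?S"
      using supp_xpow by blast
    moreover have "supp (HL_pair q u a b) \<subseteq> ?S" if "a < n" "b < n" for a b
    proof -
      have "supp (mps_scale q (xvr a) - xvr b) \<subseteq> ?S" "supp (xvr a - mps_scale q (xvr b)) \<subseteq> ?S"
        by (intro supp_diff supp_scale x that)+
      then show ?thesis unfolding HL_pair_def by (cases "u b < u a") (simp_all only: if_True if_False)
    qed
    ultimately show "supp (xpow (relabel (inv u) (comp_monomial \<mu>)) * (\<Prod>a<n. \<Prod>b\<in>{a<..<n}. HL_pair q u a b)) \<subseteq> ?S"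
      by (intro supp_times[OF S] supp_prod[OF S]) auto
  qed
qed

text \<open>Multiplication by this series divides by the product of the \<open>x_a - q x_b\<close>,
  expanded in the ratios \<open>x_b / x_a\<close>, up to the monomial \<open>dmon n\<close>.\<close>

definition HL_geom :: "'a :: comm_ring_1 \<Rightarrow> nat \<Rightarrow> 'a mps"
  where "HL_geom q n = (\<Prod>a<n. \<Prod>b\<in>{a<..<n}. mps_geom (mps_scale q (xpow (zroot a b))))"

text \<open>The contribution of a permutation to the coefficients of the numerator divided by
  \<open>\<Prod>\<^bsub>a<b\<^esub> (x\<^sub>a - q x\<^sub>b)\<close>: each inversion gives a factor \<open>(q - y) / (1 - q y)\<close> with
  \<open>y = x\<^sub>b / x\<^sub>a\<close>.\<close>

definition HL_inv :: "'a :: comm_ring_1 \<Rightarrow> nat \<Rightarrow> (nat \<Rightarrow> nat) \<Rightarrow> 'a mps"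
  where "HL_inv q n u = (\<Prod>a<n. \<Prod>b\<in>{a<..<n}. if u b < u a
    then (mps_const q - xpow (zroot a b)) * mps_geom (mps_scale q (xpow (zroot a b))) else 1)"

text \<open>The staircase with exponents \<open>n - 1, ..., 1, 0\<close>, the leading monomial of
  the Vandermonde product.\<close>

definition dmon :: "nat \<Rightarrow> monomial"
  where "dmon n = (\<Sum>a<n. \<Sum>b\<in>{a<..<n}. umon a)"

lemma lookup_dmon: "lkp (dmon n) i = (if i < n then n - 1 - i else 0)"
proof -
  have "lkp (dmon n) i = (\<Sum>a<n. if a = i then n - 1 - a else 0)"
    unfolding dmon_def lookup_sum by (intro sum.cong) (auto simp: lookup_single when_def)
  then show ?thesis by simp
qed

lemma tail_sum: "tail (sum f A) = (\<Sum>x\<in>A. tail (f x))"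
  by (induction A rule: infinite_finite_induct) (auto simp: tail_add)

lemma xpow_tail_umon: "a < b \<Longrightarrow> xpow (tail (umon b)) = xpow (tail (umon a)) * xpow (zroot a b)"
  using tail_single_zroot[of a b] by (simp add: xpow_add)

lemma xpow_tail_dmon: "xpow (tail (dmon n)) = (\<Prod>a<n. \<Prod>b\<in>{a<..<n}. xpow (tail (umon a)))"
  unfolding dmon_def tail_sum xpow_sum ..

lemma push_tail_vand:
  "push tail (vand n) = xpow (tail (dmon n)) * (\<Prod>a<n. \<Prod>b\<in>{a<..<n}. 1 - xpow (zroot a b))"
  unfolding vand_def xpow_tail_dmon prod.distrib[symmetric] push_prod[OF monomial_hom_tail]
  by (intro prod.cong refl)
    (simp add: push_diff push_xpow monomial_hom_tail xpow_tail_umon right_diff_distrib)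

text \<open>The division turns the Vandermonde product into the kernel of the product formula, which
  lets coefficients of the numerator be read as pairings.\<close>

lemma push_tail_vand_HL_geom: "push tail (vand n) * HL_geom q n = xpow (tail (dmon n)) * HL_prod q n"
  unfolding push_tail_vand mult.assoc
  by (simp add: HL_geom_def HL_prod_def x_factor_def prod.distrib[symmetric])

lemma push_tail_HL_pair:
  assumes "a < b"
  shows "push tail (HL_pair q u a b) * mps_geom (mps_scale q (xpow (zroot a b)))
    = xpow (tail (umon a)) * (if u b < u a
        then (mps_const q - xpow (zroot a b)) * mps_geom (mps_scale q (xpow (zroot a b))) else 1)"
proof -
  let ?Y = "xpow (zroot a b) :: 'a mps" and ?X = "xpow (tail (umon a)) :: 'a mps"
  have "push tail (HL_pair q u a b) = ?X * (if u b < u a then mps_const q - ?Y else 1 - mps_scale q ?Y)"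
    by (simp add: HL_pair_def push_diff push_scale push_xpow monomial_hom_tail xpow_tail_umon[OF assms]
        right_diff_distrib times_mps_scale)
  moreover have "(1 - mps_scale q ?Y) * mps_geom (mps_scale q ?Y) = 1"
    by (rule mps_geom) (use zroot_nonzero[OF assms] in auto)
  ultimately show ?thesis by (simp add: mult.assoc)
qed

lemma push_tail_HL_num_HL_geom:
  "push tail (HL_num q n \<mu>) * HL_geom q n = xpow (tail (dmon n)) *
    (\<Sum>u | u permutes {..<n}. xpow (tail (relabel (inv u) (comp_monomial \<mu>))) * HL_inv q n u)"
proof -
  have "(\<Prod>a<n. \<Prod>b\<in>{a<..<n}. push tail (HL_pair q u a b)) * HL_geom q n
      = xpow (tail (dmon n)) * HL_inv q n u" for u
    unfolding HL_geom_def HL_inv_def xpow_tail_dmon prod.distrib[symmetric]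
    by (intro prod.cong refl) (simp add: push_tail_HL_pair)
  then have "push tail (xpow m * (\<Prod>a<n. \<Prod>b\<in>{a<..<n}. HL_pair q u a b)) * HL_geom q n
      = xpow (tail (dmon n)) * (xpow (tail m) * HL_inv q n u)" for m u
    by (simp add: push_times push_prod push_xpow monomial_hom_tail mult.assoc mult.left_commute)
  then show ?thesis
    unfolding HL_num_def push_sum sum_distrib_left sum_distrib_right by (intro sum.cong) auto
qed

lemma HL_inv_coeff_0: "mps_coeff (HL_inv q n u) 0 = (\<Prod>a<n. \<Prod>b\<in>{a<..<n}. if u b < u a then q else 1)"
proof -
  have "mps_coeff (if u b < u a then (mps_const q - xpow (zroot a b)) * mps_geom (mps_scale q (xpow (zroot a b))) else 1) 0
      = (if u b < u a then q else 1)" if "a < b" for a b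
    using zroot_nonzero[OF that] by simp
  then show ?thesis by (simp add: HL_inv_def)
qed

text \<open>Weighting position \<open>i\<close> by \<open>u i\<close> instead of \<open>i\<close> makes every inverted ratio \<open>x\<^sub>b / x\<^sub>a\<close>
  negative.  Comparing the two weights leaves only the constant term.\<close>

lemma HL_inv_support:
  assumes u: "u permutes {..<n}" and \<mu>: "decr m" "kys m \<subseteq> {..<n}" and l: "decr l" "kys l \<subseteq> {..<n}"
    and \<kappa>: "tail (relabel (inv u) m) + \<kappa> = tail l" "mps_coeff (HL_inv q n u) \<kappa> \<noteq> 0"
  shows "relabel (inv u) m = l"
proof -
  \<comment> \<open>In the variables \<open>z_j\<close> the weight that puts \<open>u i\<close> on
    \<open>x_i\<close> becomes the weight \<open>c j\<close> on \<open>z_j\<close>, since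
    \<open>x_i = z_0 ... z_i\<close> and the \<open>c j\<close> telescope to \<open>u i\<close>. The
    map \<open>ell\<close> is this weight.\<close>
  define c where "c j = (if j = 0 then int (u 0) else int (u j) - int (u (j - 1)))" for j
  define ell where "ell k = (\<Sum>j<n. c j * int (lkp k j))" for k
  have tele: "(\<Sum>j\<le>i. c j) = int (u i)" for i
    by (induction i) (simp_all add: c_def)
  have ell_add: "ell (a + b) = ell a + ell b" for a b
    by (simp add: ell_def lookup_add algebra_simps sum.distrib)
  have ell_zroot: "ell (zroot a b) = int (u b) - int (u a)" if "a < b" "b < n" for a b
  proof -
    have "ell (zroot a b) = (\<Sum>j<n. if j \<in> {a<..b} then c j else 0)"
      unfolding ell_def by (intro sum.cong) (auto simp: lookup_zroot)
    also have "\<dots> = (\<Sum>j\<in>{a<..b}. c j)"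
      by (rule sum.mono_neutral_cong_right) (use that in auto)
    also have "\<dots> = (\<Sum>j\<le>b. c j) - (\<Sum>j\<le>a. c j)"
    proof -
      have "{..b} = {..a} \<union> {a<..b}" using that by auto
      then show ?thesis by (simp add: sum.union_disjoint ivl_disj_int)
    qed
    finally show ?thesis by (simp add: tele)
  qed
  have ell_tail: "int (ht (relabel u k)) = ell (tail k) + int (mdeg k)" if k: "kys k \<subseteq> {..<n}" for k
  proof -
    have "ell (tail k) = (\<Sum>j<n. \<Sum>i<n. if j \<le> i then c j * int (lkp k i) else 0)"
      unfolding ell_def lookup_tail'[OF finite_lessThan k] of_nat_sum sum_distrib_left
      by (intro sum.cong) auto
    also have "\<dots> = (\<Sum>i<n. \<Sum>j<n. if j \<le> i then c j * int (lkp k i) else 0)"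
      by (rule sum.swap)
    also have "\<dots> = (\<Sum>i<n. int (u i) * int (lkp k i))"
    proof (intro sum.cong refl)
      fix i assume "i \<in> {..<n}"
      then have "{..<n} \<inter> {j. j \<le> i} = {..i}" by auto
      then show "(\<Sum>j<n. if j \<le> i then c j * int (lkp k i) else 0) = int (u i) * int (lkp k i)"
        by (simp add: sum.If_cases tele flip: sum_distrib_right)
    qed
    finally show ?thesis
      using ht_relabel[OF permutes_inj[OF u] k] mdeg_sum[OF finite_lessThan k]
      by (simp add: sum.distrib)
  qed
  let ?k = "relabel (inv u) m"
  \<comment> \<open>An inverted ratio has weight \<open>u b - u a < 0\<close>. Freedom from
    \<open>z_0\<close> is carried along to keep the degree fixed.\<close>
  let ?S = "{k. lkp k 0 = 0 \<and> ell k \<le> 0}"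
  have S: "submonoid ?S" by (auto simp: submonoid_def lookup_add ell_add) (simp add: ell_def)
  have "supp (if u b < u a then (mps_const q - xpow (zroot a b)) * mps_geom (mps_scale q (xpow (zroot a b))) else 1) \<subseteq> ?S"
    if ab: "a < b" "b < n" for a b
  proof (cases "u b < u a")
    case True
    then have "zroot a b \<in> ?S" using ab by (simp add: ell_zroot lookup_zroot)
    then have "supp (xpow (zroot a b) :: 'a mps) \<subseteq> ?S" using supp_xpow by blast
    then have "supp ((mps_const q - xpow (zroot a b)) * mps_geom (mps_scale q (xpow (zroot a b)))) \<subseteq> ?S"
      by (intro supp_times[OF S] supp_diff supp_scale supp_geom[OF S] supp_1[OF S])
    then show ?thesis by (simp only: True if_True)
  next
    case False
    then show ?thesis using supp_1[OF S] by (simp only: if_False)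
  qed
  then have "supp (HL_inv q n u) \<subseteq> ?S"
    unfolding HL_inv_def by (intro supp_prod[OF S]) simp_all
  then have k0: "lkp \<kappa> 0 = 0" and lk: "ell \<kappa> \<le> 0" using \<kappa>(2) by (auto simp: in_supp)
  have inv: "inv u permutes {..<n}" using u by (rule permutes_inv)
  have keys: "kys ?k \<subseteq> {..<n}"
    using \<mu>(2) permutes_image[OF inv] by (auto simp: keys_relabel permutes_inj[OF inv])
  have "mdeg l = mdeg ?k"
    using arg_cong[OF \<kappa>(1), of "\<lambda>k. lkp k 0"] k0 by (simp add: lookup_add lookup_tail_0)
  moreover have "ell (tail l) \<le> ell (tail ?k)" using lk by (simp add: ell_add flip: \<kappa>(1))
  ultimately have "ht (relabel u l) \<le> ht (relabel u ?k)"
    using ell_tail[OF keys] ell_tail[OF l(2)] by linarith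
  moreover have "relabel u ?k = m"
  proof -
    have "relabel u ?k = relabel (u \<circ> inv u) m"
      by (rule relabel_comp[OF permutes_inj[OF u] permutes_inj[OF inv]])
    also have "\<dots> = m"
      by (rule poly_mapping_eqI) (simp add: permutes_inv_o[OF u] lookup_relabel_bij)
    finally show ?thesis .
  qed
  moreover have "ht l \<le> ht (relabel u l)"
    by (rule ht_relabel_ge[OF permutes_inj[OF u] l(2)]) (use l(1) in \<open>simp add: decr_def\<close>)
  moreover have "ht m \<le> ht ?k"
    by (rule ht_relabel_ge[OF permutes_inj[OF inv] \<mu>(2)]) (use \<mu>(1) in \<open>simp add: decr_def\<close>)
  moreover have "ht l = ht ?k + mdeg \<kappa>" using arg_cong[OF \<kappa>(1), of mdeg] by simp
  \<comment> \<open>The chain is \<open>ht m \<le> ht ?k = ht l - mdeg \<kappa> \<le> ht (relabel u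
    l) - mdeg \<kappa> \<le> ht m - mdeg \<kappa>\<close>.\<close>
  ultimately have "mdeg \<kappa> = 0" by (simp del: mdeg_eq_0_iff)
  then have "\<kappa> = 0" by simp
  then show ?thesis using \<kappa>(1) by simp
qed

lemma HL_term_coeff:
  assumes u: "u permutes {..<n}" and \<mu>: "is_partition \<mu>" "comp_length \<mu> \<le> n"
    and l: "decr l" "kys l \<subseteq> {..<n}"
  shows "mps_coeff (xpow (tail (relabel (inv u) (comp_monomial \<mu>))) * HL_inv q n u) (tail l)
    = (if l = comp_monomial \<mu> then if \<forall>i<n. part \<mu> (u i) = part \<mu> i
        then \<Prod>a<n. \<Prod>b\<in>{a<..<n}. if u b < u a then q else 1 else 0 else 0)"
proof -
  let ?m = "comp_monomial \<mu>"
  let ?k = "relabel (inv u) ?m"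
  have m: "decr ?m" "kys ?m \<subseteq> {..<n}"
    using \<mu> decr_comp_monomial keys_comp_monomial[of \<mu>] by auto
  have inv: "inv u permutes {..<n}" "bij (inv u)" "inv (inv u) = u"
    using u by (auto intro: permutes_inv permutes_bij simp: permutes_inv_inv bij_imp_bij_inv)
  have lk: "lkp ?k i = part \<mu> (u i)" for i
    by (simp add: lookup_relabel_bij inv lookup_comp_monomial)
  have k_eq: "?k = ?m \<longleftrightarrow> (\<forall>i<n. part \<mu> (u i) = part \<mu> i)"
  proof
    assume "?k = ?m"
    then show "\<forall>i<n. part \<mu> (u i) = part \<mu> i" by (metis lk lookup_comp_monomial)
  next
    assume *: "\<forall>i<n. part \<mu> (u i) = part \<mu> i"
    show "?k = ?m"
    proof (rule poly_mapping_eqI)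
      fix i show "lkp ?k i = lkp ?m i"
        using * permutes_not_in[OF u, of i] by (cases "i < n") (auto simp: lk lookup_comp_monomial)
    qed
  qed
  show ?thesis
  proof (cases "?k = l")
    case True
    then have "?k = ?m" using decr_relabel_eq[OF permutes_inj[OF inv(1)] m(1)] l(1) by simp
    moreover have "mps_coeff (xpow (tail ?k) * HL_inv q n u) (tail ?k + 0) = mps_coeff (HL_inv q n u) 0"
      by (rule mps_coeff_xpow_times)
    ultimately show ?thesis using True k_eq by (simp add: HL_inv_coeff_0)
  next
    case False
    have "mps_coeff (xpow (tail ?k) * HL_inv q n u) (tail l) = 0"
    proof (rule ccontr)
      assume nz: "mps_coeff (xpow (tail ?k) * HL_inv q n u) (tail l) \<noteq> 0"
      then obtain a b where "a + b = tail l" "mps_coeff (xpow (tail ?k)) a \<noteq> (0 :: 'a)"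
        "mps_coeff (HL_inv q n u) b \<noteq> 0"
        by (rule times_coeff_nonzeroE)
      then have "tail ?k + b = tail l" "mps_coeff (HL_inv q n u) b \<noteq> 0"
        by (auto split: if_splits)
      then show False using HL_inv_support[OF u m l] False by blast
    qed
    then show ?thesis using False k_eq by auto
  qed
qed

text \<open>Divisors of \<open>tail l\<close> involve the first \<open>n\<close> variables only, and
  \<open>tail\<close> neither adds nor loses variables beyond that bound.\<close>

lemma push_tail_trunc_coeff:
  assumes "kys l \<subseteq> {..<n}"
  shows "mps_coeff (push tail (trunc n G) * P) (tail l) = mps_coeff (push tail G * P) (tail l)"
proof (rule mps_coeff_times_cong)
  fix a b assume "a + b = tail l"
  moreover have "kys (tail l) \<subseteq> {..<n}" using assms by (simp add: keys_tail)
  ultimately have a: "kys a \<subseteq> {..<n}" by (metis keys_add_monomial le_supE)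
  show "mps_coeff (push tail (trunc n G)) a = mps_coeff (push tail G) a"
  proof (cases "a \<in> range tail")
    case True
    then show ?thesis using a by (auto simp: push_coeff monomial_hom_tail keys_tail)
  qed (simp add: push_coeff_notin)
qed simp

text \<open>The two sides are antisymmetric polynomials, so a monomial of minimal height in their
  difference may be taken strictly decreasing; dividing by \<open>\<Prod>\<^bsub>a<b\<^esub> (x\<^sub>a - q x\<^sub>b)\<close> its coefficient
  is read off from the pairing with the dual basis.\<close>

theorem HL_numerator:
  fixes q :: "'a :: field"
  assumes two: "(2 :: 'a) \<noteq> 0" and \<mu>: "is_partition \<mu>" "comp_length \<mu> \<le> n"
    and G: "G \<in> Sym" "\<And>\<kappa>. is_partition \<kappa> \<Longrightarrow> pairing (HL_gen q \<kappa>) G = (if \<kappa> = \<mu> then 1 else 0)"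
    and v: "v = (\<Sum>u | u permutes {..<n}. if \<forall>i<n. part \<mu> (u i) = part \<mu> i
      then \<Prod>a<n. \<Prod>b\<in>{a<..<n}. if u b < u a then q else 1 else 0)"
  shows "mps_scale v (trunc n G * vand n) = HL_num q n \<mu>"
proof (rule ccontr)
  assume neq: "mps_scale v (trunc n G * vand n) \<noteq> HL_num q n \<mu>"
  define D where "D = mps_scale v (trunc n G * vand n) - HL_num q n \<mu>"
  have sG: "sinv G" using G(1) by (simp add: Sym_iff)
  have pushD: "push (relabel \<sigma>) D = perm_sign n \<sigma> * D" if "\<sigma> permutes {..<n}" for \<sigma>
    using monomial_hom_relabel[OF permutes_inj[OF that]]
    by (simp add: D_def push_diff push_scale push_times push_vand[OF that] push_HL_num[OF that]
        push_trunc[OF that sG] right_diff_distrib times_mps_scale mult.left_commute)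
  have coeffD: "mps_coeff (perm_sign n \<sigma> * D) (relabel \<sigma> m) = mps_coeff D m" if "\<sigma> permutes {..<n}" for \<sigma> m
    using push_coeff[OF monomial_hom_relabel[OF permutes_inj[OF that]], of D m] pushD[OF that] by simp
  have suppD: "kys m \<subseteq> {..<n}" if "mps_coeff D m \<noteq> 0" for m
  proof -
    have S: "submonoid {m. kys m \<subseteq> {..<n}}" by (simp add: submonoid_def keys_add_monomial)
    have "supp (trunc n G) \<subseteq> {m. kys m \<subseteq> {..<n}}" by (auto simp: in_supp split: if_splits)
    then have "supp D \<subseteq> {m. kys m \<subseteq> {..<n}}"
      unfolding D_def by (intro supp_diff supp_scale supp_times[OF S] supp_vand supp_HL_num \<mu>(2))
    then show ?thesis using that by (auto simp: in_supp)
  qed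
  have "\<exists>m. mps_coeff D m \<noteq> 0" using neq by (auto simp: D_def intro: mps_eqI)
  then obtain m where m: "mps_coeff D m \<noteq> 0" "\<And>k. mps_coeff D k \<noteq> 0 \<Longrightarrow> ht m \<le> ht k"
    using ex_has_least_nat[of "\<lambda>m. mps_coeff D m \<noteq> 0" _ ht] by blast
  obtain \<sigma> where \<sigma>: "\<sigma> permutes {..<n}" "decr (relabel \<sigma> m)"
    using ex_sorting_permutation[OF suppD[OF m(1)]] .
  define \<beta> where "\<beta> = relabel \<sigma> m"
  have \<beta>nz: "mps_coeff D \<beta> \<noteq> 0"
    using coeffD[OF \<sigma>(1), of m] m(1) perm_sign_cases[of n \<sigma>, where 'a = "'a mps"]
    by (auto simp: \<beta>_def)
  have \<beta>keys: "kys \<beta> \<subseteq> {..<n}" by (rule suppD[OF \<beta>nz])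
  \<comment> \<open>Sorting the exponents does not raise the height, so \<open>\<beta>\<close> is
    again of minimal height in \<open>D\<close>.\<close>
  have "ht \<beta> \<le> ht (relabel (inv \<sigma>) \<beta>)"
    by (rule ht_relabel_ge[OF _ \<beta>keys]) (use \<sigma> in \<open>auto simp: \<beta>_def decr_def intro: permutes_inj permutes_inv\<close>)
  also have "relabel (inv \<sigma>) \<beta> = m"
  proof -
    have "relabel (inv \<sigma>) \<beta> = relabel (inv \<sigma> \<circ> \<sigma>) m"
      unfolding \<beta>_def by (rule relabel_comp) (use \<sigma>(1) in \<open>auto intro: permutes_inj permutes_inv\<close>)
    also have "\<dots> = m"
      by (rule poly_mapping_eqI) (simp add: permutes_inv_o[OF \<sigma>(1)] lookup_relabel_bij)
    finally show ?thesis .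
  qed
  finally have \<beta>min: "ht \<beta> \<le> ht k" if "mps_coeff D k \<noteq> 0" for k
    using m(2)[OF that] by linarith
  have strict: "lkp \<beta> (Suc i) < lkp \<beta> i" if i: "Suc i < n" for i
  proof (rule ccontr)
    assume "\<not> lkp \<beta> (Suc i) < lkp \<beta> i"
    moreover have "lkp \<beta> (Suc i) \<le> lkp \<beta> i" using \<sigma>(2) by (simp add: decr_def \<beta>_def)
    ultimately have eq: "lkp \<beta> (Suc i) = lkp \<beta> i" by simp
    let ?t = "transpose i (Suc i)"
    have t: "?t permutes {..<n}" using i by (intro permutes_swap_id) auto
    have "relabel ?t \<beta> = \<beta>"
      by (rule poly_mapping_eqI) (use eq in \<open>simp add: lookup_relabel_bij transpose_def\<close>)
    \<comment> \<open>Two equal neighbouring exponents would make the coefficient its own negative;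
      this is where characteristic 2 is excluded.\<close>
    then have "- mps_coeff D \<beta> = mps_coeff D \<beta>"
      using coeffD[OF t, of \<beta>] i by (simp add: perm_sign_adjacent)
    then have "2 * mps_coeff D \<beta> = 0" by (simp add: neg_eq_iff_add_eq_0)
    then show False using two \<beta>nz by simp
  qed
  \<comment> \<open>Strict decrease, counted back from position \<open>n - 1\<close>, makes
    \<open>\<beta>\<close> divisible by the staircase \<open>dmon n\<close>; the quotient
    \<open>l\<close> is still weakly decreasing.\<close>
  have below: "n - 1 - i \<le> lkp \<beta> i" if "i < n" for i
  proof -
    have "k \<le> lkp \<beta> (n - 1 - k)" if "k < n" for k
      using that
    proof (induction k)
      case (Suc k)
      then have "lkp \<beta> (Suc (n - 1 - Suc k)) < lkp \<beta> (n - 1 - Suc k)" by (intro strict) auto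
      moreover have "Suc (n - 1 - Suc k) = n - 1 - k" using Suc.prems by simp
      ultimately show ?case using Suc by simp
    qed simp
    from this[of "n - 1 - i"] that show ?thesis by simp
  qed
  define l where "l = \<beta> - dmon n"
  have ll: "lkp l i = (if i < n then lkp \<beta> i - (n - 1 - i) else 0)" for i
    using \<beta>keys by (auto simp: l_def lookup_minus lookup_dmon in_keys_iff)
  have \<beta>: "\<beta> = dmon n + l"
  proof (rule poly_mapping_eqI)
    fix i
    have "lkp \<beta> i = 0" if "\<not> i < n" using that \<beta>keys by (auto simp: subset_iff in_keys_iff)
    then show "lkp \<beta> i = lkp (dmon n + l) i"
      using below[of i] by (cases "i < n") (simp_all add: lookup_add lookup_dmon ll)
  qed
  have lkeys: "kys l \<subseteq> {..<n}" by (auto simp: in_keys_iff ll split: if_splits)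
  have ldecr: "decr l"
  proof (rule decrI[OF lkeys])
    fix i assume "Suc i < n"
    then show "lkp l (Suc i) \<le> lkp l i" using strict[of i] below[of "Suc i"] by (simp add: ll)
  qed
  let ?\<kappa> = "part_of l"
  have \<kappa>: "comp_monomial ?\<kappa> = l" by (rule comp_monomial_part_of[OF ldecr])
  have \<kappa>\<mu>: "l = comp_monomial \<mu> \<longleftrightarrow> ?\<kappa> = \<mu>"
    using \<kappa> part_of_comp_monomial[OF \<mu>(1)] by metis
  \<comment> \<open>\<open>HL_geom\<close> has constant term 1, so by minimality of
    \<open>\<beta>\<close> the division does not change this coefficient.\<close>
  have "mps_coeff D \<beta> = mps_coeff (push tail D * HL_geom q n) (tail \<beta>)"
    by (rule push_tail_diag[symmetric]) (use \<beta>min zroot_nonzero in \<open>auto simp: HL_geom_def\<close>)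
  also have "push tail D * HL_geom q n = xpow (tail (dmon n)) *
      (mps_scale v (push tail (trunc n G) * HL_prod q n)
        - (\<Sum>u | u permutes {..<n}. xpow (tail (relabel (inv u) (comp_monomial \<mu>))) * HL_inv q n u))"
    by (simp add: D_def push_diff push_scale push_times monomial_hom_tail left_diff_distrib
        right_diff_distrib mps_scale_times times_mps_scale mult.assoc push_tail_vand_HL_geom
        push_tail_HL_num_HL_geom mult.left_commute[of "push tail (trunc n G)"])
  also have "mps_coeff \<dots> (tail \<beta>) = v * mps_coeff (push tail (trunc n G) * HL_prod q n) (tail l)
      - (\<Sum>u | u permutes {..<n}. mps_coeff (xpow (tail (relabel (inv u) (comp_monomial \<mu>))) * HL_inv q n u) (tail l))"
    unfolding \<beta> tail_add mps_coeff_xpow_times by simp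
  \<comment> \<open>The product formula is used with \<open>n\<close> variables, at least as many as
    \<open>?\<kappa>\<close> has parts.\<close>
  also have "mps_coeff (push tail (trunc n G) * HL_prod q n) (tail l) = pairing (HL_gen q ?\<kappa>) G"
    unfolding push_tail_trunc_coeff[OF lkeys]
      pairing_HL_gen_prod[OF Sym_QSym[OF G(1)] comp_length_part_of[OF lkeys]] \<kappa> ..
  also have "\<dots> = (if l = comp_monomial \<mu> then 1 else 0)"
    using G(2)[of ?\<kappa>] \<kappa>\<mu> by simp
  also have "(\<Sum>u | u permutes {..<n}. mps_coeff (xpow (tail (relabel (inv u) (comp_monomial \<mu>))) * HL_inv q n u) (tail l))
      = (if l = comp_monomial \<mu> then v else 0)"
    unfolding v by (simp add: HL_term_coeff[OF _ \<mu> ldecr lkeys])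
  finally show False using \<beta>nz by (simp split: if_splits)
qed


section \<open>Polynomials as power series, and the identification of \<open>HL_P\<close>\<close>

definition mps_of_poly :: "((nat \<Rightarrow>\<^sub>0 nat) \<Rightarrow>\<^sub>0 'a) \<Rightarrow> 'a :: comm_ring_1 mps"
  where "mps_of_poly p = Abs_mps (Poly_Mapping.lookup p)"

lemma mps_of_poly_add: "mps_of_poly (p + r) = mps_of_poly p + mps_of_poly r"
  and mps_of_poly_diff: "mps_of_poly (p - r) = mps_of_poly p - mps_of_poly r"
  and mps_of_poly_0: "mps_of_poly 0 = 0"
  by (auto intro!: mps_eqI simp: mps_of_poly_def lookup_add lookup_minus)

lemma mps_of_poly_single: "mps_of_poly (Poly_Mapping.single m c) = mps_scale c (xpow m)"
  by (rule mps_eqI) (simp add: mps_of_poly_def lookup_single when_def)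

text \<open>\<open>mps_of_poly\<close> is an injective ring homomorphism. It brings identities free
  of division back from series to the polynomial ring whose fraction field \<open>HL_P_vars\<close>
  lives in.\<close>

lemma mps_of_poly_times: "mps_of_poly (p * r) = mps_of_poly p * mps_of_poly r"
proof (induction p rule: update_induct)
  case (update f a b)
  have "mps_of_poly (Poly_Mapping.single a b * r) = mps_of_poly (Poly_Mapping.single a b) * mps_of_poly r"
  proof (induction r rule: update_induct)
    case (update g c d)
    have "mps_of_poly (Poly_Mapping.single a b * Poly_Mapping.single c d)
        = mps_of_poly (Poly_Mapping.single a b) * mps_of_poly (Poly_Mapping.single c d)"
      by (rule mps_eqI)
        (simp add: mult_single mps_of_poly_single xpow_add mps_scale_times times_mps_scale del: mps_coeff_xpow)
    then show ?case
      using update by (simp add: update_eq_add_single distrib_left mps_of_poly_add)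
  qed (simp add: mps_of_poly_0)
  then show ?case
    using update by (simp add: update_eq_add_single distrib_right mps_of_poly_add)
qed (simp add: mps_of_poly_0)

lemma mps_of_poly_1: "mps_of_poly 1 = 1"
  using mps_of_poly_single[of 0 1] by simp

lemma mps_of_poly_sum: "mps_of_poly (sum f A) = (\<Sum>x\<in>A. mps_of_poly (f x))"
  by (induction A rule: infinite_finite_induct) (auto simp: mps_of_poly_add mps_of_poly_0)

lemma mps_of_poly_prod: "mps_of_poly (prod f A) = (\<Prod>x\<in>A. mps_of_poly (f x))"
  by (induction A rule: infinite_finite_induct) (simp_all add: mps_of_poly_times mps_of_poly_1)

lemma mps_of_poly_inject: "mps_of_poly p = mps_of_poly r \<Longrightarrow> p = r"
  by (rule poly_mapping_eqI) (metis mps_coeff_Abs mps_of_poly_def)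

lemma mps_of_poly_restrict_vars:
  assumes "bounded_degree f"
  shows "mps_of_poly (restrict_vars n f) = trunc n f"
proof (rule mps_eqI)
  fix m
  obtain d where d: "\<And>m. mps_coeff f m \<noteq> 0 \<Longrightarrow> mdeg m \<le> d"
    using assms by (auto simp: bounded_degree_def)
  let ?A = "{m. (if kys m \<subseteq> {..<n} then mps_coeff f m else 0) \<noteq> 0}"
  \<comment> \<open>Every monomial of degree at most \<open>d\<close> in the first \<open>n\<close>
    variables divides \<open>?M\<close>, so the support is finite and
    \<open>Abs_poly_mapping\<close> is applied within its domain.\<close>
  let ?M = "\<Sum>i<n. Poly_Mapping.single i d"
  have "finite ?A"
  proof (rule finite_subset[OF _ finite_monomial_le[of ?M]], safe)
    fix a assume "(if kys a \<subseteq> {..<n} then mps_coeff f a else 0) \<noteq> 0"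
    then have a: "kys a \<subseteq> {..<n}" "mdeg a \<le> d" using d[of a] by (auto split: if_splits)
    have "lkp a i \<le> d" for i
    proof (cases "i \<in> kys a")
      case True
      then have "lkp a i \<le> mdeg a" unfolding mdeg_def by (intro member_le_sum) auto
      then show ?thesis using a(2) by simp
    qed (simp add: in_keys_iff)
    moreover have "lkp ?M i = (if i < n then d else 0)" for i
      by (simp add: lookup_sum lookup_single when_def)
    moreover have "lkp a i = 0" if "\<not> i < n" for i
      using a(1) that by (auto simp: subset_iff in_keys_iff)
    ultimately have "a + (?M - a) = ?M"
      by (intro poly_mapping_eqI) (simp add: lookup_add lookup_minus)
    then show "\<exists>b. a + b = ?M" by blast
  qed
  then show "mps_coeff (mps_of_poly (restrict_vars n f)) m = mps_coeff (trunc n f) m"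
    by (simp add: mps_of_poly_def restrict_vars_def)
qed

lemma to_fract_prod: "to_fract (prod f A) = (\<Prod>x\<in>A. to_fract (f x))"
  by (induction A rule: infinite_finite_induct) simp_all

lemma to_fract_sum: "to_fract (sum f A) = (\<Sum>x\<in>A. to_fract (f x))"
  by (induction A rule: infinite_finite_induct) simp_all

lemma to_fract_power: "to_fract (x ^ k) = to_fract x ^ k"
  by (induction k) simp_all

lemma qvar_power_neq_1:
  assumes "0 < j"
  shows "qvar ^ j \<noteq> 1"
proof
  assume "qvar ^ j = 1"
  then have "to_fract (monom 1 1 ^ j :: rat poly) = to_fract 1"
    by (simp add: qvar_def to_fract_power)
  then have "(monom 1 1 ^ j :: rat poly) = 1" by (simp only: to_fract_eq_iff)
  then have "degree (monom (1 :: rat) j) = 0" by (simp add: monom_power)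
  then show False using assms by (simp add: degree_monom_eq)
qed

lemma HL_v_nonzero: "HL_v n \<nu> \<noteq> 0"
proof -
  have "qvar ^ j \<noteq> 1" if "Suc 0 \<le> j" for j
    using qvar_power_neq_1[of j] that by simp
  moreover from this[of 1] have "qvar \<noteq> 1" by simp
  ultimately show ?thesis by (simp add: HL_v_def)
qed

lemma HL_v_eq:
  assumes "is_partition \<mu>"
  shows "HL_v n \<mu> = (\<Sum>u | u permutes {..<n}. if \<forall>i<n. part \<mu> (u i) = part \<mu> i
      then \<Prod>a<n. \<Prod>b\<in>{a<..<n}. if u b < u a then qvar else 1 else 0)"
  unfolding HL_v_def
proof (rule stabilizer_inversions[symmetric])
  show "part \<mu> j \<le> part \<mu> i" if "i \<le> j" for i j by (rule partition_antimono[OF assms that])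
  show "part \<mu> i \<le> comp_size \<mu>" for i
    by (auto simp: part_def nth_default_def comp_size_def intro: member_le_sum_list)
  show "qvar \<noteq> 1" using qvar_power_neq_1[of 1] by simp
qed

text \<open>The symmetrization is multiplied by the Vandermonde product \<open>V\<close>, which
  makes it the polynomial \<open>N\<close>. There \<open>HL_numerator\<close> applies, and the
  nonzero factors \<open>V\<close> and \<open>HL_v n \<mu>\<close> are cancelled in the fraction
  field at the end.\<close>

lemma HL_P_vars_eq:
  assumes \<mu>: "is_partition \<mu>" "comp_length \<mu> \<le> n"
  shows "HL_P_vars n \<mu> = to_fract (restrict_vars n (HL_dual qvar \<mu>))"
proof -
  let ?G = "HL_dual qvar \<mu>"
  let ?R = "restrict_vars n ?G"
  let ?v = "HL_v n \<mu>"
  let ?P = "\<lambda>f. \<Prod>a<n. \<Prod>b\<in>{a<..<n}. f a b"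
  define X :: "nat \<Rightarrow> (nat \<Rightarrow>\<^sub>0 nat) \<Rightarrow>\<^sub>0 ratfun" where "X i = Poly_Mapping.single (umon i) 1" for i
  define C :: "ratfun \<Rightarrow> (nat \<Rightarrow>\<^sub>0 nat) \<Rightarrow>\<^sub>0 ratfun" where "C c = Poly_Mapping.single 0 c" for c
  define g where "g u a b = (if u b < u a then C qvar * X a - X b else X a - C qvar * X b)" for u :: "nat \<Rightarrow> nat" and a b
  define V where "V = ?P (\<lambda>a b. X a - X b)"
  define N where "N = (\<Sum>u | u permutes {..<n}. (\<Prod>i<n. X (inv u i) ^ part \<mu> i) * ?P (g u))"
  have X: "mps_of_poly (X i) = xvr i" and C: "mps_of_poly (C c) = mps_const c" for i c
    by (simp_all add: X_def C_def mps_of_poly_single)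
  have xvar: "xvar i = to_fract (X i)" and const: "const_poly c = to_fract (C c)" for i c
    by (simp_all add: xvar_def X_def const_poly_def C_def)
  have G: "?G \<in> Sym" by (rule HL_dual(1)[OF \<mu>(1)])
  have "mps_of_poly ((\<Prod>i<n. X (inv u i) ^ part \<mu> i) * ?P (g u))
      = xpow (relabel (inv u) (comp_monomial \<mu>)) * ?P (HL_pair qvar u)" if u: "u permutes {..<n}" for u
  proof -
    have "X i ^ k = Poly_Mapping.single (Poly_Mapping.single i k) 1" for i k
      by (induction k) (simp_all add: X_def mult_single single_add[symmetric])
    then have "mps_of_poly (\<Prod>i<n. X (inv u i) ^ part \<mu> i) = xpow (\<Sum>i<n. Poly_Mapping.single (inv u i) (part \<mu> i))"
      by (simp add: mps_of_poly_prod mps_of_poly_single xpow_sum)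
    also have "(\<Sum>i<n. Poly_Mapping.single (inv u i) (part \<mu> i)) = relabel (inv u) (comp_monomial \<mu>)"
    proof (rule poly_mapping_eqI)
      fix a
      have bij: "bij (inv u)" "inv (inv u) = u"
        using u by (auto intro: permutes_bij permutes_inv simp: permutes_inv_inv)
      have "part \<mu> i = 0" if "\<not> i < n" for i
        using that \<mu>(2) by (simp add: part_def nth_default_def comp_length_def)
      then have "part \<mu> (u a) = (\<Sum>i<n. if i = u a then part \<mu> i else 0)" by simp
      also have "\<dots> = (\<Sum>i<n. if inv u i = a then part \<mu> i else 0)"
        using permutes_inv_eq[OF u] by (intro sum.cong) auto
      finally show "lkp (\<Sum>i<n. Poly_Mapping.single (inv u i) (part \<mu> i)) a = lkp (relabel (inv u) (comp_monomial \<mu>)) a"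
        by (simp add: lookup_sum lookup_single when_def lookup_relabel_bij[OF bij(1)] bij(2) lookup_comp_monomial)
    qed
    moreover have "mps_of_poly (?P (g u)) = ?P (HL_pair qvar u)"
    proof -
      have "mps_of_poly (g u a b) = HL_pair qvar u a b" for a b
        by (simp add: g_def HL_pair_def mps_of_poly_diff mps_of_poly_times X C mps_const_times)
      then show ?thesis by (simp add: mps_of_poly_prod)
    qed
    ultimately show ?thesis by (simp add: mps_of_poly_times)
  qed
  then have "mps_of_poly N = HL_num qvar n \<mu>"
    unfolding N_def HL_num_def mps_of_poly_sum by (intro sum.cong) auto
  also have "\<dots> = mps_scale ?v (trunc n ?G * vand n)"
  proof (rule HL_numerator[symmetric, OF _ \<mu> G _ HL_v_eq[OF \<mu>(1)]])
    have "to_fract (2 :: rat poly) \<noteq> 0" by (simp only: to_fract_eq_0_iff)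
    moreover have "to_fract (2 :: rat poly) = 2"
      by (metis one_add_one to_fract_1 to_fract_add)
    ultimately show "(2 :: ratfun) \<noteq> 0" by simp
  qed (rule HL_dual(2)[OF \<mu>(1)])
  also have "\<dots> = mps_of_poly (C ?v * (?R * V))"
    using G by (simp add: mps_of_poly_times C mps_const_times V_def vand_def mps_of_poly_prod
        mps_of_poly_diff X mps_of_poly_restrict_vars Sym_iff)
  finally have N: "N = C ?v * (?R * V)" by (rule mps_of_poly_inject)
  have Xneq: "X a \<noteq> X b" if "a < b" for a b
  proof
    assume "X a = X b"
    then have "Poly_Mapping.lookup (X a) (umon a) = Poly_Mapping.lookup (X b) (umon a)" by simp
    then have "umon b = umon a" by (simp add: X_def lookup_single when_def split: if_splits)
    then have "lkp (umon b) a = lkp (umon a) a" by simp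
    then show False using that by (simp add: lookup_single)
  qed
  let ?x = "\<lambda>i. to_fract (X i)" and ?q = "to_fract (C qvar)"
  have V: "to_fract V \<noteq> 0" using Xneq by (simp add: V_def to_fract_prod)
  have term_eq: "(\<Prod>i<n. \<Prod>j\<in>{i<..<n}. (?x (w i) - ?q * ?x (w j)) / (?x (w i) - ?x (w j))) * to_fract V
      = to_fract (?P (g (inv w)))" if w: "w permutes {..<n}" for w
  proof -
    let ?g = "\<lambda>a b. (?x a - ?q * ?x b) / (?x a - ?x b)"
    have pair: "(if inv w a < inv w b then ?g a b else ?g b a) * (?x a - ?x b) = to_fract (g (inv w) a b)"
      if ab: "a < b" for a b
    proof -
      have ne: "?x a - ?x b \<noteq> 0" "?x b - ?x a \<noteq> 0" using Xneq[OF ab] by auto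
      have "inv w a \<noteq> inv w b"
        using permutes_inj[OF permutes_inv[OF w]] ab by (metis injD less_irrefl)
      then consider "inv w a < inv w b" "\<not> inv w b < inv w a" | "inv w b < inv w a" "\<not> inv w a < inv w b"
        by linarith
      then show ?thesis
      proof cases
        case 1
        then show ?thesis using ne by (simp add: g_def)
      next
        case 2
        \<comment> \<open>The denominator of an inverted pair is \<open>x_b - x_a\<close>; its
          opposite sign accounts for the inverted case of \<open>g\<close>.\<close>
        have "?g b a * (?x a - ?x b) = - ((?x b - ?q * ?x a) / (?x b - ?x a) * (?x b - ?x a))"
          by (simp only: mult_minus_right[symmetric] minus_diff_eq)
        also have "\<dots> = ?q * ?x a - ?x b" using ne(2) by simp
        finally show ?thesis using 2 by (simp add: g_def)
      qed
    qed
    have "(\<Prod>i<n. \<Prod>j\<in>{i<..<n}. ?g (w i) (w j)) * to_fract V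
        = (\<Prod>a<n. \<Prod>b\<in>{a<..<n}. (if inv w a < inv w b then ?g a b else ?g b a) * (?x a - ?x b))"
      unfolding prod_pairs_permutes[OF w, of ?g] V_def to_fract_prod to_fract_diff prod.distrib ..
    also have "\<dots> = to_fract (?P (g (inv w)))"
      unfolding to_fract_prod by (intro prod.cong refl pair) simp
    finally show ?thesis .
  qed
  let ?S = "\<Sum>w | w permutes {..<n}. (\<Prod>i<n. xvar (w i) ^ part \<mu> i) *
      (\<Prod>i<n. \<Prod>j\<in>{i<..<n}. (xvar (w i) - const_poly qvar * xvar (w j)) / (xvar (w i) - xvar (w j)))"
  have "?S * to_fract V = (\<Sum>w | w permutes {..<n}. to_fract ((\<Prod>i<n. X (w i) ^ part \<mu> i) * ?P (g (inv w))))"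
    unfolding sum_distrib_right xvar const
    by (intro sum.cong refl) (simp only: mem_Collect_eq mult.assoc term_eq to_fract_mult, simp only: to_fract_prod to_fract_power)
  \<comment> \<open>\<open>HL_P_vars\<close> sums over \<open>w\<close> and the numerator over
    \<open>u = inv w\<close>.\<close>
  also have "\<dots> = to_fract N"
    unfolding N_def to_fract_sum
    by (subst sum_permutations_inverse) (auto intro!: sum.cong simp: permutes_inv_inv)
  also have "\<dots> = to_fract (C ?v) * to_fract ?R * to_fract V" by (simp add: N)
  finally have "?S = to_fract (C ?v) * to_fract ?R" using V by simp
  moreover have "to_fract (C ?v) \<noteq> 0"
  proof -
    have "Poly_Mapping.lookup (C ?v) 0 \<noteq> 0" by (simp add: C_def HL_v_nonzero)
    then have "C ?v \<noteq> 0" by (metis lookup_zero)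
    then show ?thesis by simp
  qed
  ultimately show ?thesis by (simp add: HL_P_vars_def const)
qed

lemma HL_P_eq:
  assumes "is_partition \<mu>"
  shows "HL_P \<mu> = HL_dual qvar \<mu>"
  unfolding HL_P_def
proof (rule the_equality)
  show *: "HL_dual qvar \<mu> \<in> Sym \<and>
      (\<forall>n\<ge>comp_length \<mu>. to_fract (restrict_vars n (HL_dual qvar \<mu>)) = HL_P_vars n \<mu>)"
    using HL_dual(1)[OF assms] HL_P_vars_eq[OF assms] by simp
  fix f assume f: "f \<in> Sym \<and> (\<forall>n\<ge>comp_length \<mu>. to_fract (restrict_vars n f) = HL_P_vars n \<mu>)"
  show "f = HL_dual qvar \<mu>"
  proof (rule mps_eqI)
    fix m
    obtain N where N: "kys m \<subseteq> {..<N}" by (meson finite_keys finite_nat_iff_bounded)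
    \<comment> \<open>Large enough for the description to apply and for the truncation to keep
      \<open>m\<close>; letting \<open>n\<close> depend on \<open>m\<close> gives equality of all
      coefficients.\<close>
    define n where "n = max N (comp_length \<mu>)"
    have n: "kys m \<subseteq> {..<n}" "comp_length \<mu> \<le> n" using N by (auto simp: n_def)
    have "to_fract (restrict_vars n f) = to_fract (restrict_vars n (HL_dual qvar \<mu>))"
      using f * n(2) by simp
    then have "restrict_vars n f = restrict_vars n (HL_dual qvar \<mu>)" by simp
    then have "trunc n f = trunc n (HL_dual qvar \<mu>)"
      using f * by (metis mps_of_poly_restrict_vars Sym_iff)
    then have "mps_coeff (trunc n f) m = mps_coeff (trunc n (HL_dual qvar \<mu>)) m" by simp
    then show "mps_coeff f m = mps_coeff (HL_dual qvar \<mu>) m" using n(1) by simp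
  qed
qed

theorem theorem4p12:
  "(\<forall>\<alpha>. HL_nsym \<alpha> \<in> range nsym_of_poly) \<and>
   (\<forall>n. NSym.independent (HL_nsym ` {\<alpha>. comp_size \<alpha> = n}) \<and>
        NSym.span (HL_nsym ` {\<alpha>. comp_size \<alpha> = n}) = NSym_deg n) \<and>
   (\<forall>\<nu>. is_partition \<nu> \<longrightarrow> chi (HL_nsym \<nu>) = HL_Q' \<nu>) \<and>
   (\<forall>\<alpha>. specialize 1 (HL_nsym \<alpha>) = H_comp \<alpha> \<and> specialize 0 (HL_nsym \<alpha>) = immaculate \<alpha>)"
proof (intro conjI allI impI)
  have HL: "HL_nsym = HL_gen qvar" by (intro ext) (rule HL_nsym_eq)
  show "HL_nsym \<alpha> \<in> range nsym_of_poly" for \<alpha> by (simp add: HL_nsym_of_poly)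
  show "NSym.independent (HL_nsym ` {\<alpha>. comp_size \<alpha> = n})"
    "NSym.span (HL_nsym ` {\<alpha>. comp_size \<alpha> = n}) = NSym_deg n" for n
    unfolding HL by (rule HL_gen_basis)+
  show "chi (HL_nsym \<nu>) = HL_Q' \<nu>" if "is_partition \<nu>" for \<nu>
    using HL_P_eq that by (rule chi_HL_eq_HL_Q')
  show "specialize 1 (HL_nsym \<alpha>) = H_comp \<alpha>" "specialize 0 (HL_nsym \<alpha>) = immaculate \<alpha>" for \<alpha>
    by (simp_all add: specialize_HL HL_gen_1 immaculate_eq)
qed

end
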